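(* Let $\mathcal G$ be a finite modular graph of genus $g$ with $n$ punctures. Then the isotropy group $\mathsf{OMG}(\mathcal G)$ of $\mathcal G$ in the outer modular groupoid $\mathbf{\Omega MG}$ surjects, via the natural homomorphism, onto $\mathsf{Out}(\pi_1(\mathcal G))$; that is, there is a surjection $\mathsf{OMG}(\mathcal G)\twoheadrightarrow\mathsf{Out}(\mathsf F_r)$, where $\mathsf F_r$ is the free group of rank $r=2g+n-1$.
   Context: **Modular graphs.** A modular graph is a connected bipartite ribbon graph $\mathcal G$ in which every edge joins a vertex of degree 2 to a vertex of degree 3 (multiple edges allowed); ribbon structure means a cyclic (counterclockwise) order of the edges at each vertex. Edges sharing a degree-2 vertex are called twins. For finite $\mathcal G$, a puncture is a closed left-turn path (turning left at every degree-3 vertex), up to choice of starting edge; the genus is that of the closed surface obtained by gluing discs along all left-turn closed paths. If $\mathcal G$ has genus $g$ and $n$ punctures, $\pi_1(\mathcal G)$ is free of rank $2g+n-1$. **Labelings, flips, relabelings, shuffles.** A labeling of $\mathcal G$ is a bijection $\ell:E(\mathcal G)\to\{1,\dots,|E(\mathcal G)|/2\}\times\{+,-\}$ such that twins carry labels $(k,+),(k,-)$ for some $k$ (with $\mathbb N$ in place of $\{1,\dots,|E(\mathcal G)|/2\}$ if $\mathcal G$ is infinite). Let $f$ be an edge of $(\mathcal G,\ell)$ with twin $e$. If $e,f$ have a second common vertex, the flip at $f$ does nothing. Otherwise let the degree-3 vertices of $f$ and $e$ have cyclic orders $(f,a,b)$ and $(e,d,c)$. The flip produces $(\mathcal G',\ell')$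 by replacing these two vertices by degree-3 vertices with cyclic orders $(e',c',a')$ and $(f',b',d')$, keeping $e',f'$ twins and leaving all else unchanged; $x'$ keeps the label of $x$. A relabeling changes only the labeling, by a permutation of the labels carrying each pair $\{(m,+),(m,-)\}$ to a pair $\{(k,+),(k,-)\}$. A shuffle reverses the cyclic order at one degree-3 vertex, leaving the underlying labeled graph unchanged. **Graph fundamental groupoid.** $\widetilde\Pi_1^{\mathcal G}$ has object set $E(\mathcal G)$, and morphisms the homotopy classes of paths in $\mathcal G$ between midpoints of edges; it is generated by length-2 paths $(x,y)_v$ through a common vertex $v$. A nontrivial flip at $f$ induces the isomorphism $\widetilde\Pi_1^{\mathcal G}\to\widetilde\Pi_1^{\mathcal G'}$ given on objects by $x\mapsto x'$ and on generators by $(a,f)\mapsto(a',e')(e',f')$, $(b,f)\mapsto(b',f')$, $(c,e)\mapsto(c',e')$, $(d,e)\mapsto(d',f')(f',e')$, $(f,e)\mapsto(f',e')$ (the first two through the degree-3 vertex of $f$, the next two through that of $e$, the last through their common degree-2 vertex), and $(x,y)_v\mapsto(x',y')_v$ for all other vertices $v$. Trivial flips, relabelings and shuffles induce the identity. **Outer modular groupoid.** $\mathbf{\Omega MG}$ has as objects the labeled modular graphs $|\mathcal G,\ell|$ up to label- and ribbon-structure-preserving isomorphism; morphisms $|\mathcal G_1,\ell_1|\to|\mathcal G_2,\ell_2|$ are the isomorphisms $\widetilde\Pi_1^{\mathcal G_1}\to\widetilde\Pi_1^{\mathcal G_2}$ induced by finite sequences of flips, shuffles and relabelings. $\mathsf{OMG}(\mathcal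 G)=\mathrm{Mor}_{\mathbf{\Omega MG}}(|\mathcal G,\ell|,|\mathcal G,\ell|)$ for a labeling $\ell$ (independent of $\ell$ up to isomorphism); it is a subgroup of $\mathsf{Aut}(\widetilde\Pi_1^{\mathcal G})$. **Natural homomorphism.** For a connected groupoid $\mathbf X$ and an object $x$, there is a homomorphism $\mathsf{Aut}(\mathbf X)\to\mathsf{Out}(\mathrm{Mor}(x,x))$ sending $\Xi$ to the class of $\gamma\mapsto\beta\cdot\Xi(\gamma)\cdot\beta^{-1}$ for any $\beta\in\mathrm{Mor}(x,\Xi(x))$. Applied to $\widetilde\Pi_1^{\mathcal G}$, whose isotropy groups are $\pi_1(\mathcal G)$, and restricted to $\mathsf{OMG}(\mathcal G)$, it gives $\mathsf{OMG}(\mathcal G)\to\mathsf{Out}(\pi_1(\mathcal G))$. *)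

theory Defs
  imports "HOL-Algebra.Coset" "HOL-Algebra.Bij" "HOL-Combinatorics.Orbits"
begin

section \<open>Outer automorphism groups and free groups\<close>

definition Inn :: "('a, 'b) monoid_scheme \<Rightarrow> ('a \<Rightarrow> 'a) set" where
  "Inn H = {\<lambda>h\<in>carrier H. a \<otimes>\<^bsub>H\<^esub> h \<otimes>\<^bsub>H\<^esub> inv\<^bsub>H\<^esub> a | a. a \<in> carrier H}"

definition Out :: "('a, 'b) monoid_scheme \<Rightarrow> ('a \<Rightarrow> 'a) set monoid" where
  "Out H = AutoGroup H Mod Inn H"

text \<open>The letter \<open>(s, True)\<close> is the generator \<open>s\<close>, and \<open>(s, False)\<close> is its inverse; the elements
  of the free group are the reduced words.\<close>

fun inverse_letter :: "'a \<times> bool \<Rightarrow> 'a \<times> bool" where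
  "inverse_letter (s, b) = (s, \<not> b)"

definition reduced :: "('a \<times> bool) list \<Rightarrow> bool" where
  "reduced w \<longleftrightarrow> successively (\<lambda>s t. t \<noteq> inverse_letter s) w"

fun push_letter :: "'a \<times> bool \<Rightarrow> ('a \<times> bool) list \<Rightarrow> ('a \<times> bool) list" where
  "push_letter s [] = [s]"
| "push_letter s (t # w) = (if t = inverse_letter s then w else s # t # w)"

definition free_group :: "'a set \<Rightarrow> ('a \<times> bool) list monoid" where
  "free_group S =
    \<lparr>carrier = {w. set w \<subseteq> S \<times> UNIV \<and> reduced w},
     monoid.mult = (\<lambda>v w. foldr push_letter v w),
     one = []\<rparr>"


section \<open>Groupoids\<close>

text \<open>Composition is written in path order: \<open>gpd_comp X m n\<close> is \<open>m\<close> followed by \<open>n\<close>, and is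
  meaningful only if \<open>gpd_tgt X m = gpd_src X n\<close>.\<close>

record ('o, 'm) groupoid =
  gpd_obj :: "'o set"
  gpd_mor :: "'m set"
  gpd_src :: "'m \<Rightarrow> 'o"
  gpd_tgt :: "'m \<Rightarrow> 'o"
  gpd_comp :: "'m \<Rightarrow> 'm \<Rightarrow> 'm"
  gpd_ident :: "'o \<Rightarrow> 'm"

definition gpd_hom :: "('o, 'm) groupoid \<Rightarrow> 'o \<Rightarrow> 'o \<Rightarrow> 'm set" where
  "gpd_hom X x y = {m \<in> gpd_mor X. gpd_src X m = x \<and> gpd_tgt X m = y}"

definition gpd_inv :: "('o, 'm) groupoid \<Rightarrow> 'm \<Rightarrow> 'm" where
  "gpd_inv X m = (THE n. n \<in> gpd_hom X (gpd_tgt X m) (gpd_src X m)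
      \<and> gpd_comp X m n = gpd_ident X (gpd_src X m)
      \<and> gpd_comp X n m = gpd_ident X (gpd_tgt X m))"

definition isotropy :: "('o, 'm) groupoid \<Rightarrow> 'o \<Rightarrow> 'm monoid" where
  "isotropy X x = \<lparr>carrier = gpd_hom X x x, monoid.mult = gpd_comp X, one = gpd_ident X x\<rparr>"

text \<open>A functor is the pair of its object map and its morphism map. Both maps are extensional, so
  that isomorphisms that agree as functors are equal.\<close>

type_synonym ('o, 'm) gpd_functor = "('o \<Rightarrow> 'o) \<times> ('m \<Rightarrow> 'm)"

definition gpd_iso :: "('o, 'm) groupoid \<Rightarrow> ('o, 'm) groupoid \<Rightarrow> ('o, 'm) gpd_functor set" where
  "gpd_iso X Y = {F.
      fst F \<in> extensional (gpd_obj X) \<and> bij_betw (fst F) (gpd_obj X) (gpd_obj Y)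
    \<and> snd F \<in> extensional (gpd_mor X) \<and> bij_betw (snd F) (gpd_mor X) (gpd_mor Y)
    \<and> (\<forall>m\<in>gpd_mor X. gpd_src Y (snd F m) = fst F (gpd_src X m)
                   \<and> gpd_tgt Y (snd F m) = fst F (gpd_tgt X m))
    \<and> (\<forall>x\<in>gpd_obj X. snd F (gpd_ident X x) = gpd_ident Y (fst F x))
    \<and> (\<forall>m\<in>gpd_mor X. \<forall>n\<in>gpd_mor X. gpd_tgt X m = gpd_src X n
          \<longrightarrow> snd F (gpd_comp X m n) = gpd_comp Y (snd F m) (snd F n))}"

definition functor_id :: "('o, 'm) groupoid \<Rightarrow> ('o, 'm) gpd_functor" where
  "functor_id X = (\<lambda>x\<in>gpd_obj X. x, \<lambda>m\<in>gpd_mor X. m)"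

text \<open>\<open>functor_comp X F' F\<close> is \<open>F'\<close> after \<open>F\<close>, where \<open>X\<close> is the domain of \<open>F\<close>.\<close>

definition functor_comp ::
  "('o, 'm) groupoid \<Rightarrow> ('o, 'm) gpd_functor \<Rightarrow> ('o, 'm) gpd_functor \<Rightarrow> ('o, 'm) gpd_functor" where
  "functor_comp X F' F =
    (compose (gpd_obj X) (fst F') (fst F), compose (gpd_mor X) (snd F') (snd F))"

definition gpd_Aut :: "('o, 'm) groupoid \<Rightarrow> ('o, 'm) gpd_functor monoid" where
  "gpd_Aut X = \<lparr>carrier = gpd_iso X X, monoid.mult = functor_comp X, one = functor_id X\<rparr>"

text \<open>For a connected groupoid the class does not depend on the choice of \<open>\<beta>\<close>: another choice
  changes the representative by an inner automorphism.\<close>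

definition natural_hom :: "('o, 'm) groupoid \<Rightarrow> 'o \<Rightarrow> ('o, 'm) gpd_functor \<Rightarrow> ('m \<Rightarrow> 'm) set" where
  "natural_hom X x F =
    (let H = isotropy X x;
         \<beta> = (SOME \<beta>. \<beta> \<in> gpd_hom X x (fst F x))
     in Inn H #>\<^bsub>AutoGroup H\<^esub>
          (\<lambda>\<gamma>\<in>carrier H. gpd_comp X (gpd_comp X \<beta> (snd F \<gamma>)) (gpd_inv X \<beta>)))"


section \<open>Ribbon graphs and modular graphs\<close>

text \<open>\<open>rot G v x\<close> is the edge following \<open>x\<close> in the counterclockwise order at \<open>v\<close>. Multiple edges
  are allowed; loops are not (ribbon graphs with loops are not needed, as modular graphs are
  bipartite).\<close>

record ('v, 'e) ribbon_graph =
  verts :: "'v set"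
  edges :: "'e set"
  ends :: "'e \<Rightarrow> 'v set"
  rot :: "'v \<Rightarrow> 'e \<Rightarrow> 'e"

definition incident :: "('v, 'e) ribbon_graph \<Rightarrow> 'v \<Rightarrow> 'e set" where
  "incident G v = {x \<in> edges G. v \<in> ends G x}"

definition degree :: "('v, 'e) ribbon_graph \<Rightarrow> 'v \<Rightarrow> nat" where
  "degree G v = card (incident G v)"

definition ribbon_graph :: "('v, 'e) ribbon_graph \<Rightarrow> bool" where
  "ribbon_graph G \<longleftrightarrow>
      (\<forall>x\<in>edges G. ends G x \<subseteq> verts G \<and> card (ends G x) = 2)
    \<and> (\<forall>v\<in>verts G. cyclic_on (rot G v) (incident G v))"

definition connected_graph :: "('v, 'e) ribbon_graph \<Rightarrow> bool" where
  "connected_graph G \<longleftrightarrow> verts G \<noteq> {}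
    \<and> (\<forall>u\<in>verts G. \<forall>v\<in>verts G. (u, v) \<in> {(s, t). \<exists>x\<in>edges G. ends G x = {s, t}}\<^sup>*)"

text \<open>Every vertex of a ribbon graph is incident to an edge, as \<open>cyclic_on\<close> requires a nonempty
  set. So in a modular graph every vertex has degree 2 or 3, and the degrees give the
  bipartition.\<close>

definition modular_graph :: "('v, 'e) ribbon_graph \<Rightarrow> bool" where
  "modular_graph G \<longleftrightarrow> ribbon_graph G \<and> connected_graph G
    \<and> (\<forall>x\<in>edges G. \<exists>u v. ends G x = {u, v} \<and> degree G u = 2 \<and> degree G v = 3)"

definition vert2 :: "('v, 'e) ribbon_graph \<Rightarrow> 'e \<Rightarrow> 'v" where
  "vert2 G x = (THE v. v \<in> ends G x \<and> degree G v = 2)"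

definition vert3 :: "('v, 'e) ribbon_graph \<Rightarrow> 'e \<Rightarrow> 'v" where
  "vert3 G x = (THE v. v \<in> ends G x \<and> degree G v = 3)"

definition twin :: "('v, 'e) ribbon_graph \<Rightarrow> 'e \<Rightarrow> 'e" where
  "twin G x = (THE y. y \<in> incident G (vert2 G x) \<and> y \<noteq> x)"

text \<open>A path that enters a degree-3 vertex with counterclockwise order \<open>(x, a, b)\<close> along \<open>x\<close> and
  turns left leaves along \<open>b\<close>, and enters the next degree-3 vertex along the twin of \<open>b\<close>. A left-turn
  path is recorded by the list of the edges along which it enters degree-3 vertices; \<open>distinct\<close>
  says that a closed path is traversed only once.\<close>

definition left_next :: "('v, 'e) ribbon_graph \<Rightarrow> 'e \<Rightarrow> 'e" where
  "left_next G x = twin G (rot G (vert3 G x) (rot G (vert3 G x) x))"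

definition closed_left_turn_path :: "('v, 'e) ribbon_graph \<Rightarrow> 'e list \<Rightarrow> bool" where
  "closed_left_turn_path G p \<longleftrightarrow> p \<noteq> [] \<and> distinct p \<and> set p \<subseteq> edges G
    \<and> (\<forall>i<length p. p ! ((i + 1) mod length p) = left_next G (p ! i))"

definition punctures :: "('v, 'e) ribbon_graph \<Rightarrow> 'e list set set" where
  "punctures G = {{rotate k p | k. True} | p. closed_left_turn_path G p}"

text \<open>Gluing discs along the closed left-turn paths of a finite modular graph gives a closed
  connected oriented surface with a cell structure whose 0-, 1- and 2-cells are the vertices, the
  edges and the discs. Its genus is the \<open>g\<close> for which its Euler characteristic is \<open>2 - 2 g\<close>.\<close>

definition surface_euler_char :: "('v, 'e) ribbon_graph \<Rightarrow> int" where
  "surface_euler_char G =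
    int (card (verts G)) - int (card (edges G)) + int (card (punctures G))"

definition has_genus :: "('v, 'e) ribbon_graph \<Rightarrow> nat \<Rightarrow> bool" where
  "has_genus G g \<longleftrightarrow> surface_euler_char G = 2 - 2 * int g"


section \<open>The graph fundamental groupoid\<close>

text \<open>The path \<open>(x\<^sub>0, [(v\<^sub>1, x\<^sub>1), \<dots>, (v\<^sub>k, x\<^sub>k)])\<close> runs from the midpoint of the edge \<open>x\<^sub>0\<close> through the
  vertex \<open>v\<^sub>1\<close> to the midpoint of \<open>x\<^sub>1\<close>, and so on. The vertices must be recorded, since two edges can
  have two common vertices.\<close>

type_synonym ('v, 'e) path = "'e \<times> ('v \<times> 'e) list"

fun path_end :: "('v, 'e) path \<Rightarrow> 'e" where
  "path_end (x, []) = x"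
| "path_end (x, (v, y) # p) = path_end (y, p)"

fun is_path :: "('v, 'e) ribbon_graph \<Rightarrow> ('v, 'e) path \<Rightarrow> bool" where
  "is_path G (x, []) \<longleftrightarrow> x \<in> edges G"
| "is_path G (x, (v, y) # p) \<longleftrightarrow> x \<in> incident G v \<and> y \<in> incident G v \<and> is_path G (y, p)"

text \<open>Since the star of a vertex is contractible, homotopy (with fixed endpoints) is generated by
  \<open>(y, y)\<^sub>v \<sim> 1\<close> and \<open>(x, y)\<^sub>v (y, z)\<^sub>v \<sim> (x, z)\<^sub>v\<close>.\<close>

inductive elem_homotopy :: "('v, 'e) ribbon_graph \<Rightarrow> ('v, 'e) path \<Rightarrow> ('v, 'e) path \<Rightarrow> bool"
  for G where
  stationary: "is_path G (x, p @ (v, y) # q) \<Longrightarrow> path_end (x, p) = y \<Longrightarrow>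
    elem_homotopy G (x, p @ (v, y) # q) (x, p @ q)"
| shortcut: "is_path G (x, p @ (v, y) # (v, z) # q) \<Longrightarrow>
    elem_homotopy G (x, p @ (v, y) # (v, z) # q) (x, p @ (v, z) # q)"

definition homotopic :: "('v, 'e) ribbon_graph \<Rightarrow> ('v, 'e) path \<Rightarrow> ('v, 'e) path \<Rightarrow> bool" where
  "homotopic G = equivclp (elem_homotopy G)"

definition homotopy_class :: "('v, 'e) ribbon_graph \<Rightarrow> ('v, 'e) path \<Rightarrow> ('v, 'e) path set" where
  "homotopy_class G p = {q. is_path G q \<and> homotopic G p q}"

definition path_rep :: "('v, 'e) path set \<Rightarrow> ('v, 'e) path" where
  "path_rep A = (SOME p. p \<in> A)"

definition fund_groupoid :: "('v, 'e) ribbon_graph \<Rightarrow> ('e, ('v, 'e) path set) groupoid" where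
  "fund_groupoid G =
    \<lparr>gpd_obj = edges G,
     gpd_mor = homotopy_class G ` {p. is_path G p},
     gpd_src = (\<lambda>A. fst (path_rep A)),
     gpd_tgt = (\<lambda>A. path_end (path_rep A)),
     gpd_comp = (\<lambda>A B. homotopy_class G
        (fst (path_rep A), snd (path_rep A) @ snd (path_rep B))),
     gpd_ident = (\<lambda>x. homotopy_class G (x, []))\<rparr>"

definition pi1 :: "('v, 'e) ribbon_graph \<Rightarrow> 'e \<Rightarrow> ('v, 'e) path set monoid" where
  "pi1 G x = isotropy (fund_groupoid G) x"

definition gen :: "('v, 'e) ribbon_graph \<Rightarrow> 'e \<Rightarrow> 'v \<Rightarrow> 'e \<Rightarrow> ('v, 'e) path set" where
  "gen G x v y = homotopy_class G (x, [(v, y)])"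


section \<open>Labelings, flips, shuffles and relabelings\<close>

text \<open>\<open>(k, True)\<close> and \<open>(k, False)\<close> stand for the labels \<open>(k, +)\<close> and \<open>(k, -)\<close>.\<close>

type_synonym label = "nat \<times> bool"

definition label_indices :: "('v, 'e) ribbon_graph \<Rightarrow> nat set" where
  "label_indices G = (if finite (edges G) then {1..card (edges G) div 2} else {1..})"

definition labeling :: "('v, 'e) ribbon_graph \<Rightarrow> ('e \<Rightarrow> label) \<Rightarrow> bool" where
  "labeling G l \<longleftrightarrow> bij_betw l (edges G) (label_indices G \<times> UNIV)
    \<and> (\<forall>x\<in>edges G. \<exists>k. {l x, l (twin G x)} = {(k, True), (k, False)})"

definition label_perm :: "('v, 'e) ribbon_graph \<Rightarrow> (label \<Rightarrow> label) \<Rightarrow> bool" where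
  "label_perm G \<sigma> \<longleftrightarrow> bij_betw \<sigma> (label_indices G \<times> UNIV) (label_indices G \<times> UNIV)
    \<and> (\<forall>m\<in>label_indices G. \<exists>k. \<sigma> ` {(m, True), (m, False)} = {(k, True), (k, False)})"

definition shuffle :: "('v, 'e) ribbon_graph \<Rightarrow> 'v \<Rightarrow> ('v, 'e) ribbon_graph" where
  "shuffle G v = G\<lparr>rot := (rot G)(v := inv_into (incident G v) (rot G v))\<rparr>"

definition trivial_flip :: "('v, 'e) ribbon_graph \<Rightarrow> 'e \<Rightarrow> bool" where
  "trivial_flip G f \<longleftrightarrow> vert3 G (twin G f) = vert3 G f"

text \<open>The flipped graph has the same edge set, the edge \<open>x'\<close> being \<open>x\<close>. The names \<open>u\<close> and \<open>w\<close> of the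
  two removed vertices are reused: \<open>(f', b', d')\<close> is the new vertex \<open>u\<close> and \<open>(e', c', a')\<close> is the
  new vertex \<open>w\<close>, so that only \<open>a\<close> and \<open>d\<close> change their ends.\<close>

definition flip :: "('v, 'e) ribbon_graph \<Rightarrow> 'e \<Rightarrow> ('v, 'e) ribbon_graph" where
  "flip G f =
    (if trivial_flip G f then G
     else let e = twin G f; u = vert3 G f; w = vert3 G e;
              a = rot G u f; b = rot G u a; d = rot G w e; c = rot G w d
          in G\<lparr>ends := (ends G)(a := insert w (ends G a - {u}), d := insert u (ends G d - {w})),
               rot := (rot G)(u := id(f := b, b := d, d := f),
                              w := id(e := c, c := a, a := e))\<rparr>)"

text \<open>\<open>F\<close> is the isomorphism of fundamental groupoids induced by the flip at \<open>f\<close>. It is determined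
  by its values on generators, as the listed ones generate the groupoid.\<close>

definition flip_induces ::
  "('v, 'e) ribbon_graph \<Rightarrow> 'e \<Rightarrow> ('e, ('v, 'e) path set) gpd_functor \<Rightarrow> bool" where
  "flip_induces G f F \<longleftrightarrow>
    (if trivial_flip G f then F = functor_id (fund_groupoid G)
     else let e = twin G f; u = vert3 G f; w = vert3 G e; v = vert2 G f;
              a = rot G u f; b = rot G u a; d = rot G w e; c = rot G w d;
              G' = flip G f; comp' = gpd_comp (fund_groupoid G')
          in F \<in> gpd_iso (fund_groupoid G) (fund_groupoid G')
           \<and> (\<forall>x\<in>edges G. fst F x = x)
           \<and> snd F (gen G a u f) = comp' (gen G' a w e) (gen G' e v f)
           \<and> snd F (gen G b u f) = gen G' b u f
           \<and> snd F (gen G c w e) = gen G' c w e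
           \<and> snd F (gen G d w e) = comp' (gen G' d u f) (gen G' f v e)
           \<and> snd F (gen G f v e) = gen G' f v e
           \<and> (\<forall>t\<in>verts G - {u, w, v}. \<forall>x\<in>incident G t. \<forall>y\<in>incident G t.
                snd F (gen G x t y) = gen G' x t y))"


section \<open>The outer modular groupoid\<close>

type_synonym ('v, 'e) labeled_graph = "('v, 'e) ribbon_graph \<times> ('e \<Rightarrow> label)"

definition labeled_graph_iso ::
  "('v, 'e) labeled_graph \<Rightarrow> ('v, 'e) labeled_graph \<Rightarrow> ('v \<Rightarrow> 'v) \<Rightarrow> ('e \<Rightarrow> 'e) \<Rightarrow> bool" where
  "labeled_graph_iso = (\<lambda>(G, l) (G', l') \<phi> \<psi>.
      bij_betw \<phi> (verts G) (verts G') \<and> bij_betw \<psi> (edges G) (edges G')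
    \<and> (\<forall>x\<in>edges G. ends G' (\<psi> x) = \<phi> ` ends G x \<and> l' (\<psi> x) = l x)
    \<and> (\<forall>v\<in>verts G. \<forall>x\<in>incident G v. rot G' (\<phi> v) (\<psi> x) = \<psi> (rot G v x)))"

text \<open>The image of a homotopy class of paths under a graph isomorphism is again a homotopy
  class.\<close>

definition iso_functor :: "('v, 'e) ribbon_graph \<Rightarrow> ('v \<Rightarrow> 'v) \<Rightarrow> ('e \<Rightarrow> 'e) \<Rightarrow>
    ('e, ('v, 'e) path set) gpd_functor" where
  "iso_functor G \<phi> \<psi> =
    (restrict \<psi> (edges G),
     \<lambda>A\<in>gpd_mor (fund_groupoid G). map_prod \<psi> (map (map_prod \<phi> \<psi>)) ` A)"

text \<open>The objects of the outer modular groupoid are isomorphism classes of labeled modular graphs.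
  The predicate below describes its morphisms in terms of representatives: \<open>OMG_mor X Y F\<close> says
  that \<open>F\<close> is a morphism from the class of \<open>X\<close> to the class of \<open>Y\<close>. The rule \<open>identify\<close> is the
  identification of isomorphic representatives; it does not introduce new automorphisms, since an
  isomorphism is determined by the labels.\<close>

inductive OMG_mor :: "('v, 'e) labeled_graph \<Rightarrow> ('v, 'e) labeled_graph \<Rightarrow>
    ('e, ('v, 'e) path set) gpd_functor \<Rightarrow> bool" where
  flip: "f \<in> edges G \<Longrightarrow> flip_induces G f F \<Longrightarrow> OMG_mor (G, l) (flip G f, l) F"
| shuffle: "v \<in> verts G \<Longrightarrow> degree G v = 3 \<Longrightarrow>
    OMG_mor (G, l) (shuffle G v, l) (functor_id (fund_groupoid G))"
| relabel: "label_perm G \<sigma> \<Longrightarrow> OMG_mor (G, l) (G, \<sigma> \<circ> l) (functor_id (fund_groupoid G))"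
| identify: "labeled_graph_iso (G, l) (G', l') \<phi> \<psi> \<Longrightarrow>
    OMG_mor (G, l) (G', l') (iso_functor G \<phi> \<psi>)"
| compose: "OMG_mor (G, l) (G', l') F \<Longrightarrow> OMG_mor (G', l') (G'', l'') F' \<Longrightarrow>
    OMG_mor (G, l) (G'', l'') (functor_comp (fund_groupoid G) F' F)"

definition OMG ::
  "('v, 'e) ribbon_graph \<Rightarrow> ('e \<Rightarrow> label) \<Rightarrow> ('e, ('v, 'e) path set) gpd_functor monoid" where
  "OMG G l = (gpd_Aut (fund_groupoid G))\<lparr>carrier := {F. OMG_mor (G, l) (G, l) F}\<rparr>"

end

theory Submission
  imports Defs
begin

text \<open>An automorphism \<open>\<alpha>\<close> of \<open>\<pi>\<^sub>1(G)\<close> is represented by a map from \<open>G\<close> to \<open>G\<close> that sends vertices of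
  degree 3 to vertices of degree 3 and pairs of twins to edge paths. While keeping the homotopy class
  of this map, its domain is modified by flips and its total length is decreased by folding in the
  sense of Stallings. If the images of two edges at a vertex start with the same letter, moving the
  image of the vertex along this letter decreases the total length. The edges that are mapped to
  points form a forest, since the map is injective on \<open>\<pi>\<^sub>1\<close>. Flips at these edges change none of the
  images, and by such flips any two directions leaving a tree of the forest can be brought to the same
  vertex. So for a map of minimal length the images of the directions at a tree start with different
  letters. As there are only three letters at each vertex of \<open>G\<close>, no edge is mapped to a point, and
  the map is an immersion. Since it is also surjective on homotopy classes of paths, it is an
  isomorphism of graphs, up to the ribbon structure and the labels, which are corrected by shuffles
  and a relabeling. The composite of all these moves is an element of \<open>OMG(G)\<close> that induces \<open>\<alpha>\<close> up to
  an inner automorphism.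

  The group \<open>\<pi>\<^sub>1(G)\<close> is free on the pairs of twins outside a spanning tree, whose number follows from
  the Euler characteristic.\<close>

section \<open>Groupoids\<close>

text \<open>The obstacle is that the target is a groupoid with many objects while the domain graph
  keeps changing. One encoding meets both. A map is stored as its values \<open>m x\<close> on twin
  pairs, all written in a single free group with one generator for each twin pair of
  \<open>G\<close>. Homotopy classes of edge paths become reduced words, and \<open>PW p q\<close>
  singles out the words running from \<open>p\<close> to \<open>q\<close>. Homotopies of the map
  become coboundaries (\<open>marked_gauge\<close>), and word length measures progress. Flips keep
  the edge set, the twins and the labels, so \<open>m\<close> is literally the same function before
  and after a flip; as the total length does not see such flips, they are controlled by a separate
  induction on the number of collapsed edges between two directions. A marking demands bijectivity
  on all hom sets and not only on one isotropy group, because lifting paths between arbitrary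
  vertices is what turns a folded map into an isomorphism. That \<open>OMG\<close> is a group has to
  be proved as well: \<open>OMG_mor\<close> is closed under composition by definition, but each of
  its rules has to be inverted, and a flip is not undone by a single flip.\<close>

locale gpd =
  fixes X :: "('o, 'm) groupoid"
  assumes src_obj [simp]: "m \<in> gpd_mor X \<Longrightarrow> gpd_src X m \<in> gpd_obj X"
    and tgt_obj [simp]: "m \<in> gpd_mor X \<Longrightarrow> gpd_tgt X m \<in> gpd_obj X"
    and comp_mor [simp]: "\<lbrakk>m \<in> gpd_mor X; n \<in> gpd_mor X; gpd_tgt X m = gpd_src X n\<rbrakk>
      \<Longrightarrow> gpd_comp X m n \<in> gpd_mor X"
    and src_comp [simp]: "\<lbrakk>m \<in> gpd_mor X; n \<in> gpd_mor X; gpd_tgt X m = gpd_src X n\<rbrakk>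
      \<Longrightarrow> gpd_src X (gpd_comp X m n) = gpd_src X m"
    and tgt_comp [simp]: "\<lbrakk>m \<in> gpd_mor X; n \<in> gpd_mor X; gpd_tgt X m = gpd_src X n\<rbrakk>
      \<Longrightarrow> gpd_tgt X (gpd_comp X m n) = gpd_tgt X n"
    and ident_mor [simp]: "x \<in> gpd_obj X \<Longrightarrow> gpd_ident X x \<in> gpd_mor X"
    and src_ident [simp]: "x \<in> gpd_obj X \<Longrightarrow> gpd_src X (gpd_ident X x) = x"
    and tgt_ident [simp]: "x \<in> gpd_obj X \<Longrightarrow> gpd_tgt X (gpd_ident X x) = x"
    and comp_assoc: "\<lbrakk>m \<in> gpd_mor X; n \<in> gpd_mor X; p \<in> gpd_mor X;
        gpd_tgt X m = gpd_src X n; gpd_tgt X n = gpd_src X p\<rbrakk>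
      \<Longrightarrow> gpd_comp X (gpd_comp X m n) p = gpd_comp X m (gpd_comp X n p)"
    and ident_comp [simp]: "\<lbrakk>m \<in> gpd_mor X; gpd_src X m = x\<rbrakk> \<Longrightarrow> gpd_comp X (gpd_ident X x) m = m"
    and comp_ident [simp]: "\<lbrakk>m \<in> gpd_mor X; gpd_tgt X m = x\<rbrakk> \<Longrightarrow> gpd_comp X m (gpd_ident X x) = m"
    and has_inverse: "m \<in> gpd_mor X \<Longrightarrow> \<exists>n\<in>gpd_mor X. gpd_src X n = gpd_tgt X m
      \<and> gpd_tgt X n = gpd_src X m \<and> gpd_comp X m n = gpd_ident X (gpd_src X m)
      \<and> gpd_comp X n m = gpd_ident X (gpd_tgt X m)"
begin

lemma inverse_unique:
  assumes "m \<in> gpd_mor X" "n \<in> gpd_mor X" "n' \<in> gpd_mor X"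
    and "gpd_src X n = gpd_tgt X m" "gpd_tgt X n = gpd_src X m" "gpd_src X n' = gpd_tgt X m"
    and "gpd_comp X n m = gpd_ident X (gpd_tgt X m)" "gpd_comp X m n' = gpd_ident X (gpd_src X m)"
  shows "n = n'"
proof -
  have "n = gpd_comp X n (gpd_comp X m n')" using assms by simp
  also have "\<dots> = gpd_comp X (gpd_comp X n m) n'" by (rule comp_assoc[symmetric]) (use assms in auto)
  also have "\<dots> = n'" using assms by simp
  finally show ?thesis .
qed

lemma inv_props:
  assumes "m \<in> gpd_mor X"
  shows "gpd_inv X m \<in> gpd_mor X \<and> gpd_src X (gpd_inv X m) = gpd_tgt X m
    \<and> gpd_tgt X (gpd_inv X m) = gpd_src X m \<and> gpd_comp X m (gpd_inv X m) = gpd_ident X (gpd_src X m)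
    \<and> gpd_comp X (gpd_inv X m) m = gpd_ident X (gpd_tgt X m)"
proof -
  obtain n where n: "n \<in> gpd_mor X" "gpd_src X n = gpd_tgt X m" "gpd_tgt X n = gpd_src X m"
    "gpd_comp X m n = gpd_ident X (gpd_src X m)" "gpd_comp X n m = gpd_ident X (gpd_tgt X m)"
    using has_inverse[OF assms] by blast
  have "gpd_inv X m = n"
    unfolding gpd_inv_def
  proof (rule the_equality)
    fix n' assume "n' \<in> gpd_hom X (gpd_tgt X m) (gpd_src X m) \<and>
       gpd_comp X m n' = gpd_ident X (gpd_src X m) \<and> gpd_comp X n' m = gpd_ident X (gpd_tgt X m)"
    then show "n' = n" using inverse_unique[OF assms, of n' n] n by (auto simp: gpd_hom_def)
  qed (use n in \<open>auto simp: gpd_hom_def\<close>)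
  then show ?thesis using n by simp
qed

lemma inv_mor [simp]: "m \<in> gpd_mor X \<Longrightarrow> gpd_inv X m \<in> gpd_mor X"
  and src_inv [simp]: "m \<in> gpd_mor X \<Longrightarrow> gpd_src X (gpd_inv X m) = gpd_tgt X m"
  and tgt_inv [simp]: "m \<in> gpd_mor X \<Longrightarrow> gpd_tgt X (gpd_inv X m) = gpd_src X m"
  and comp_inv [simp]: "m \<in> gpd_mor X \<Longrightarrow> gpd_comp X m (gpd_inv X m) = gpd_ident X (gpd_src X m)"
  and inv_comp [simp]: "m \<in> gpd_mor X \<Longrightarrow> gpd_comp X (gpd_inv X m) m = gpd_ident X (gpd_tgt X m)"
  using inv_props by blast+

lemma inv_comp_cancel [simp]: "\<lbrakk>m \<in> gpd_mor X; n \<in> gpd_mor X; gpd_src X m = gpd_src X n\<rbrakk>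
    \<Longrightarrow> gpd_comp X m (gpd_comp X (gpd_inv X m) n) = n"
  and comp_inv_cancel [simp]: "\<lbrakk>m \<in> gpd_mor X; n \<in> gpd_mor X; gpd_tgt X m = gpd_src X n\<rbrakk>
    \<Longrightarrow> gpd_comp X (gpd_inv X m) (gpd_comp X m n) = n"
  by (simp_all add: comp_assoc[symmetric])

lemma inv_equality:
  assumes "m \<in> gpd_mor X" "n \<in> gpd_mor X" "gpd_tgt X m = gpd_src X n" "gpd_tgt X n = gpd_src X m"
    and "gpd_comp X m n = gpd_ident X (gpd_src X m)"
  shows "gpd_inv X m = n"
  by (rule inverse_unique[of m]) (use assms in auto)

lemma inv_inv [simp]: "m \<in> gpd_mor X \<Longrightarrow> gpd_inv X (gpd_inv X m) = m"
  by (rule inv_equality) auto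

lemma inv_ident [simp]: "x \<in> gpd_obj X \<Longrightarrow> gpd_inv X (gpd_ident X x) = gpd_ident X x"
  by (rule inv_equality) auto

lemma inv_of_comp: "\<lbrakk>m \<in> gpd_mor X; n \<in> gpd_mor X; gpd_tgt X m = gpd_src X n\<rbrakk>
    \<Longrightarrow> gpd_inv X (gpd_comp X m n) = gpd_comp X (gpd_inv X n) (gpd_inv X m)"
  by (rule inv_equality) (auto simp: comp_assoc)

lemma idem_ident:
  assumes "m \<in> gpd_mor X" "gpd_tgt X m = gpd_src X m" "gpd_comp X m m = m"
  shows "m = gpd_ident X (gpd_src X m)"
proof -
  have "m = gpd_comp X (gpd_inv X m) (gpd_comp X m m)" using assms(1,2) by simp
  then show ?thesis using assms by simp
qed

lemma group_isotropy: "x \<in> gpd_obj X \<Longrightarrow> group (isotropy X x)"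
proof (rule groupI)
  fix m assume "m \<in> carrier (isotropy X x)"
  then show "\<exists>n\<in>carrier (isotropy X x). n \<otimes>\<^bsub>isotropy X x\<^esub> m = \<one>\<^bsub>isotropy X x\<^esub>"
    using inv_comp[of m] by (auto simp: isotropy_def gpd_hom_def intro!: exI[of _ "gpd_inv X m"])
qed (auto simp: isotropy_def gpd_hom_def comp_assoc)

lemma inv_isotropy:
  assumes "x \<in> gpd_obj X" "m \<in> gpd_hom X x x"
  shows "inv\<^bsub>isotropy X x\<^esub> m = gpd_inv X m"
proof -
  interpret group "isotropy X x" using assms(1) by (rule group_isotropy)
  show ?thesis by (rule inv_equality) (use assms in \<open>auto simp: isotropy_def gpd_hom_def\<close>)
qed

end

text \<open>Weaker than \<open>gpd_iso\<close>, so that functors can be built and compared before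
  they are known to be invertible. Preservation of identities follows from the composition law,
  since an idempotent of a groupoid is an identity.\<close>

definition functorial ::
  "('o, 'm) groupoid \<Rightarrow> ('o, 'm) groupoid \<Rightarrow> ('o, 'm) gpd_functor \<Rightarrow> bool" where
  "functorial X Y F \<longleftrightarrow>
      (\<forall>x\<in>gpd_obj X. fst F x \<in> gpd_obj Y)
    \<and> (\<forall>m\<in>gpd_mor X. snd F m \<in> gpd_mor Y \<and> gpd_src Y (snd F m) = fst F (gpd_src X m)
                   \<and> gpd_tgt Y (snd F m) = fst F (gpd_tgt X m))
    \<and> (\<forall>m\<in>gpd_mor X. \<forall>n\<in>gpd_mor X. gpd_tgt X m = gpd_src X n
          \<longrightarrow> snd F (gpd_comp X m n) = gpd_comp Y (snd F m) (snd F n))"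

lemma functorialD:
  assumes "functorial X Y F"
  shows "x \<in> gpd_obj X \<Longrightarrow> fst F x \<in> gpd_obj Y"
    and "m \<in> gpd_mor X \<Longrightarrow> snd F m \<in> gpd_mor Y"
    and "m \<in> gpd_mor X \<Longrightarrow> gpd_src Y (snd F m) = fst F (gpd_src X m)"
    and "m \<in> gpd_mor X \<Longrightarrow> gpd_tgt Y (snd F m) = fst F (gpd_tgt X m)"
    and "\<lbrakk>m \<in> gpd_mor X; n \<in> gpd_mor X; gpd_tgt X m = gpd_src X n\<rbrakk>
      \<Longrightarrow> snd F (gpd_comp X m n) = gpd_comp Y (snd F m) (snd F n)"
  using assms by (auto simp: functorial_def)

lemma functorial_ident:
  assumes "gpd X" "gpd Y" "functorial X Y F" "x \<in> gpd_obj X"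
  shows "snd F (gpd_ident X x) = gpd_ident Y (fst F x)"
proof -
  interpret X: gpd X by fact
  interpret Y: gpd Y by fact
  note F = functorialD[OF assms(3)]
  have "gpd_comp Y (snd F (gpd_ident X x)) (snd F (gpd_ident X x)) = snd F (gpd_ident X x)"
    using F(5)[of "gpd_ident X x" "gpd_ident X x"] assms(4) by simp
  then show ?thesis
    using Y.idem_ident[of "snd F (gpd_ident X x)"] F(2-4)[of "gpd_ident X x"] assms(4) by simp
qed

lemma functorial_inv:
  assumes "gpd X" "gpd Y" "functorial X Y F" "m \<in> gpd_mor X"
  shows "snd F (gpd_inv X m) = gpd_inv Y (snd F m)"
proof -
  interpret X: gpd X by fact
  interpret Y: gpd Y by fact
  note F = functorialD[OF assms(3)]
  have "gpd_comp Y (snd F m) (snd F (gpd_inv X m)) = gpd_ident Y (gpd_src Y (snd F m))"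
    using F(5)[of m "gpd_inv X m", symmetric] F(3)[of m] assms(4)
    by (simp add: functorial_ident[OF assms(1-3)])
  then show ?thesis
    using F(2-4) assms(4) by (intro Y.inv_equality[symmetric]) auto
qed

lemma functorial_comp:
  "\<lbrakk>gpd X; functorial X Y F; functorial Y Z K\<rbrakk> \<Longrightarrow> functorial X Z (functor_comp X K F)"
  by (auto simp: functorial_def functor_comp_def compose_eq gpd.src_obj gpd.tgt_obj gpd.comp_mor)

lemma functorial_id: "gpd X \<Longrightarrow> functorial X X (functor_id X)"
  by (auto simp: functorial_def functor_id_def gpd.src_obj gpd.tgt_obj gpd.comp_mor)

lemma gpd_iso_functorial: "F \<in> gpd_iso X Y \<Longrightarrow> functorial X Y F"
  by (auto simp: functorial_def gpd_iso_def bij_betw_def)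

lemma gpd_isoI:
  assumes "gpd X" "gpd Y" "functorial X Y F"
    and "fst F \<in> extensional (gpd_obj X)" "snd F \<in> extensional (gpd_mor X)"
    and "bij_betw (fst F) (gpd_obj X) (gpd_obj Y)" "bij_betw (snd F) (gpd_mor X) (gpd_mor Y)"
  shows "F \<in> gpd_iso X Y"
  using assms(4-7) functorialD[OF assms(3)] functorial_ident[OF assms(1-3)]
  by (simp add: gpd_iso_def)

lemma functor_comp_id_left:
  assumes "F \<in> gpd_iso X Y" shows "functor_comp X (functor_id Y) F = F"
  using assms by (auto simp: functor_comp_def functor_id_def gpd_iso_def bij_betw_def
      extensional_def compose_def fun_eq_iff prod_eq_iff)

lemma functor_comp_id_right:
  assumes "F \<in> gpd_iso X Y" shows "functor_comp X F (functor_id X) = F"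
  using assms by (auto simp: functor_comp_def functor_id_def gpd_iso_def
      extensional_def compose_def fun_eq_iff prod_eq_iff)

lemma functor_comp_assoc:
  assumes "F \<in> gpd_iso X Y" 
  shows "functor_comp X (functor_comp Y M K) F = functor_comp X M (functor_comp X K F)"
  using assms by (auto simp: functor_comp_def gpd_iso_def bij_betw_def
      compose_def fun_eq_iff prod_eq_iff)

lemma functor_id_iso: "gpd X \<Longrightarrow> functor_id X \<in> gpd_iso X X"
  by (rule gpd_isoI[OF _ _ functorial_id])
    (auto simp: functor_id_def bij_betw_def inj_on_def)

lemma functor_comp_iso:
  assumes "gpd X" "gpd Z" "F \<in> gpd_iso X Y" "K \<in> gpd_iso Y Z"
  shows "functor_comp X K F \<in> gpd_iso X Z"
proof (rule gpd_isoI[OF assms(1,2) functorial_comp[OF assms(1)]])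
  show "functorial X Y F" "functorial Y Z K" using assms gpd_iso_functorial by blast+
qed (use assms in \<open>auto simp: functor_comp_def gpd_iso_def intro: bij_betw_compose\<close>)

lemma gpd_iso_of_inverse:
  assumes "gpd X" "gpd Y" "functorial X Y F" "functorial Y X K"
    and "fst F \<in> extensional (gpd_obj X)" "snd F \<in> extensional (gpd_mor X)"
    and "\<And>x. x \<in> gpd_obj X \<Longrightarrow> fst K (fst F x) = x" "\<And>m. m \<in> gpd_mor X \<Longrightarrow> snd K (snd F m) = m"
    and "\<And>y. y \<in> gpd_obj Y \<Longrightarrow> fst F (fst K y) = y" "\<And>n. n \<in> gpd_mor Y \<Longrightarrow> snd F (snd K n) = n"
  shows "F \<in> gpd_iso X Y"
proof (rule gpd_isoI[OF assms(1-3,5,6)])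
  note F = functorialD[OF assms(3)] and K = functorialD[OF assms(4)]
  show "bij_betw (fst F) (gpd_obj X) (gpd_obj Y)"
    by (rule bij_betwI[where g = "fst K"]) (use F(1) K(1) assms in auto)
  show "bij_betw (snd F) (gpd_mor X) (gpd_mor Y)"
    by (rule bij_betwI[where g = "snd K"]) (use F(2) K(2) assms in auto)
qed

definition functor_inv ::
  "('o, 'm) groupoid \<Rightarrow> ('o, 'm) groupoid \<Rightarrow> ('o, 'm) gpd_functor \<Rightarrow> ('o, 'm) gpd_functor" where
  "functor_inv X Y F =
    (\<lambda>y\<in>gpd_obj Y. inv_into (gpd_obj X) (fst F) y, \<lambda>n\<in>gpd_mor Y. inv_into (gpd_mor X) (snd F) n)"

lemma functor_inv:
  assumes "gpd X" "gpd Y" "F \<in> gpd_iso X Y"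
  shows functor_inv_iso: "functor_inv X Y F \<in> gpd_iso Y X"
    and functor_inv_comp: "functor_comp X (functor_inv X Y F) F = functor_id X"
    and functor_comp_inv: "functor_comp Y F (functor_inv X Y F) = functor_id Y"
proof -
  interpret X: gpd X by fact
  interpret Y: gpd Y by fact
  let ?K = "functor_inv X Y F"
  note F = functorialD[OF gpd_iso_functorial[OF assms(3)]]
  have b: "bij_betw (fst F) (gpd_obj X) (gpd_obj Y)" "bij_betw (snd F) (gpd_mor X) (gpd_mor Y)"
    using assms(3) by (auto simp: gpd_iso_def)
  have K: "x \<in> gpd_obj X \<Longrightarrow> fst ?K (fst F x) = x" "m \<in> gpd_mor X \<Longrightarrow> snd ?K (snd F m) = m" for x m
    using b F(1,2) by (auto simp: functor_inv_def bij_betw_def)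
  have Kin: "y \<in> gpd_obj Y \<Longrightarrow> fst ?K y \<in> gpd_obj X" "n \<in> gpd_mor Y \<Longrightarrow> snd ?K n \<in> gpd_mor X" for y n
    using b by (auto simp: functor_inv_def bij_betw_def inv_into_into)
  have FK: "y \<in> gpd_obj Y \<Longrightarrow> fst F (fst ?K y) = y" "n \<in> gpd_mor Y \<Longrightarrow> snd F (snd ?K n) = n" for y n
    using b by (auto simp: functor_inv_def bij_betw_def f_inv_into_f)
  have s: "gpd_src X (snd ?K n) = fst ?K (gpd_src Y n)" "gpd_tgt X (snd ?K n) = fst ?K (gpd_tgt Y n)"
    if "n \<in> gpd_mor Y" for n
    using that F(3,4)[of "snd ?K n"] Kin(2)[OF that] FK(2)[OF that] K(1)
    by (metis X.src_obj, metis X.tgt_obj)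
  have c: "snd ?K (gpd_comp Y m n) = gpd_comp X (snd ?K m) (snd ?K n)"
    if "m \<in> gpd_mor Y" "n \<in> gpd_mor Y" "gpd_tgt Y m = gpd_src Y n" for m n
    using that F(5)[of "snd ?K m" "snd ?K n"] Kin(2) FK(2) s
    by (metis K(2) X.comp_mor)
  have fK: "functorial Y X ?K" using Kin s c by (simp add: functorial_def)
  show "?K \<in> gpd_iso Y X"
    by (rule gpd_iso_of_inverse[OF assms(2,1) fK gpd_iso_functorial[OF assms(3)]])
      (use K FK in \<open>auto simp: functor_inv_def\<close>)
  show "functor_comp X ?K F = functor_id X"
    using K by (auto simp: functor_comp_def functor_id_def compose_def fun_eq_iff)
  show "functor_comp Y F ?K = functor_id Y"
    using FK by (auto simp: functor_comp_def functor_id_def compose_def fun_eq_iff)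
qed

lemma group_gpd_Aut:
  assumes "gpd X" shows "group (gpd_Aut X)"
proof (rule groupI)
  fix F assume "F \<in> carrier (gpd_Aut X)"
  then show "\<exists>K\<in>carrier (gpd_Aut X). K \<otimes>\<^bsub>gpd_Aut X\<^esub> F = \<one>\<^bsub>gpd_Aut X\<^esub>"
    using functor_inv[OF assms assms, of F] by (auto simp: gpd_Aut_def)
qed (auto simp: gpd_Aut_def assms functor_id_iso functor_comp_iso functor_comp_assoc functor_comp_id_left)

lemma inv_gpd_Aut:
  assumes "gpd X" "F \<in> gpd_iso X X" "K \<in> gpd_iso X X" "functor_comp X K F = functor_id X"
  shows "inv\<^bsub>gpd_Aut X\<^esub> F = K"
proof -
  interpret group "gpd_Aut X" by (rule group_gpd_Aut) fact
  show ?thesis by (rule inv_equality) (use assms in \<open>auto simp: gpd_Aut_def\<close>)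
qed


section \<open>Outer automorphisms\<close>

context group
begin

definition inner :: "'a \<Rightarrow> 'a \<Rightarrow> 'a" where
  "inner a = (\<lambda>h\<in>carrier G. a \<otimes> h \<otimes> inv a)"

lemma inner_apply [simp]: "h \<in> carrier G \<Longrightarrow> inner a h = a \<otimes> h \<otimes> inv a"
  by (simp add: inner_def)

lemma inner_extensional [simp]: "inner a \<in> extensional (carrier G)"
  by (simp add: inner_def)

lemma cancel_inv_simps [simp]:
  assumes "a \<in> carrier G" "x \<in> carrier G"
  shows "a \<otimes> (inv a \<otimes> x) = x" "inv a \<otimes> (a \<otimes> x) = x"
  using assms by (simp_all add: m_assoc[symmetric])

lemma inner_auto: 
  assumes "a \<in> carrier G" shows "inner a \<in> auto G"
proof -
  have "bij_betw (inner a) (carrier G) (carrier G)"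
    by (rule bij_betwI[where g = "inner (inv a)"]) (use assms in \<open>auto simp: m_assoc\<close>)
  then show ?thesis using assms by (auto simp: auto_def Bij_def hom_def m_assoc)
qed

lemma AutoGroup_simps [simp]:
  "carrier (AutoGroup G) = auto G" "\<one>\<^bsub>AutoGroup G\<^esub> = (\<lambda>x\<in>carrier G. x)"
  "\<lbrakk>f \<in> auto G; g \<in> auto G\<rbrakk> \<Longrightarrow> f \<otimes>\<^bsub>AutoGroup G\<^esub> g = compose (carrier G) f g"
  by (auto simp: AutoGroup_def BijGroup_def auto_def)

lemma auto_closed: "\<lbrakk>f \<in> auto G; x \<in> carrier G\<rbrakk> \<Longrightarrow> f x \<in> carrier G"
  by (auto simp: auto_def hom_def)

lemma auto_mult: "\<lbrakk>f \<in> auto G; x \<in> carrier G; y \<in> carrier G\<rbrakk> \<Longrightarrow> f (x \<otimes> y) = f x \<otimes> f y"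
  by (auto simp: auto_def hom_def)

lemma auto_inv: "\<lbrakk>f \<in> auto G; x \<in> carrier G\<rbrakk> \<Longrightarrow> f (inv x) = inv (f x)"
  by (rule group_hom.hom_inv) (auto simp: auto_def group_hom_def group_hom_axioms_def)

lemma Inn_eq: "Inn G = {inner a | a. a \<in> carrier G}"
  by (simp add: Inn_def inner_def)

lemma compose_inner_inner:
  "\<lbrakk>a \<in> carrier G; b \<in> carrier G\<rbrakk> \<Longrightarrow> compose (carrier G) (inner a) (inner b) = inner (a \<otimes> b)"
  by (rule extensionalityI[of _ "carrier G"]) (auto simp: compose_def m_assoc inv_mult_group)

lemma inner_one: "inner \<one> = (\<lambda>x\<in>carrier G. x)"
  by (rule extensionalityI[of _ "carrier G"]) auto

lemma inv_inner: "a \<in> carrier G \<Longrightarrow> inv\<^bsub>AutoGroup G\<^esub> (inner a) = inner (inv a)"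
proof -
  assume a: "a \<in> carrier G"
  interpret A: group "AutoGroup G" by (rule AutoGroup)
  show ?thesis
  proof (rule A.inv_equality)
    show "inner (inv a) \<otimes>\<^bsub>AutoGroup G\<^esub> inner a = \<one>\<^bsub>AutoGroup G\<^esub>"
      using a by (simp add: inner_auto compose_inner_inner inner_one)
    show "inner a \<in> carrier (AutoGroup G)" "inner (inv a) \<in> carrier (AutoGroup G)"
      using a inner_auto[of a] inner_auto[of "inv a"] by simp_all
  qed
qed

text \<open>An automorphism \<open>f\<close> satisfies \<open>f\<close> after \<open>inner a\<close>
  = \<open>inner (f a)\<close> after \<open>f\<close>, so conjugating an inner automorphism gives an
  inner one.\<close>

lemma Inn_normal: "Inn G \<lhd> AutoGroup G"
proof -
  interpret A: group "AutoGroup G" by (rule AutoGroup)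
  have sub: "subgroup (Inn G) (AutoGroup G)"
  proof (rule A.subgroupI)
    show "Inn G \<subseteq> carrier (AutoGroup G)" using inner_auto by (auto simp: Inn_eq)
    show "Inn G \<noteq> {}" by (auto simp: Inn_eq)
    fix f assume "f \<in> Inn G"
    then obtain a where a: "a \<in> carrier G" "f = inner a" by (auto simp: Inn_eq)
    have "inv\<^bsub>AutoGroup G\<^esub> f = inner (inv a)" using a inv_inner by blast
    then show "inv\<^bsub>AutoGroup G\<^esub> f \<in> Inn G" using a inv_closed unfolding Inn_eq by blast
    fix g assume "g \<in> Inn G"
    then obtain b where b: "b \<in> carrier G" "g = inner b" by (auto simp: Inn_eq)
    have "f \<otimes>\<^bsub>AutoGroup G\<^esub> g = inner (a \<otimes> b)"
      using a b inner_auto compose_inner_inner by simp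
    then show "f \<otimes>\<^bsub>AutoGroup G\<^esub> g \<in> Inn G" using a b by (auto simp: Inn_eq)
  qed
  have "f \<otimes>\<^bsub>AutoGroup G\<^esub> h \<otimes>\<^bsub>AutoGroup G\<^esub> inv\<^bsub>AutoGroup G\<^esub> f \<in> Inn G"
    if f: "f \<in> carrier (AutoGroup G)" and h: "h \<in> Inn G" for f h
  proof -
    obtain a where a: "a \<in> carrier G" "h = inner a" using h by (auto simp: Inn_eq)
    have fa: "f a \<in> carrier G" using f a auto_closed by simp
    have "compose (carrier G) f h = compose (carrier G) (inner (f a)) f"
      by (rule extensionalityI[of _ "carrier G"])
        (use f a fa auto_closed in \<open>auto simp: compose_def auto_mult auto_inv\<close>)
    then have "f \<otimes>\<^bsub>AutoGroup G\<^esub> h = inner (f a) \<otimes>\<^bsub>AutoGroup G\<^esub> f"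
      using f a fa inner_auto by simp
    then have "f \<otimes>\<^bsub>AutoGroup G\<^esub> h \<otimes>\<^bsub>AutoGroup G\<^esub> inv\<^bsub>AutoGroup G\<^esub> f = inner (f a)"
      using f fa inner_auto[of "f a"]
      by (simp add: A.m_assoc AutoGroup_simps(1)[symmetric] A.r_inv del: AutoGroup_simps)
    then show ?thesis using fa by (auto simp: Inn_eq)
  qed
  then show ?thesis using sub A.normal_inv_iff by blast
qed

lemma Out_simps:
  "carrier (Out G) = rcosets\<^bsub>AutoGroup G\<^esub> Inn G"
  "A \<otimes>\<^bsub>Out G\<^esub> B = A <#>\<^bsub>AutoGroup G\<^esub> B"
  "\<one>\<^bsub>Out G\<^esub> = Inn G"
  by (simp_all add: Out_def FactGroup_def)

lemma Out_mult: "\<lbrakk>f \<in> auto G; g \<in> auto G\<rbrakk> \<Longrightarrow>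
    (Inn G #>\<^bsub>AutoGroup G\<^esub> f) \<otimes>\<^bsub>Out G\<^esub> (Inn G #>\<^bsub>AutoGroup G\<^esub> g)
    = Inn G #>\<^bsub>AutoGroup G\<^esub> compose (carrier G) f g"
  using normal.rcos_sum[OF Inn_normal, of f g] by (simp add: Out_simps)

lemma Inn_coset_eq:
  assumes "f \<in> auto G" "g \<in> auto G" "a \<in> carrier G"
    and "\<And>x. x \<in> carrier G \<Longrightarrow> g x = a \<otimes> f x \<otimes> inv a"
  shows "Inn G #>\<^bsub>AutoGroup G\<^esub> f = Inn G #>\<^bsub>AutoGroup G\<^esub> g"
proof -
  interpret A: group "AutoGroup G" by (rule AutoGroup)
  have "g = inner a \<otimes>\<^bsub>AutoGroup G\<^esub> f"
    using assms inner_auto[OF assms(3)] auto_closed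
    by (auto simp: compose_def fun_eq_iff auto_def Bij_def extensional_def)
  then have "g \<in> Inn G #>\<^bsub>AutoGroup G\<^esub> f"
    using assms(3) by (auto simp: r_coset_def Inn_eq)
  then show ?thesis
    using A.repr_independence[of g "Inn G" f] assms(1) Inn_normal
    by (simp add: normal_imp_subgroup)
qed

end

lemma r_coset_image: "C #>\<^bsub>M\<^esub> c = (\<lambda>g. g \<otimes>\<^bsub>M\<^esub> c) ` C"
  by (auto simp: r_coset_def)

text \<open>Conjugating automorphisms by \<open>h\<close> is an isomorphism of automorphism groups
  that maps \<open>Inn H\<close> onto \<open>Inn K\<close>; hence taking images of cosets is a
  homomorphism of the quotients. It replaces \<open>pi1\<close> by the standard free group at the
  end.\<close>

lemma Out_iso_epi:
  assumes "group H" "group K" "h \<in> iso H K"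
  shows "\<exists>\<Theta>. \<Theta> \<in> epi (Out H) (Out K)"
proof -
  interpret H: group H by fact
  interpret K: group K by fact
  interpret h: group_hom H K h using assms(3) by unfold_locales (auto simp: iso_def)
  let ?A = "AutoGroup H" and ?B = "AutoGroup K"
  interpret A: group ?A by (rule H.AutoGroup)
  interpret B: group ?B by (rule K.AutoGroup)
  have b: "bij_betw h (carrier H) (carrier K)" using assms(3) by (auto simp: iso_def)
  define k where "k = inv_into (carrier H) h"
  have k: "y \<in> carrier K \<Longrightarrow> k y \<in> carrier H" "y \<in> carrier K \<Longrightarrow> h (k y) = y"
    "x \<in> carrier H \<Longrightarrow> k (h x) = x" for x y
    using b by (auto simp: k_def bij_betw_def f_inv_into_f inv_into_into)
  have k_mult: "k (y \<otimes>\<^bsub>K\<^esub> z) = k y \<otimes>\<^bsub>H\<^esub> k z" if "y \<in> carrier K" "z \<in> carrier K" for y z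
    using that k by (metis H.m_closed h.hom_mult)
  define \<theta> where "\<theta> f = (\<lambda>y\<in>carrier K. h (f (k y)))" for f
  define \<eta> where "\<eta> f = (\<lambda>x\<in>carrier H. k (f (h x)))" for f
  have bk: "bij_betw k (carrier K) (carrier H)"
    by (rule bij_betwI[where g = h]) (use k in auto)
  have \<theta>: "\<theta> f \<in> auto K" if "f \<in> auto H" for f
  proof -
    have "bij_betw (h \<circ> (f \<circ> k)) (carrier K) (carrier K)"
      using that b bk by (intro bij_betw_trans) (auto simp: auto_def Bij_def)
    then have "bij_betw (\<theta> f) (carrier K) (carrier K)"
      by (subst bij_betw_cong[where g = "h \<circ> (f \<circ> k)"]) (auto simp: \<theta>_def)
    then show ?thesis using that k H.auto_closed[OF that] H.auto_mult[OF that]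
      by (auto simp: auto_def Bij_def hom_def \<theta>_def k_mult)
  qed
  have \<eta>: "\<eta> f \<in> auto H" if "f \<in> auto K" for f
  proof -
    have "bij_betw (k \<circ> (f \<circ> h)) (carrier H) (carrier H)"
      using that b bk by (intro bij_betw_trans) (auto simp: auto_def Bij_def)
    then have "bij_betw (\<eta> f) (carrier H) (carrier H)"
      by (subst bij_betw_cong[where g = "k \<circ> (f \<circ> h)"]) (auto simp: \<eta>_def)
    then show ?thesis using that k K.auto_closed[OF that] K.auto_mult[OF that]
      by (auto simp: auto_def Bij_def hom_def \<eta>_def k_mult)
  qed
  have \<theta>\<eta>: "\<theta> (\<eta> f) = f" if "f \<in> auto K" for f
    using that k K.auto_closed[OF that]
    by (auto simp: \<theta>_def \<eta>_def auto_def Bij_def extensional_def fun_eq_iff)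
  have mult: "\<theta> (compose (carrier H) f g) = compose (carrier K) (\<theta> f) (\<theta> g)"
    if "f \<in> auto H" "g \<in> auto H" for f g
    using that k H.auto_closed by (auto simp: \<theta>_def compose_def fun_eq_iff)
  have \<theta>_hom: "\<theta> \<in> hom ?A ?B"
    using \<theta> by (auto simp: hom_def mult)
  interpret \<theta>: group_hom ?A ?B \<theta> using \<theta>_hom by unfold_locales
  have inner: "\<theta> (H.inner a) = K.inner (h a)" if "a \<in> carrier H" for a
    by (rule extensionalityI[of _ "carrier K"]) (use that k in \<open>auto simp: \<theta>_def\<close>)
  have inn: "\<theta> ` Inn H = Inn K"
  proof -
    have "K.inner b \<in> \<theta> ` Inn H" if "b \<in> carrier K" for b
    proof -
      have "K.inner b = \<theta> (H.inner (k b))" using inner[of "k b"] k that by simp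
      then show ?thesis using k that by (auto simp: H.Inn_eq)
    qed
    then show ?thesis using inner by (auto simp: H.Inn_eq K.Inn_eq)
  qed
  define \<Theta> where "\<Theta> C = \<theta> ` C" for C
  have coset: "\<Theta> (Inn H #>\<^bsub>?A\<^esub> f) = Inn K #>\<^bsub>?B\<^esub> \<theta> f" if "f \<in> auto H" for f
  proof -
    have "Inn H \<subseteq> carrier ?A" using normal_imp_subgroup[OF H.Inn_normal] subgroup.subset by blast
    then have "\<theta> (g \<otimes>\<^bsub>?A\<^esub> f) = \<theta> g \<otimes>\<^bsub>?B\<^esub> \<theta> f" if "g \<in> Inn H" for g
      using \<open>f \<in> auto H\<close> that \<theta>.hom_mult[of g f] by auto
    then have "\<theta> ` ((\<lambda>g. g \<otimes>\<^bsub>?A\<^esub> f) ` Inn H) = (\<lambda>g. g \<otimes>\<^bsub>?B\<^esub> \<theta> f) ` \<theta> ` Inn H"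
      unfolding image_image by (rule image_cong[OF refl])
    then show ?thesis by (simp add: \<Theta>_def r_coset_image inn)
  qed
  have "\<Theta> \<in> hom (Out H) (Out K)"
    unfolding hom_def
  proof (intro CollectI conjI ballI funcsetI)
    fix C assume "C \<in> carrier (Out H)"
    then obtain f where f: "f \<in> auto H" "C = Inn H #>\<^bsub>?A\<^esub> f" by (auto simp: H.Out_simps RCOSETS_def)
    show "\<Theta> C \<in> carrier (Out K)" using f coset \<theta> by (auto simp: K.Out_simps RCOSETS_def)
    fix D assume "D \<in> carrier (Out H)"
    then obtain g where g: "g \<in> auto H" "D = Inn H #>\<^bsub>?A\<^esub> g" by (auto simp: H.Out_simps RCOSETS_def)
    have "compose (carrier H) f g \<in> auto H"
      using A.m_closed[of f g] f g by simp
    then show "\<Theta> (C \<otimes>\<^bsub>Out H\<^esub> D) = \<Theta> C \<otimes>\<^bsub>Out K\<^esub> \<Theta> D"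
      using f g coset \<theta> by (simp add: H.Out_mult K.Out_mult mult)
  qed
  moreover have "C \<in> \<Theta> ` carrier (Out H)" if "C \<in> carrier (Out K)" for C
  proof -
    from that obtain f where f: "f \<in> auto K" "C = Inn K #>\<^bsub>?B\<^esub> f" by (auto simp: K.Out_simps RCOSETS_def)
    then have "C = \<Theta> (Inn H #>\<^bsub>?A\<^esub> \<eta> f)" using coset[OF \<eta>] \<theta>\<eta> by simp
    then show ?thesis using \<eta> f by (auto simp: H.Out_simps RCOSETS_def)
  qed
  ultimately show ?thesis unfolding epi_iff_subset by blast
qed

lemma epi_comp: "\<lbrakk>f \<in> epi G H; g \<in> epi H K\<rbrakk> \<Longrightarrow> g \<circ> f \<in> epi G K"
  unfolding epi_def using hom_compose[of f G H g K] by (metis (mono_tags, lifting) image_comp mem_Collect_eq)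


section \<open>The natural homomorphism\<close>

text \<open>The inverse is explicit: conjugate back by \<open>\<beta>\<close>, then apply the
  inverse functor.\<close>

lemma functorial_transport_auto:
  assumes "gpd X" "F \<in> gpd_iso X X" "x \<in> gpd_obj X" "\<beta> \<in> gpd_hom X x (fst F x)"
  shows "(\<lambda>\<gamma>\<in>carrier (isotropy X x). gpd_comp X (gpd_comp X \<beta> (snd F \<gamma>)) (gpd_inv X \<beta>))
    \<in> auto (isotropy X x)" (is "?N \<in> _")
proof -
  interpret X: gpd X by fact
  let ?K = "functor_inv X X F"
  note K = functor_inv[OF assms(1,1,2)]
  note f = functorialD[OF gpd_iso_functorial[OF assms(2)]] 
    and k = functorialD[OF gpd_iso_functorial[OF K(1)]]
  have FK: "snd F (snd ?K m) = m" "snd ?K (snd F m) = m" if "m \<in> gpd_mor X" for m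
    using K(2,3) that 
    by (auto simp: functor_comp_def functor_id_def compose_def fun_eq_iff split: if_splits)
  have KF: "fst ?K (fst F x) = x" using K(2) assms(3)
    by (auto simp: functor_comp_def functor_id_def compose_def fun_eq_iff split: if_splits)
  have \<beta>: "\<beta> \<in> gpd_mor X" "gpd_src X \<beta> = x" "gpd_tgt X \<beta> = fst F x"
    using assms(4) by (auto simp: gpd_hom_def)
  let ?N' = "\<lambda>\<gamma>. snd ?K (gpd_comp X (gpd_comp X (gpd_inv X \<beta>) \<gamma>) \<beta>)"
  have "bij_betw ?N (gpd_hom X x x) (gpd_hom X x x)"
    by (rule bij_betwI[where g = ?N'])
      (auto simp: gpd_hom_def \<beta> f k FK KF X.comp_assoc isotropy_def)
  moreover have "gpd_comp X (snd F \<gamma>) (gpd_comp X (snd F \<delta>) (gpd_inv X \<beta>))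
     = gpd_comp X (snd F \<gamma>) (gpd_comp X (gpd_inv X \<beta>)
        (gpd_comp X \<beta> (gpd_comp X (snd F \<delta>) (gpd_inv X \<beta>))))"
    if "\<gamma> \<in> gpd_hom X x x" "\<delta> \<in> gpd_hom X x x" for \<gamma> \<delta>
    using that by (auto simp: gpd_hom_def f \<beta>)
  ultimately show ?thesis
    by (auto simp: auto_def hom_def Bij_def isotropy_def gpd_hom_def \<beta> f X.comp_assoc)
qed

text \<open>Replaces the \<open>SOME\<close> in \<open>natural_hom\<close> by any convenient
  \<open>\<beta>\<close>. Two choices differ by the loop \<open>?a\<close>, and conjugation by a
  loop is inner.\<close>

lemma natural_hom_eq:
  assumes "gpd X" "F \<in> gpd_iso X X" "x \<in> gpd_obj X" "\<beta> \<in> gpd_hom X x (fst F x)"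
  shows "natural_hom X x F = Inn (isotropy X x) #>\<^bsub>AutoGroup (isotropy X x)\<^esub>
    (\<lambda>\<gamma>\<in>carrier (isotropy X x). gpd_comp X (gpd_comp X \<beta> (snd F \<gamma>)) (gpd_inv X \<beta>))"
proof -
  interpret X: gpd X by fact
  interpret H: group "isotropy X x" using assms(3) by (rule X.group_isotropy)
  define \<beta>' where "\<beta>' = (SOME \<beta>. \<beta> \<in> gpd_hom X x (fst F x))"
  have \<beta>': "\<beta>' \<in> gpd_hom X x (fst F x)" unfolding \<beta>'_def using assms(4) by (rule someI)
  note f = functorialD[OF gpd_iso_functorial[OF assms(2)]]
  let ?a = "gpd_comp X \<beta> (gpd_inv X \<beta>')"
  have b: "\<beta> \<in> gpd_mor X" "gpd_src X \<beta> = x" "gpd_tgt X \<beta> = fst F x"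
     "\<beta>' \<in> gpd_mor X" "gpd_src X \<beta>' = x" "gpd_tgt X \<beta>' = fst F x"
    using assms(4) \<beta>' by (auto simp: gpd_hom_def)
  have a: "?a \<in> gpd_hom X x x" using b by (simp add: gpd_hom_def)
  show ?thesis
    unfolding natural_hom_def Let_def \<beta>'_def[symmetric]
  proof (rule H.Inn_coset_eq[where a = ?a])
    fix \<gamma> assume "\<gamma> \<in> carrier (isotropy X x)"
    then have \<gamma>: "\<gamma> \<in> gpd_hom X x x" by (simp add: isotropy_def)
    have "gpd_comp X (gpd_comp X \<beta> (snd F \<gamma>)) (gpd_inv X \<beta>)
      = gpd_comp X (gpd_comp X ?a (gpd_comp X (gpd_comp X \<beta>' (snd F \<gamma>)) (gpd_inv X \<beta>'))) (gpd_inv X ?a)"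
      using b \<gamma> f by (simp add: gpd_hom_def X.comp_assoc X.inv_of_comp)
    then show "(\<lambda>\<gamma>\<in>carrier (isotropy X x). gpd_comp X (gpd_comp X \<beta> (snd F \<gamma>)) (gpd_inv X \<beta>)) \<gamma>
      = ?a \<otimes>\<^bsub>isotropy X x\<^esub> (\<lambda>\<gamma>\<in>carrier (isotropy X x). gpd_comp X (gpd_comp X \<beta>' (snd F \<gamma>)) (gpd_inv X \<beta>')) \<gamma>
        \<otimes>\<^bsub>isotropy X x\<^esub> inv\<^bsub>isotropy X x\<^esub> ?a"
      using \<gamma> a by (simp add: X.inv_isotropy[OF assms(3)]) (simp add: isotropy_def)
  next
    show "?a \<in> carrier (isotropy X x)" using a by (simp add: isotropy_def)
  qed (rule functorial_transport_auto[OF assms(1-3)], fact)+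
qed

lemma natural_hom_hom:
  assumes "gpd X" "x \<in> gpd_obj X" and conn: "\<And>y. y \<in> gpd_obj X \<Longrightarrow> gpd_hom X x y \<noteq> {}"
  shows "natural_hom X x \<in> hom (gpd_Aut X) (Out (isotropy X x))"
proof -
  interpret X: gpd X by fact
  interpret H: group "isotropy X x" using assms(2) by (rule X.group_isotropy)
  let ?N = "\<lambda>F \<beta>. \<lambda>\<gamma>\<in>carrier (isotropy X x). gpd_comp X (gpd_comp X \<beta> (snd F \<gamma>)) (gpd_inv X \<beta>)"
  have ex: "\<exists>\<beta>. \<beta> \<in> gpd_hom X x (fst F x)" if "F \<in> gpd_iso X X" for F
    using conn[of "fst F x"] functorialD(1)[OF gpd_iso_functorial[OF that]] assms(2) by blast
  show ?thesis
    unfolding hom_def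
  proof (intro CollectI conjI ballI funcsetI)
    fix F assume "F \<in> carrier (gpd_Aut X)"
    then have F: "F \<in> gpd_iso X X" by (simp add: gpd_Aut_def)
    then obtain \<beta> where \<beta>: "\<beta> \<in> gpd_hom X x (fst F x)" using ex by blast
    note NF = natural_hom_eq[OF assms(1) F assms(2) \<beta>] 
      and aF = functorial_transport_auto[OF assms(1) F assms(2) \<beta>]
    show "natural_hom X x F \<in> carrier (Out (isotropy X x))"
      using NF aF by (auto simp: H.Out_simps RCOSETS_def)
    fix K assume "K \<in> carrier (gpd_Aut X)"
    then have K: "K \<in> gpd_iso X X" by (simp add: gpd_Aut_def)
    then obtain \<beta>' where \<beta>': "\<beta>' \<in> gpd_hom X x (fst K x)" using ex by blast
    note NK = natural_hom_eq[OF assms(1) K assms(2) \<beta>'] 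
      and aK = functorial_transport_auto[OF assms(1) K assms(2) \<beta>']
    note f = functorialD[OF gpd_iso_functorial[OF F]] and k = functorialD[OF gpd_iso_functorial[OF K]]
    let ?\<beta> = "gpd_comp X \<beta> (snd F \<beta>')"
    have b: "\<beta> \<in> gpd_mor X" "gpd_src X \<beta> = x" "gpd_tgt X \<beta> = fst F x"
     "\<beta>' \<in> gpd_mor X" "gpd_src X \<beta>' = x" "gpd_tgt X \<beta>' = fst K x"
      using \<beta> \<beta>' by (auto simp: gpd_hom_def)
    have FK: "functor_comp X F K \<in> gpd_iso X X" by (rule functor_comp_iso[OF assms(1,1) K F])
    have bb: "?\<beta> \<in> gpd_hom X x (fst (functor_comp X F K) x)"
      using b f k assms(2) by (simp add: gpd_hom_def functor_comp_def compose_def)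
    have "?N (functor_comp X F K) ?\<beta> = compose (carrier (isotropy X x)) (?N F \<beta>) (?N K \<beta>')"
    proof (rule extensionalityI[of _ "carrier (isotropy X x)"])
      fix \<gamma> assume "\<gamma> \<in> carrier (isotropy X x)"
      then have \<gamma>: "\<gamma> \<in> gpd_mor X" "gpd_src X \<gamma> = x" "gpd_tgt X \<gamma> = x"
        by (simp_all add: isotropy_def gpd_hom_def)
      show "?N (functor_comp X F K) ?\<beta> \<gamma> = compose (carrier (isotropy X x)) (?N F \<beta>) (?N K \<beta>') \<gamma>"
        using b f k \<gamma>
        by (simp add: compose_def isotropy_def gpd_hom_def functor_comp_def X.comp_assoc X.inv_of_comp
            functorial_inv[OF assms(1,1) gpd_iso_functorial[OF F]])
    qed auto
    then show "natural_hom X x (F \<otimes>\<^bsub>gpd_Aut X\<^esub> K)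
        = natural_hom X x F \<otimes>\<^bsub>Out (isotropy X x)\<^esub> natural_hom X x K"
      using natural_hom_eq[OF assms(1) FK assms(2) bb] NF NK aF aK
      by (simp add: gpd_Aut_def H.Out_mult)
  qed
qed


section \<open>The fundamental groupoid of a graph\<close>

lemma path_end_append [simp]: "path_end (x, p @ q) = path_end (path_end (x, p), q)"
  by (induction "(x, p)" arbitrary: x p rule: path_end.induct) auto

lemma is_path_append [simp]: "is_path G (x, p @ q) \<longleftrightarrow> is_path G (x, p) \<and> is_path G (path_end (x, p), q)"
  by (induction p arbitrary: x) (auto simp: incident_def, (cases q; auto simp: incident_def)+)

lemma incident_edges: "x \<in> incident G v \<Longrightarrow> x \<in> edges G"
  by (simp add: incident_def)

lemma is_path_fst: "is_path G (x, p) \<Longrightarrow> x \<in> edges G"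
  by (cases "(G, x, p)" rule: is_path.cases) (auto simp: incident_edges)

lemma is_path_end: "is_path G (x, p) \<Longrightarrow> path_end (x, p) \<in> edges G"
  by (induction "(x, p)" arbitrary: x p rule: path_end.induct) auto

lemma elem_homotopyD:
  assumes "elem_homotopy G p q"
  shows "is_path G p" "is_path G q" "fst p = fst q" "path_end p = path_end q"
  using assms by (induction rule: elem_homotopy.induct) (auto simp: incident_def)

lemma homotopic_equiv: "equivp (homotopic G)"
  unfolding homotopic_def by (rule equivp_evquivclp)

lemma homotopic_refl [simp]: "homotopic G p p"
  using homotopic_equiv by (rule equivp_reflp)

lemma homotopic_sym: "homotopic G p q \<Longrightarrow> homotopic G q p"
  using homotopic_equiv by (rule equivp_symp)

lemma homotopic_trans: "homotopic G p q \<Longrightarrow> homotopic G q r \<Longrightarrow> homotopic G p r"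
  using homotopic_equiv by (rule equivp_transp)

lemma homotopic_elem: "elem_homotopy G p q \<Longrightarrow> homotopic G p q"
  unfolding homotopic_def by (rule r_into_equivclp)

lemma homotopic_induct [consumes 1, case_names refl step]:
  assumes "homotopic G p q" 
    and "P p" 
    and "\<And>q r. \<lbrakk>homotopic G p q; elem_homotopy G q r \<or> elem_homotopy G r q; P q\<rbrakk> \<Longrightarrow> P r"
  shows "P q"
  using assms unfolding homotopic_def by (induction rule: equivclp_induct) blast+

lemma homotopicD:
  assumes "homotopic G p q"
  shows "is_path G p \<longleftrightarrow> is_path G q" "fst p = fst q" "path_end p = path_end q"
proof -
  from assms have "(is_path G p \<longleftrightarrow> is_path G q) \<and> fst p = fst q \<and> path_end p = path_end q"
  proof (induction rule: homotopic_induct)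
    case (step q r)
    then show ?case using elem_homotopyD[of G q r] elem_homotopyD[of G r q] by auto
  qed simp
  then show "is_path G p \<longleftrightarrow> is_path G q" "fst p = fst q" "path_end p = path_end q" by auto
qed

lemma homotopic_map:
  assumes "homotopic G p q" "is_path G p"
    and "\<And>p q. elem_homotopy G p q \<Longrightarrow> homotopic H (f p) (f q)"
  shows "homotopic H (f p) (f q)"
  using assms(1)
proof (induction rule: homotopic_induct)
  case (step q r)
  then have "homotopic H (f q) (f r)" using assms(3) homotopic_sym by blast
  then show ?case using step(3) homotopic_trans by blast
qed simp

lemma elem_homotopy_append_right:
  assumes "elem_homotopy G (x, p) (x', p')" "is_path G (path_end (x, p), q)"
  shows "elem_homotopy G (x, p @ q) (x', p' @ q)"
  using assms
proof (cases rule: elem_homotopy.cases)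
  case (stationary p v y r)
  then show ?thesis using elem_homotopy.stationary[of G x p v y "r @ q"] assms by auto
next
  case (shortcut p v y z r)
  then show ?thesis using elem_homotopy.shortcut[of G x p v y z "r @ q"] assms by auto
qed

lemma elem_homotopy_append_left:
  assumes "elem_homotopy G (y, q) (y', q')" "is_path G (x, p)" "path_end (x, p) = y"
  shows "elem_homotopy G (x, p @ q) (x, p @ q')"
  using assms(1)
proof (cases rule: elem_homotopy.cases)
  case (stationary r v z s)
  then show ?thesis using elem_homotopy.stationary[of G x "p @ r" v z s] assms by auto
next
  case (shortcut r v z z' s)
  then show ?thesis using elem_homotopy.shortcut[of G x "p @ r" v z z' s] assms by auto
qed

lemma homotopic_append_right:
  assumes "homotopic G (x, p) (x', p')" "is_path G (path_end (x, p), q)"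
  shows "homotopic G (x, p @ q) (x', p' @ q)"
proof -
  have "homotopic G (x, p) r \<Longrightarrow> homotopic G (x, p @ q) (fst r, snd r @ q)" for r
  proof (induction rule: homotopic_induct)
    case (step r s)
    have "path_end r = path_end (x, p)" "path_end s = path_end (x, p)"
      using homotopicD(3)[OF step(1)] elem_homotopyD(4) step(2) by metis+
    then have "homotopic G (fst r, snd r @ q) (fst s, snd s @ q)"
      using step(2) elem_homotopy_append_right[of G "fst r" "snd r" "fst s" "snd s" q] assms(2)
        elem_homotopy_append_right[of G "fst s" "snd s" "fst r" "snd r" q] homotopic_elem homotopic_sym
      by (metis prod.collapse)
    then show ?case using step(3) homotopic_trans by blast
  qed auto
  from this[OF assms(1)] show ?thesis by simp
qed

lemma homotopic_append_left:
  assumes "homotopic G (y, q) (y', q')" "is_path G (x, p)" "path_end (x, p) = y"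
  shows "homotopic G (x, p @ q) (x, p @ q')"
proof -
  have "homotopic G (y, q) r \<Longrightarrow> homotopic G (x, p @ q) (x, p @ snd r)" for r
  proof (induction rule: homotopic_induct)
    case (step r s)
    have "fst r = y" "fst s = y"
      using homotopicD(2)[OF step(1)] elem_homotopyD(3) step(2) by (metis fst_conv)+
    then have "homotopic G (x, p @ snd r) (x, p @ snd s)"
      using step(2) elem_homotopy_append_left[of G y "snd r" y "snd s" x p] assms(2,3)
        elem_homotopy_append_left[of G y "snd s" y "snd r" x p] homotopic_elem homotopic_sym
      by (metis prod.collapse)
    then show ?case using step(3) homotopic_trans by blast
  qed auto
  from this[OF assms(1)] show ?thesis by simp
qed

lemma homotopy_class_eq_iff:
  "is_path G p \<Longrightarrow> is_path G q \<Longrightarrow> homotopy_class G p = homotopy_class G q \<longleftrightarrow> homotopic G p q"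
  by (auto simp: homotopy_class_def intro: homotopic_trans homotopic_sym)

lemma path_rep_class:
  assumes "is_path G p"
  shows "is_path G (path_rep (homotopy_class G p))" "homotopic G p (path_rep (homotopy_class G p))"
proof -
  have "p \<in> homotopy_class G p" using assms by (simp add: homotopy_class_def)
  then have "path_rep (homotopy_class G p) \<in> homotopy_class G p" unfolding path_rep_def by (rule someI)
  then show "is_path G (path_rep (homotopy_class G p))" "homotopic G p (path_rep (homotopy_class G p))"
    by (simp_all add: homotopy_class_def)
qed

abbreviation FG :: "('v, 'e) ribbon_graph \<Rightarrow> ('e, ('v, 'e) path set) groupoid" where
  "FG \<equiv> fund_groupoid"

lemma fund_groupoid_obj [simp]: "gpd_obj (FG G) = edges G"
  by (simp add: fund_groupoid_def)

lemma class_mor [simp]: "is_path G p \<Longrightarrow> homotopy_class G p \<in> gpd_mor (FG G)"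
  by (simp add: fund_groupoid_def)

lemma mor_class: "m \<in> gpd_mor (FG G) \<Longrightarrow> \<exists>x p. is_path G (x, p) \<and> m = homotopy_class G (x, p)"
  by (auto simp: fund_groupoid_def)

lemma src_class [simp]: "is_path G p \<Longrightarrow> gpd_src (FG G) (homotopy_class G p) = fst p"
  using path_rep_class(2)[of G p] homotopicD(2) by (fastforce simp: fund_groupoid_def)

lemma tgt_class [simp]: "is_path G p \<Longrightarrow> gpd_tgt (FG G) (homotopy_class G p) = path_end p"
  using path_rep_class(2)[of G p] homotopicD(3) by (fastforce simp: fund_groupoid_def)

lemma comp_class:
  assumes "is_path G (x, p)" "is_path G (y, q)" "path_end (x, p) = y"
  shows "gpd_comp (FG G) (homotopy_class G (x, p)) (homotopy_class G (y, q)) = homotopy_class G (x, p @ q)"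
proof -
  obtain x' p' y' q' where r: "path_rep (homotopy_class G (x, p)) = (x', p')"
     "path_rep (homotopy_class G (y, q)) = (y', q')" by fastforce
  then have h: "homotopic G (x, p) (x', p')" "homotopic G (y, q) (y', q')" "is_path G (x', p')" "is_path G (y', q')"
    using path_rep_class[OF assms(1)] path_rep_class[OF assms(2)] by auto
  have e: "x' = x" "y' = y" "path_end (x', p') = y" 
    using homotopicD(2,3)[OF h(1)] homotopicD(2)[OF h(2)] assms(3) by auto
  have "homotopic G (x, p @ q) (x, p' @ q)"
    using homotopic_append_right[OF h(1), of q] assms e by simp
  moreover have "homotopic G (x, p' @ q) (x, p' @ q')"
    using homotopic_append_left[OF h(2), of x p'] h e by simp
  ultimately have "homotopic G (x, p @ q) (x, p' @ q')" by (rule homotopic_trans)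
  then have "homotopy_class G (x, p @ q) = homotopy_class G (x, p' @ q')"
    using assms h e by (subst homotopy_class_eq_iff) auto
  then show ?thesis using r e by (simp add: fund_groupoid_def)
qed

lemma gen_comp:
  assumes "x \<in> incident G v" "y \<in> incident G v" "z \<in> incident G v"
  shows "gpd_comp (FG G) (gen G x v y) (gen G y v z) = gen G x v z"
proof -
  have e: "x \<in> edges G" "y \<in> edges G" "z \<in> edges G" using assms incident_edges by fast+
  have "homotopic G (x, [(v, y), (v, z)]) (x, [(v, z)])"
    using elem_homotopy.shortcut[of G x "[]" v y z "[]"] assms e by (intro homotopic_elem) simp
  then show ?thesis using assms e
    by (simp add: gen_def comp_class homotopy_class_eq_iff)
qed

lemma ident_fund: "gpd_ident (FG G) x = homotopy_class G (x, [])"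
  by (simp add: fund_groupoid_def)

lemma gen_self: 
  assumes "x \<in> incident G v" shows "gen G x v x = gpd_ident (FG G) x"
proof -
  have e: "x \<in> edges G" using assms incident_edges by fast
  have "homotopic G (x, [(v, x)]) (x, [])"
    using elem_homotopy.stationary[of G x "[]" v x "[]"] assms e by (intro homotopic_elem) simp
  then show ?thesis using assms e
    by (simp add: gen_def ident_fund homotopy_class_eq_iff)
qed

lemma gen_mor [simp]:
  assumes "x \<in> incident G v" "y \<in> incident G v"
  shows "gen G x v y \<in> gpd_mor (FG G)" "gpd_src (FG G) (gen G x v y) = x" "gpd_tgt (FG G) (gen G x v y) = y"
  using assms incident_edges[of x G v] incident_edges[of y G v] by (auto simp: gen_def)

lemma class_Cons: "is_path G (x, (v, y) # p) \<Longrightarrow>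
   homotopy_class G (x, (v, y) # p) = gpd_comp (FG G) (gen G x v y) (homotopy_class G (y, p))"
  using is_path_fst[of G y p] by (auto simp: gen_def comp_class)

interpretation fund: gpd "fund_groupoid G" for G :: "('v, 'e) ribbon_graph"
proof
  show "gpd_src (FG G) m \<in> gpd_obj (FG G)" "gpd_tgt (FG G) m \<in> gpd_obj (FG G)" 
    if "m \<in> gpd_mor (FG G)" for m
    using mor_class[OF that] is_path_fst is_path_end by force+
  show "gpd_comp (FG G) m n \<in> gpd_mor (FG G)" "gpd_src (FG G) (gpd_comp (FG G) m n) = gpd_src (FG G) m"
     "gpd_tgt (FG G) (gpd_comp (FG G) m n) = gpd_tgt (FG G) n"
    if "m \<in> gpd_mor (FG G)" "n \<in> gpd_mor (FG G)" "gpd_tgt (FG G) m = gpd_src (FG G) n" for m n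
    using mor_class[OF that(1)] mor_class[OF that(2)] that(3) by (auto simp: comp_class)
  show "gpd_ident (FG G) x \<in> gpd_mor (FG G)" "gpd_src (FG G) (gpd_ident (FG G) x) = x"
     "gpd_tgt (FG G) (gpd_ident (FG G) x) = x" if "x \<in> gpd_obj (FG G)" for x
    using that by (simp_all add: ident_fund)
  show "gpd_comp (FG G) (gpd_comp (FG G) m n) p = gpd_comp (FG G) m (gpd_comp (FG G) n p)"
    if "m \<in> gpd_mor (FG G)" "n \<in> gpd_mor (FG G)" "p \<in> gpd_mor (FG G)"
      "gpd_tgt (FG G) m = gpd_src (FG G) n" "gpd_tgt (FG G) n = gpd_src (FG G) p" for m n p
    using mor_class[OF that(1)] mor_class[OF that(2)] mor_class[OF that(3)] that(4,5) 
    by (auto simp: comp_class)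
  show "gpd_comp (FG G) (gpd_ident (FG G) x) m = m" 
    if "m \<in> gpd_mor (FG G)" "gpd_src (FG G) m = x" for m x
    using mor_class[OF that(1)] that(2) is_path_fst by (fastforce simp: ident_fund comp_class)
  show "gpd_comp (FG G) m (gpd_ident (FG G) x) = m" 
    if "m \<in> gpd_mor (FG G)" "gpd_tgt (FG G) m = x" for m x
    using mor_class[OF that(1)] that(2) is_path_end by (fastforce simp: ident_fund comp_class)
  \<comment> \<open>The reverse path is built by induction from the end: the last step is undone
    first, and the two opposite steps through \<open>v\<close> contract by a shortcut followed by a
    stationary step.\<close>
  have inv_path: "\<exists>y q. is_path G (y, q) \<and> y = path_end (x, p) \<and> path_end (y, q) = x
      \<and> homotopic G (x, p @ q) (x, []) \<and> homotopic G (y, q @ p) (y, [])" if "is_path G (x, p)" for x p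
    using that
  proof (induction p arbitrary: x rule: rev_induct)
    case Nil
    then show ?case by (intro exI[of _ x] exI[of _ "[]"]) auto
  next
    case (snoc s p)
    obtain v z where s: "s = (v, z)" by fastforce
    let ?y = "path_end (x, p)"
    from snoc s have p: "is_path G (x, p)" and v: "?y \<in> incident G v" "z \<in> incident G v" by auto
    have e: "?y \<in> edges G" "z \<in> edges G" using v incident_edges by fast+
    from snoc.IH[OF p] obtain q where q: "is_path G (?y, q)" "path_end (?y, q) = x"
      "homotopic G (x, p @ q) (x, [])" "homotopic G (?y, q @ p) (?y, [])" by auto
    have 1: "homotopic G (y, [(v, z), (v, y)]) (y, [])" if "y \<in> incident G v" "z \<in> incident G v" for y z
    proof -
      have "y \<in> edges G" "z \<in> edges G" using that incident_edges by fast+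
      then show ?thesis using that elem_homotopy.shortcut[of G y "[]" v z y "[]"] 
        elem_homotopy.stationary[of G y "[]" v y "[]"] homotopic_elem homotopic_trans by fastforce
    qed
    have "homotopic G (?y, [(v, z), (v, ?y)] @ q) (?y, [] @ q)"
      by (rule homotopic_append_right[OF 1[OF v]]) (use q in simp)
    then have "homotopic G (x, p @ [(v, z), (v, ?y)] @ q) (x, p @ q)"
      using homotopic_append_left p by fastforce
    then have 2: "homotopic G (x, (p @ [s]) @ (v, ?y) # q) (x, [])"
      using q(3) homotopic_trans s by fastforce
    have "homotopic G (z, [(v, ?y)] @ (q @ p)) (z, [(v, ?y)] @ [])"
      by (rule homotopic_append_left[OF q(4)]) (use v e in auto)
    from homotopic_append_right[OF this, of "[s]"] have
      "homotopic G (z, ((v, ?y) # q) @ p @ [s]) (z, [(v, ?y), (v, z)])" using v e s q p by simp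
    with 1[OF v(2,1)] have 3: "homotopic G (z, ((v, ?y) # q) @ p @ [s]) (z, [])" 
      using homotopic_trans by blast
    show ?case using 2 3 q s v by (intro exI[of _ z] exI[of _ "(v, ?y) # q"]) auto
  qed
  show "\<exists>n\<in>gpd_mor (FG G). gpd_src (FG G) n = gpd_tgt (FG G) m \<and> gpd_tgt (FG G) n = gpd_src (FG G) m
      \<and> gpd_comp (FG G) m n = gpd_ident (FG G) (gpd_src (FG G) m)
      \<and> gpd_comp (FG G) n m = gpd_ident (FG G) (gpd_tgt (FG G) m)" if m: "m \<in> gpd_mor (FG G)" for m
  proof -
    obtain x p where p: "is_path G (x, p)" "m = homotopy_class G (x, p)" using mor_class[OF m] by blast
    from inv_path[OF p(1)] obtain q where q: "is_path G (path_end (x, p), q)" "path_end (path_end (x, p), q) = x"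
      "homotopic G (x, p @ q) (x, [])" "homotopic G (path_end (x, p), q @ p) (path_end (x, p), [])" by blast
    then show ?thesis using p is_path_fst[OF p(1)] is_path_end[OF p(1)]
      by (intro bexI[of _ "homotopy_class G (path_end (x, p), q)"]) 
        (auto simp: comp_class ident_fund homotopy_class_eq_iff)
  qed
qed

lemma gen_inv:
  assumes "x \<in> incident G v" "y \<in> incident G v"
  shows "gpd_inv (FG G) (gen G x v y) = gen G y v x"
  by (rule fund.inv_equality) (use assms in \<open>auto simp: gen_comp gen_self\<close>)

lemma fund_induct [consumes 1, case_names ident comp]:
  assumes "m \<in> gpd_mor (FG G)"
    and "\<And>x. x \<in> edges G \<Longrightarrow> P (gpd_ident (FG G) x)"
    and "\<And>x v y m. \<lbrakk>x \<in> incident G v; y \<in> incident G v; m \<in> gpd_mor (FG G); gpd_src (FG G) m = y; P m\<rbrakk>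
      \<Longrightarrow> P (gpd_comp (FG G) (gen G x v y) m)"
  shows "P m"
proof -
  have "is_path G (x, p) \<Longrightarrow> P (homotopy_class G (x, p))" for x p
  proof (induction p arbitrary: x)
    case Nil then show ?case using assms(2) by (simp add: ident_fund)
  next
    case (Cons s p)
    obtain v y where s: "s = (v, y)" by fastforce
    show ?case using Cons s assms(3)[of x v y "homotopy_class G (y, p)"]
      by (simp add: class_Cons)
  qed
  then show ?thesis using mor_class[OF assms(1)] by blast
qed

text \<open>Choose one base edge \<open>b v\<close> per vertex. Every generator
  \<open>(x, y)_v\<close> is \<open>(x, b v)_v\<close> followed by the inverse of
  \<open>(y, b v)_v\<close>, so agreement on generators that end at base edges is enough.\<close>

lemma functor_eqI:
  assumes Y: "gpd Y" and F: "functorial (FG G) Y F" and K: "functorial (FG G) Y K"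
    and obj: "\<And>x. x \<in> edges G \<Longrightarrow> fst F x = fst K x"
    and base: "\<And>v x. x \<in> incident G v \<Longrightarrow> b v \<in> incident G v \<and> snd F (gen G x v (b v)) = snd K (gen G x v (b v))"
    and m: "m \<in> gpd_mor (FG G)"
  shows "snd F m = snd K m"
proof -
  have step: "snd F (gen G x v y) = snd K (gen G x v y)" if "x \<in> incident G v" "y \<in> incident G v" for x y v
  proof -
    have b: "b v \<in> incident G v" using base that by blast
    have "snd F (gpd_inv (FG G) (gen G y v (b v))) = snd K (gpd_inv (FG G) (gen G y v (b v)))"
      using base[OF that(2)] functorial_inv[OF fund.gpd_axioms Y F, of "gen G y v (b v)"]
        functorial_inv[OF fund.gpd_axioms Y K, of "gen G y v (b v)"] that by simp
    then have "snd F (gen G (b v) v y) = snd K (gen G (b v) v y)" using that b by (simp add: gen_inv)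
    then show ?thesis
      using functorialD(5)[OF F, of "gen G x v (b v)" "gen G (b v) v y"] 
        functorialD(5)[OF K, of "gen G x v (b v)" "gen G (b v) v y"] that b base[OF that(1)]
      by (simp add: gen_comp)
  qed
  from m show ?thesis
  proof (induction rule: fund_induct)
    case (ident x)
    then show ?case using functorial_ident[OF fund.gpd_axioms Y F, of x] 
      functorial_ident[OF fund.gpd_axioms Y K, of x] obj by simp
  next
    case (comp x v y m)
    then show ?case using functorialD(5)[OF F, of "gen G x v y" m] functorialD(5)[OF K, of "gen G x v y" m] step
      by simp
  qed
qed


section \<open>Functors on the fundamental groupoid\<close>

text \<open>Since the star of a vertex is contractible, a functor on the fundamental groupoid is given by
  an arbitrary choice, for each vertex \<open>v\<close> and each edge \<open>x\<close> at \<open>v\<close>, of a morphism \<open>H v x\<close> from the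
  image of \<open>x\<close> to an object depending only on \<open>v\<close>.\<close>

fun path_image :: "('o, 'm) groupoid \<Rightarrow> ('e \<Rightarrow> 'o) \<Rightarrow> ('v \<Rightarrow> 'e \<Rightarrow> 'm) \<Rightarrow> ('v, 'e) path \<Rightarrow> 'm" where
  "path_image Y f H (x, []) = gpd_ident Y (f x)"
| "path_image Y f H (x, (v, y) # p) =
    gpd_comp Y (gpd_comp Y (H v x) (gpd_inv Y (H v y))) (path_image Y f H (y, p))"

definition star_functor :: "('v, 'e) ribbon_graph \<Rightarrow> ('e, 'm) groupoid \<Rightarrow> ('v \<Rightarrow> 'e \<Rightarrow> 'm)
    \<Rightarrow> ('e \<Rightarrow> 'e) \<times> (('v, 'e) path set \<Rightarrow> 'm)" where
  "star_functor G Y H =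
    (\<lambda>x\<in>edges G. x, \<lambda>A\<in>gpd_mor (FG G). path_image Y (\<lambda>x. x) H (path_rep A))"

text \<open>A step through \<open>v\<close> is sent to \<open>H v x\<close> followed by the inverse
  of \<open>H v y\<close>. Stationary steps cancel and consecutive steps through the same vertex
  telescope, which is invariance under both elementary homotopies; hence the choice made by
  \<open>path_rep\<close> does not matter.\<close>

lemma star_functor:
  assumes Y: "gpd Y" "gpd_obj Y = edges G"
    and H: "\<And>v x. x \<in> incident G v \<Longrightarrow> H v x \<in> gpd_mor Y \<and> gpd_src Y (H v x) = x \<and> gpd_tgt Y (H v x) = B v"
  shows star_functorial: "functorial (FG G) Y (star_functor G Y H)"
    and star_functor_gen: "\<lbrakk>x \<in> incident G v; y \<in> incident G v\<rbrakk> \<Longrightarrow>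
      snd (star_functor G Y H) (gen G x v y) = gpd_comp Y (H v x) (gpd_inv Y (H v y))"
proof -
  interpret Y: gpd Y by (rule Y)
  let ?P = "path_image Y (\<lambda>x. x) H"
  have P_all: "?P (x, p) \<in> gpd_mor Y \<and> gpd_src Y (?P (x, p)) = x 
     \<and> gpd_tgt Y (?P (x, p)) = path_end (x, p)" if "is_path G (x, p)" for x p
    using that
  proof (induction p arbitrary: x)
    case (Cons s p)
    obtain v y where s: "s = (v, y)" by fastforce
    have y: "is_path G (y, p)" using Cons.prems s by auto
    show ?case using Cons.IH[OF y] H[of x v] H[of y v] Cons.prems s by simp
  qed (auto simp: Y)
  then have P: "?P (x, p) \<in> gpd_mor Y" "gpd_src Y (?P (x, p)) = x" 
     "gpd_tgt Y (?P (x, p)) = path_end (x, p)" if "is_path G (x, p)" for x p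
    using that by blast+
  have P_append: "?P (x, p @ q) = gpd_comp Y (?P (x, p)) (?P (path_end (x, p), q))"
    if "is_path G (x, p)" "is_path G (path_end (x, p), q)" for x p q
    using that
  proof (induction p arbitrary: x)
    case Nil
    then show ?case using P[of x q] by simp
  next
    case (Cons s p)
    obtain v y where s: "s = (v, y)" by fastforce
    have y: "is_path G (y, p)" using Cons s by auto
    show ?case using Cons.IH[OF y] Cons.prems s P[OF y] P[of "path_end (y, p)" q] H[of x v] H[of y v]
      by (simp add: Y.comp_assoc)
  qed
  have P_elem: "?P p = ?P q" if "elem_homotopy G p q" for p q
    using that
  proof (cases rule: elem_homotopy.cases)
    case (stationary x p v y q)
    then show ?thesis using P_append[of x p "(v, y) # q"] P_append[of x p q] P[of x p] P[of y q] H[of y v]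
      by auto
  next
    case (shortcut x p v y z q)
    let ?w = "path_end (x, p)"
    have "?P (?w, (v, y) # (v, z) # q) = ?P (?w, (v, z) # q)"
      using shortcut P[of z q] H[of ?w v] H[of y v] H[of z v] by (simp add: Y.comp_assoc)
    then show ?thesis using shortcut P_append[of x p "(v, y) # (v, z) # q"] P_append[of x p "(v, z) # q"] 
      by (auto simp del: path_image.simps)
  qed
  have P_homotopic: "?P p = ?P q" if "homotopic G p q" for p q
    using that by (induction rule: homotopic_induct) (use P_elem in auto)
  have F: "snd (star_functor G Y H) (homotopy_class G p) = ?P p" if "is_path G p" for p
    using P_homotopic[OF path_rep_class(2)[OF that]] that by (simp add: star_functor_def)
  show "functorial (FG G) Y (star_functor G Y H)"
    unfolding functorial_def
  proof (intro conjI ballI impI)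
    show "fst (star_functor G Y H) x \<in> gpd_obj Y" if "x \<in> gpd_obj (FG G)" for x
      using that Y(2) by (simp add: star_functor_def)
    fix m assume "m \<in> gpd_mor (FG G)"
    then obtain x p where m: "is_path G (x, p)" "m = homotopy_class G (x, p)" using mor_class by blast
    show "snd (star_functor G Y H) m \<in> gpd_mor Y" 
      "gpd_src Y (snd (star_functor G Y H) m) = fst (star_functor G Y H) (gpd_src (FG G) m)"
      "gpd_tgt Y (snd (star_functor G Y H) m) = fst (star_functor G Y H) (gpd_tgt (FG G) m)"
      using m P[OF m(1)] F[OF m(1)] is_path_fst[OF m(1)] is_path_end[OF m(1)]
      by (auto simp: star_functor_def)
    fix n assume "n \<in> gpd_mor (FG G)" "gpd_tgt (FG G) m = gpd_src (FG G) n"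
    then obtain y q where n: "is_path G (y, q)" "n = homotopy_class G (y, q)" "y = path_end (x, p)" 
      using mor_class m by fastforce
    show "snd (star_functor G Y H) (gpd_comp (FG G) m n) 
      = gpd_comp Y (snd (star_functor G Y H) m) (snd (star_functor G Y H) n)"
      using m n P_append[of x p q] by (simp add: F comp_class)
  qed
  show "snd (star_functor G Y H) (gen G x v y) = gpd_comp Y (H v x) (gpd_inv Y (H v y))"
    if "x \<in> incident G v" "y \<in> incident G v"
    using that incident_edges[of x G v] incident_edges[of y G v] H[of x v] H[of y v] 
    by (simp add: gen_def F)
qed


section \<open>Modular graphs\<close>

lemma orbit_subset:
  assumes "x \<in> T" "\<And>y. y \<in> T \<Longrightarrow> f y \<in> T" shows "orbit f x \<subseteq> T"
proof
  fix z assume "z \<in> orbit f x" then show "z \<in> T" by induction (use assms in auto)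
qed

text \<open>A shorter cycle would give an \<open>f\<close>-stable set with at most two elements,
  whereas \<open>S\<close> is the orbit of each of its elements.\<close>

lemma cyclic_on_3:
  assumes "cyclic_on f S" "card S = 3" "x \<in> S"
  shows "S = {x, f x, f (f x)}" "f (f (f x)) = x" "x \<noteq> f x" "f x \<noteq> f (f x)" "x \<noteq> f (f x)"
proof -
  have S: "S = orbit f y" if "y \<in> S" for y using assms(1) that by (auto simp: cyclic_on_alldef)
  have fin: "f y \<in> S" if "y \<in> S" for y using assms(1) that by (rule cyclic_on_inI)
  have small: "\<not> S \<subseteq> {a, b}" for a b
  proof
    assume "S \<subseteq> {a, b}"
    then have "card S \<le> card {a, b}" by (rule card_mono[rotated]) auto
    also have "\<dots> \<le> 2" by (simp add: card_insert_if)
    finally show False using assms(2) by simp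
  qed
  have 1: "y \<noteq> f y" if "y \<in> S" for y
    using orbit_subset[of y "{y, y}" f] S[OF that] small[of y y] by auto
  have 2: "y \<noteq> f (f y)" if "y \<in> S" for y
  proof
    assume "y = f (f y)"
    then have "orbit f y \<subseteq> {y, f y}" by (intro orbit_subset) auto
    then show False using S[OF that] small[of y "f y"] by auto
  qed
  show d: "x \<noteq> f x" "f x \<noteq> f (f x)" "x \<noteq> f (f x)" using 1 2 fin assms(3) by auto
  have "{x, f x, f (f x)} \<subseteq> S" "card {x, f x, f (f x)} = 3" using d fin assms(3) by auto
  then show e: "S = {x, f x, f (f x)}" using assms(2) 
    by (metis card.infinite card_subset_eq zero_neq_numeral)
  show "f (f (f x)) = x" using 1[of "f (f x)"] 2[of "f x"] fin assms(3) e by (metis insertE singletonD)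
qed

lemma cyclic_on_2:
  assumes "cyclic_on f S" "card S = 2" "x \<in> S"
  shows "S = {x, f x}" "f (f x) = x" "x \<noteq> f x"
proof -
  have S: "S = orbit f y" if "y \<in> S" for y using assms(1) that by (auto simp: cyclic_on_alldef)
  have fin: "f y \<in> S" if "y \<in> S" for y using assms(1) that by (rule cyclic_on_inI)
  have small: "\<not> S \<subseteq> {a}" for a
    using card_mono[of "{a}" S] assms(2) by auto
  have 1: "y \<noteq> f y" if "y \<in> S" for y
    using orbit_subset[of y "{y}" f] S[OF that] small[of y] by auto
  show d: "x \<noteq> f x" using 1 assms(3) by auto
  have "{x, f x} \<subseteq> S" "card {x, f x} = 2" using d fin assms(3) by auto
  then show e: "S = {x, f x}" using assms(2) 
    by (metis card.infinite card_subset_eq zero_neq_numeral)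
  show "f (f x) = x" using 1[of "f x"] fin[of "f x"] fin assms(3) e by (metis insertE singletonD)
qed

lemma cyclic_on_3I: "\<lbrakk>f x = y; f y = z; f z = x\<rbrakk> \<Longrightarrow> cyclic_on f {x, y, z}"
proof -
  assume f: "f x = y" "f y = z" "f z = x"
  have "orbit f x \<subseteq> {x, y, z}" by (rule orbit_subset) (use f in auto)
  moreover have "y \<in> orbit f x" using f(1) orbit.base by metis
  moreover have "z \<in> orbit f x" using f(2) calculation(2) orbit.step by metis
  moreover have "x \<in> orbit f x" using f(3) calculation(3) orbit.step by metis
  ultimately show ?thesis unfolding cyclic_on_def by blast
qed

context
  fixes G :: "('v, 'e) ribbon_graph"
  assumes G: "modular_graph G"
begin

lemma mg_ends:
  assumes "x \<in> edges G"
  shows "ends G x = {vert2 G x, vert3 G x}" "degree G (vert2 G x) = 2" "degree G (vert3 G x) = 3"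
proof -
  obtain u v where uv: "ends G x = {u, v}" "degree G u = 2" "degree G v = 3"
    using G assms by (auto simp: modular_graph_def)
  have "vert2 G x = u" "vert3 G x = v"
    unfolding vert2_def vert3_def using uv by (auto intro!: the_equality)
  then show "ends G x = {vert2 G x, vert3 G x}" "degree G (vert2 G x) = 2" "degree G (vert3 G x) = 3"
    using uv by auto
qed

lemma vert2_neq_vert3 [simp]: "\<lbrakk>x \<in> edges G; y \<in> edges G\<rbrakk> \<Longrightarrow> vert2 G x \<noteq> vert3 G y"
   "\<lbrakk>x \<in> edges G; y \<in> edges G\<rbrakk> \<Longrightarrow> vert3 G y \<noteq> vert2 G x"
  using mg_ends(2)[of x] mg_ends(3)[of y] by auto

lemma incident_iff: "x \<in> incident G v \<longleftrightarrow> x \<in> edges G \<and> (v = vert2 G x \<or> v = vert3 G x)"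
  using mg_ends by (auto simp: incident_def)

lemma incident_vert [simp]: "x \<in> edges G \<Longrightarrow> x \<in> incident G (vert2 G x)"
  "x \<in> edges G \<Longrightarrow> x \<in> incident G (vert3 G x)"
  by (simp_all add: incident_iff)

lemma vert_verts [simp]: "x \<in> edges G \<Longrightarrow> vert2 G x \<in> verts G" "x \<in> edges G \<Longrightarrow> vert3 G x \<in> verts G"
  using G mg_ends(1)[of x] by (auto simp: modular_graph_def ribbon_graph_def)

lemma incident_vert3: "x \<in> edges G \<Longrightarrow> incident G (vert3 G x) = {y \<in> edges G. vert3 G y = vert3 G x}"
  by (auto simp: incident_iff)

lemma ex_twin: 
  assumes "x \<in> edges G" shows "incident G (vert2 G x) = {x, twin G x} \<and> twin G x \<noteq> x"
proof -
  have "card (incident G (vert2 G x)) = 2" using mg_ends(2)[OF assms] by (simp add: degree_def)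
  then obtain y where y: "incident G (vert2 G x) = {x, y}" "y \<noteq> x" 
    using incident_vert(1)[OF assms] by (auto simp: card_2_iff) (metis insert_commute)+
  have "twin G x = y" unfolding twin_def using y by (intro the_equality) auto
  then show ?thesis using y by auto
qed

lemma incident_vert2: "x \<in> edges G \<Longrightarrow> incident G (vert2 G x) = {x, twin G x}"
  and twin_neq [simp]: "x \<in> edges G \<Longrightarrow> twin G x \<noteq> x" "x \<in> edges G \<Longrightarrow> x \<noteq> twin G x"
  using ex_twin by metis+

lemma twin_edge [simp]: "x \<in> edges G \<Longrightarrow> twin G x \<in> edges G"
  using incident_vert2[of x] incident_edges by fastforce

lemma vert2_twin [simp]: "x \<in> edges G \<Longrightarrow> vert2 G (twin G x) = vert2 G x"
proof -
  assume x: "x \<in> edges G"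
  then have "twin G x \<in> incident G (vert2 G x)" by (simp add: incident_vert2)
  then show ?thesis using x by (auto simp: incident_iff)
qed

lemma vert2_eq_iff: "\<lbrakk>x \<in> edges G; y \<in> edges G\<rbrakk> \<Longrightarrow> vert2 G x = vert2 G y \<longleftrightarrow> y = x \<or> y = twin G x"
  using incident_vert2[of x] incident_vert(1)[of y] vert2_twin[of x] by (metis insert_iff singletonD)

lemma twin_twin [simp]: "x \<in> edges G \<Longrightarrow> twin G (twin G x) = x"
  using vert2_eq_iff[of "twin G x" x] by auto

lemma twin_eq_iff [simp]: "\<lbrakk>x \<in> edges G; y \<in> edges G\<rbrakk> \<Longrightarrow> twin G x = twin G y \<longleftrightarrow> x = y"
  using twin_twin by metis

lemma rot_cyclic: "v \<in> verts G \<Longrightarrow> cyclic_on (rot G v) (incident G v)"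
  using G by (simp add: modular_graph_def ribbon_graph_def)

lemma vert_cases:
  assumes "v \<in> verts G"
  obtains x where "x \<in> edges G" "v = vert2 G x" | x where "x \<in> edges G" "v = vert3 G x"
proof -
  have "incident G v \<noteq> {}" using rot_cyclic[OF assms] by (auto simp: cyclic_on_alldef)
  then obtain x where "x \<in> incident G v" by blast
  then show ?thesis using that(1)[of x] that(2)[of x] by (auto simp: incident_iff)
qed

lemma star3:
  assumes "x \<in> edges G"
  defines "u \<equiv> vert3 G x"
  shows "incident G u = {x, rot G u x, rot G u (rot G u x)}" "rot G u (rot G u (rot G u x)) = x"
    "x \<noteq> rot G u x" "rot G u x \<noteq> rot G u (rot G u x)" "x \<noteq> rot G u (rot G u x)"
proof -
  have "cyclic_on (rot G u) (incident G u)" "card (incident G u) = 3" "x \<in> incident G u"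
    using rot_cyclic[of u] assms mg_ends(3)[of x] by (simp_all add: degree_def)
  note * = cyclic_on_3[OF this]
  show "incident G u = {x, rot G u x, rot G u (rot G u x)}" "rot G u (rot G u (rot G u x)) = x"
    "x \<noteq> rot G u x" "rot G u x \<noteq> rot G u (rot G u x)" "x \<noteq> rot G u (rot G u x)"
    by (fact *)+
qed

text \<open>A walk in the graph becomes a morphism by changing from one edge to the next at each
  vertex that it visits.\<close>

lemma fund_connected: 
  assumes "x \<in> edges G" "y \<in> edges G"
  shows "gpd_hom (FG G) x y \<noteq> {}"
proof -
  let ?R = "{(s, t). \<exists>x\<in>edges G. ends G x = {s, t}}"
  have "(u, v) \<in> ?R\<^sup>* \<Longrightarrow> x \<in> incident G u \<Longrightarrow> \<forall>y \<in> incident G v. \<exists>m. m \<in> gpd_hom (FG G) x y" for u v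
  proof (induction rule: rtrancl_induct)
    case base
    then have "gen G x u y \<in> gpd_hom (FG G) x y" if "y \<in> incident G u" for y
      using that by (simp add: gpd_hom_def)
    then show ?case by blast
  next
    case (step v w)
    then obtain z where z: "z \<in> edges G" "ends G z = {v, w}" by auto
    then have zi: "z \<in> incident G v" "z \<in> incident G w" by (auto simp: incident_def)
    then obtain m where m: "m \<in> gpd_hom (FG G) x z" using step by blast
    show ?case
    proof
      fix y assume "y \<in> incident G w"
      then have "gpd_comp (FG G) m (gen G z w y) \<in> gpd_hom (FG G) x y"
        using m zi by (simp add: gpd_hom_def)
      then show "\<exists>m. m \<in> gpd_hom (FG G) x y" by blast
    qed
  qed
  moreover have "(vert3 G x, vert3 G y) \<in> ?R\<^sup>*"
    using G assms vert_verts by (auto simp: modular_graph_def connected_graph_def)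
  ultimately show ?thesis using assms incident_vert by blast
qed

lemma verts3: "{v \<in> verts G. degree G v = 3} = vert3 G ` edges G"
proof (intro equalityI subsetI)
  fix v assume "v \<in> {v \<in> verts G. degree G v = 3}"
  then have v: "v \<in> verts G" "degree G v = 3" by auto
  from v(1) show "v \<in> vert3 G ` edges G"
    by (cases rule: vert_cases) (use v mg_ends in auto)
qed (auto simp: mg_ends)

lemma card_edges_vert3: 
  assumes "finite (edges G)" shows "card (edges G) = 3 * card (vert3 G ` edges G)"
proof -
  have "edges G = (\<Union>v\<in>vert3 G ` edges G. incident G v)" by (auto simp: incident_edges)
  then have "card (edges G) = card (\<Union>v\<in>vert3 G ` edges G. incident G v)" by simp
  also have "\<dots> = (\<Sum>v\<in>vert3 G ` edges G. card (incident G v))"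
  proof (rule card_UN_disjoint)
    show "\<forall>v\<in>vert3 G ` edges G. finite (incident G v)"
      using assms by (auto intro!: finite_subset[OF _ assms] simp: incident_edges)
  qed (use assms in \<open>auto simp: incident_vert3\<close>)
  also have "\<dots> = (\<Sum>v\<in>vert3 G ` edges G. 3)"
    by (rule sum.cong) (use mg_ends(3) in \<open>auto simp: degree_def\<close>)
  finally show ?thesis by simp
qed

lemma card_edges_vert2: 
  assumes "finite (edges G)" shows "card (edges G) = 2 * card (vert2 G ` edges G)"
proof -
  have "edges G = (\<Union>v\<in>vert2 G ` edges G. incident G v)" by (auto simp: incident_edges)
  then have "card (edges G) = card (\<Union>v\<in>vert2 G ` edges G. incident G v)" by simp
  also have "\<dots> = (\<Sum>v\<in>vert2 G ` edges G. card (incident G v))"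
  proof (rule card_UN_disjoint)
    show "\<forall>v\<in>vert2 G ` edges G. finite (incident G v)"
      using assms by (auto intro!: finite_subset[OF _ assms] simp: incident_edges)
    show "\<forall>i\<in>vert2 G ` edges G. \<forall>j\<in>vert2 G ` edges G. i \<noteq> j \<longrightarrow> incident G i \<inter> incident G j = {}"
      by (auto simp: incident_iff)
  qed (use assms in auto)
  also have "\<dots> = (\<Sum>v\<in>vert2 G ` edges G. 2)"
    by (rule sum.cong) (use mg_ends(2) in \<open>auto simp: degree_def\<close>)
  finally show ?thesis by simp
qed

lemma verts_eq: "verts G = vert2 G ` edges G \<union> vert3 G ` edges G"
  by (auto elim: vert_cases)

lemma card_verts:
  assumes "finite (edges G)" 
  shows "card (verts G) = card (vert2 G ` edges G) + card (vert3 G ` edges G)"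
  unfolding verts_eq by (rule card_Un_disjoint) (use assms in auto)

end

text \<open>Converse of \<open>fund_connected\<close>. It allows connectedness to be transferred
  through the fundamental groupoid, for instance along the functor of a flip.\<close>

lemma connected_graphI:
  assumes "ribbon_graph G" "verts G \<noteq> {}"
    and "\<And>x y. x \<in> edges G \<Longrightarrow> y \<in> edges G \<Longrightarrow> gpd_hom (FG G) x y \<noteq> {}"
  shows "connected_graph G"
proof -
  let ?R = "{(s, t). \<exists>x\<in>edges G. ends G x = {s, t}}"
  have edge: "(s, t) \<in> ?R\<^sup>*" if "x \<in> edges G" "s \<in> ends G x" "t \<in> ends G x" for s t x
  proof (cases "s = t")
    case False
    have "card (ends G x) = 2" using assms(1) that by (auto simp: ribbon_graph_def)
    then have "ends G x = {s, t}" using that False by (auto simp: card_2_iff)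
    then show ?thesis using that by auto
  qed simp
  have path: "(s, t) \<in> ?R\<^sup>*" if "is_path G (x, p)" "s \<in> ends G x" "t \<in> ends G (path_end (x, p))" for x p s t
    using that
  proof (induction p arbitrary: x s)
    case Nil
    then show ?case using edge[of x s t] by auto
  next
    case (Cons q p)
    obtain v y where q: "q = (v, y)" by fastforce
    have "(s, v) \<in> ?R\<^sup>*" using edge[of x s v] Cons.prems q by (auto simp: incident_def)
    moreover have "(v, t) \<in> ?R\<^sup>*" using Cons.IH[of y v] Cons.prems q by (auto simp: incident_def)
    ultimately show ?case by (rule rtrancl_trans)
  qed
  have "(s, t) \<in> ?R\<^sup>*" if "s \<in> verts G" "t \<in> verts G" for s t
  proof -
    have "incident G s \<noteq> {}" "incident G t \<noteq> {}" 
      using assms(1) that by (auto simp: ribbon_graph_def cyclic_on_alldef)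
    then obtain x y where xy: "x \<in> incident G s" "y \<in> incident G t" by blast
    then obtain m where "m \<in> gpd_hom (FG G) x y" using assms(3)[of x y] incident_edges by fast
    then obtain p where "is_path G (x, p)" "path_end (x, p) = y" 
      using mor_class by (fastforce simp: gpd_hom_def)
    then show ?thesis using path[of x p s t] xy by (auto simp: incident_def)
  qed
  then show ?thesis using assms(2) by (auto simp: connected_graph_def)
qed


section \<open>Functors to a group\<close>

text \<open>Up to natural isomorphism, a functor from the fundamental groupoid to a group (written
  additively) is trivial at the vertices of degree 3. It is then given by the values \<open>m x\<close> on the
  paths from \<open>x\<close> to its twin.\<close>

definition twin_odd :: "('v, 'e) ribbon_graph \<Rightarrow> ('e \<Rightarrow> 'w::group_add) \<Rightarrow> bool" where
  "twin_odd G m \<longleftrightarrow> (\<forall>x\<in>edges G. m (twin G x) = - m x)"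

definition step_val :: "('v, 'e) ribbon_graph \<Rightarrow> ('e \<Rightarrow> 'w::group_add) \<Rightarrow> 'e \<Rightarrow> 'v \<Rightarrow> 'e \<Rightarrow> 'w" where
  "step_val G m x v y = (if v = vert2 G x \<and> y \<noteq> x then m x else 0)"

fun path_val :: "('v, 'e) ribbon_graph \<Rightarrow> ('e \<Rightarrow> 'w::group_add) \<Rightarrow> ('v, 'e) path \<Rightarrow> 'w" where
  "path_val G m (x, []) = 0"
| "path_val G m (x, (v, y) # p) = step_val G m x v y + path_val G m (y, p)"

definition val :: "('v, 'e) ribbon_graph \<Rightarrow> ('e \<Rightarrow> 'w::group_add) \<Rightarrow> ('v, 'e) path set \<Rightarrow> 'w" where
  "val G m A = path_val G m (path_rep A)"

lemma path_val_append: 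
  "path_val G m (x, p @ q) = path_val G m (x, p) + path_val G m (path_end (x, p), q)"
  by (induction p arbitrary: x) (auto simp: add.assoc)

context
  fixes G :: "('v, 'e) ribbon_graph" and m :: "'e \<Rightarrow> 'w::group_add"
  assumes G: "modular_graph G" and m: "twin_odd G m"
begin

text \<open>The cocycle identity behind homotopy invariance. At a vertex of degree 3 all terms
  vanish; at a vertex of degree 2 the only nontrivial case is going to the twin and back, where
  oddness of \<open>m\<close> is used.\<close>

lemma step_val_add:
  assumes "x \<in> incident G v" "y \<in> incident G v" "z \<in> incident G v"
  shows "step_val G m x v y + step_val G m y v z = step_val G m x v z"
proof (cases "v = vert2 G x")
  case True
  have x: "x \<in> edges G" using assms incident_edges by fast
  have "y \<in> {x, twin G x}" "z \<in> {x, twin G x}" using assms True incident_vert2[OF G x] by auto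
  moreover have "m (twin G x) = - m x" "vert2 G (twin G x) = vert2 G x" "twin G x \<noteq> x" 
    using x G m by (simp_all add: twin_odd_def)
  ultimately show ?thesis using True by (elim insertE; simp add: step_val_def)
next
  case False
  have e: "x \<in> edges G" "y \<in> edges G" using assms incident_edges by fast+
  then have "v = vert3 G x" using assms False incident_iff[OF G] by auto
  then have "v \<noteq> vert2 G y" using G e by simp
  then show ?thesis using False by (simp add: step_val_def)
qed

lemma path_val_homotopic: 
  assumes "homotopic G p q" shows "path_val G m p = path_val G m q"
proof -
  have "path_val G m p = path_val G m q" if "elem_homotopy G p q" for p q
    using that
  proof (cases rule: elem_homotopy.cases)
    case (stationary x p v y q)
    then show ?thesis by (simp add: path_val_append step_val_def)
  next
    case (shortcut x p v y z q)
    then show ?thesis using step_val_add[of "path_end (x, p)" v y z]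
      by (simp add: path_val_append add.assoc[symmetric])
  qed
  with assms show ?thesis by (induction rule: homotopic_induct) auto
qed

lemma val_class: "is_path G p \<Longrightarrow> val G m (homotopy_class G p) = path_val G m p"
  unfolding val_def using path_val_homotopic path_rep_class by metis

lemma val_comp: 
  assumes "a \<in> gpd_mor (FG G)" "b \<in> gpd_mor (FG G)" "gpd_tgt (FG G) a = gpd_src (FG G) b"
  shows "val G m (gpd_comp (FG G) a b) = val G m a + val G m b"
proof -
  obtain x p y q where "is_path G (x, p)" "a = homotopy_class G (x, p)"
    "is_path G (y, q)" "b = homotopy_class G (y, q)" using assms(1,2) mor_class by metis
  then show ?thesis using assms(3) by (auto simp: comp_class val_class path_val_append)
qed

lemma val_gen: "\<lbrakk>x \<in> incident G v; y \<in> incident G v\<rbrakk> \<Longrightarrow> val G m (gen G x v y) = step_val G m x v y"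
  using incident_edges[of y G v] by (simp add: gen_def val_class)

lemma val_ident: "x \<in> edges G \<Longrightarrow> val G m (gpd_ident (FG G) x) = 0"
  by (simp add: ident_fund val_class)

lemma val_inv: "a \<in> gpd_mor (FG G) \<Longrightarrow> val G m (gpd_inv (FG G) a) = - val G m a"
  using val_comp[of a "gpd_inv (FG G) a"] fund.src_obj[of a G] 
  by (simp add: val_ident minus_unique)

lemma val_gen_vert3 [simp]: 
  "\<lbrakk>x \<in> edges G; y \<in> edges G; vert3 G y = vert3 G x\<rbrakk> \<Longrightarrow> val G m (gen G x (vert3 G x) y) = 0"
  using G by (simp add: val_gen incident_iff step_val_def)

lemma val_gen_twin [simp]: 
  "x \<in> edges G \<Longrightarrow> val G m (gen G x (vert2 G x) (twin G x)) = m x"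
  using G by (simp add: val_gen incident_vert2 step_val_def)

end

text \<open>The analogue of \<open>functor_eqI\<close> for values in a group: generators into one
  base edge per vertex determine all values, and identities go to 0 because their values are
  idempotent.\<close>

lemma group_functor_eqI:
  fixes M N :: "('v, 'e) path set \<Rightarrow> 'w::group_add"
  assumes M: "\<And>a b. \<lbrakk>a \<in> gpd_mor (FG G); b \<in> gpd_mor (FG G); gpd_tgt (FG G) a = gpd_src (FG G) b\<rbrakk>
      \<Longrightarrow> M (gpd_comp (FG G) a b) = M a + M b"
    and N: "\<And>a b. \<lbrakk>a \<in> gpd_mor (FG G); b \<in> gpd_mor (FG G); gpd_tgt (FG G) a = gpd_src (FG G) b\<rbrakk>
      \<Longrightarrow> N (gpd_comp (FG G) a b) = N a + N b"
    and base: "\<And>v x. x \<in> incident G v \<Longrightarrow> b v \<in> incident G v \<and> M (gen G x v (b v)) = N (gen G x v (b v))"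
    and m: "m \<in> gpd_mor (FG G)"
  shows "M m = N m"
proof -
  have ident: "M (gpd_ident (FG G) x) = 0" "N (gpd_ident (FG G) x) = 0" if "x \<in> edges G" for x
    using M[of "gpd_ident (FG G) x" "gpd_ident (FG G) x"] N[of "gpd_ident (FG G) x" "gpd_ident (FG G) x"] that
    by (simp_all) (metis add.right_neutral add_left_imp_eq)+
  have step: "M (gen G x v y) = N (gen G x v y)" if x: "x \<in> incident G v" "y \<in> incident G v" for x y v
  proof -
    have b: "b v \<in> incident G v" using base that by blast
    have "M (gen G x v (b v)) = M (gen G x v y) + M (gen G y v (b v))"
      "N (gen G x v (b v)) = N (gen G x v y) + N (gen G y v (b v))"
      using M[of "gen G x v y" "gen G y v (b v)"] N[of "gen G x v y" "gen G y v (b v)"] x b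
      by (simp_all add: gen_comp)
    then show ?thesis using base[OF x(1)] base[OF x(2)] by simp
  qed
  from m show ?thesis
  proof (induction rule: fund_induct)
    case (comp x v y m)
    then show ?case using M[of "gen G x v y" m] N[of "gen G x v y" m] step by simp
  qed (simp add: ident)
qed


section \<open>Flips\<close>

lemma homotopic_cong:
  assumes "edges G = edges G'" "\<And>v. incident G v = incident G' v"
  shows "is_path G = is_path G'" "homotopic G = homotopic G'"
proof -
  have "is_path G (x, p) = is_path G' (x, p)" for x p
    by (induction p arbitrary: x) (auto simp: assms)
  then show p: "is_path G = is_path G'" by auto
  have "elem_homotopy A q r \<Longrightarrow> elem_homotopy B q r" if "is_path A = is_path B" 
    for q r and A B :: "('v, 'e) ribbon_graph"
    by (induction rule: elem_homotopy.induct) (use that in \<open>auto intro: elem_homotopy.intros\<close>)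
  from this[OF p] this[OF p[symmetric]] have "elem_homotopy G = elem_homotopy G'" by blast
  then show "homotopic G = homotopic G'" by (simp add: homotopic_def)
qed

text \<open>The homotopy relation sees only incidences, never the cyclic orders. So shuffled graphs,
  and graphs restored after a flip, have equal groupoids and not merely isomorphic ones, which lets
  identity functors serve as morphisms between them.\<close>

lemma fund_groupoid_cong:
  assumes "edges G = edges G'" "\<And>v. incident G v = incident G' v"
  shows "FG G = FG G'"
  by (simp add: fund_groupoid_def homotopy_class_def[abs_def] homotopic_cong[OF assms] assms(1))

lemma gen_cong:
  assumes "edges G = edges G'" "\<And>v. incident G v = incident G' v"
  shows "gen G = gen G'"
  by (simp add: gen_def[abs_def] homotopy_class_def[abs_def] homotopic_cong[OF assms])

text \<open>A flip, without its effect on the ribbon structure: the edge \<open>a\<close> moves from \<open>u\<close> to \<open>w\<close> along the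
  twins \<open>f\<close> and \<open>e\<close>, and \<open>d\<close> moves from \<open>w\<close> to \<open>u\<close>. The inverse operation has the same form.\<close>

definition slide :: "('v, 'e) ribbon_graph \<Rightarrow> ('v, 'e) ribbon_graph \<Rightarrow> 'e \<Rightarrow> 'e \<Rightarrow> 'e \<Rightarrow> 'e \<Rightarrow>
    'v \<Rightarrow> 'v \<Rightarrow> 'v \<Rightarrow> bool" where
  "slide G G' f e a d u w v \<longleftrightarrow> edges G' = edges G \<and> u \<noteq> w \<and> v \<noteq> u \<and> v \<noteq> w
    \<and> f \<in> incident G u \<and> f \<in> incident G v \<and> e \<in> incident G w \<and> e \<in> incident G v
    \<and> a \<in> incident G u \<and> a \<notin> incident G w \<and> d \<in> incident G w \<and> d \<notin> incident G u \<and> a \<noteq> f \<and> d \<noteq> e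
    \<and> incident G' u = insert d (incident G u - {a}) \<and> incident G' w = insert a (incident G w - {d})
    \<and> (\<forall>t. t \<noteq> u \<and> t \<noteq> w \<longrightarrow> incident G' t = incident G t)"

lemma slide_sym: "slide G G' f e a d u w v \<Longrightarrow> slide G' G f e d a u w v"
  unfolding slide_def by auto

text \<open>The base edges \<open>f\<close> at \<open>u\<close> and \<open>e\<close> at
  \<open>w\<close> are incident to these vertices both before and after the slide, so one choice of
  base edges works for both graphs.\<close>

definition slide_base where
  "slide_base G f e u w t = (if t = u then f else if t = w then e else (SOME y. y \<in> incident G t))"

text \<open>The data for \<open>star_functor\<close>: the path in the new graph from
  \<open>x\<close> to the base edge at \<open>t\<close>. Only \<open>a\<close> and \<open>d\<close>,
  which have left their vertices, take a detour through the twins.\<close>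

definition slide_mor where
  "slide_mor G' f e a d u w v t x =
    (if t = u \<and> x = a then gpd_comp (FG G') (gen G' a w e) (gen G' e v f)
     else if t = w \<and> x = d then gpd_comp (FG G') (gen G' d u f) (gen G' f v e)
     else gen G' x t (slide_base G' f e u w t))"

definition slide_functor where
  "slide_functor G G' f e a d u w v = star_functor G (FG G') (slide_mor G' f e a d u w v)"

lemma slide_base:
  assumes "slide G G' f e a d u w v" "x \<in> incident G t"
  shows "slide_base G' f e u w t \<in> incident G t" "slide_base G' f e u w t \<in> incident G' t"
  using assms by (auto simp: slide_def slide_base_def intro: someI)

lemma slide_mor:
  assumes "slide G G' f e a d u w v" "x \<in> incident G t"
  shows "slide_mor G' f e a d u w v t x \<in> gpd_mor (FG G')
      \<and> gpd_src (FG G') (slide_mor G' f e a d u w v t x) = x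
      \<and> gpd_tgt (FG G') (slide_mor G' f e a d u w v t x) = slide_base G' f e u w t"
proof -
  note b = slide_base[OF assms]
  show ?thesis using assms b by (auto simp: slide_def slide_mor_def slide_base_def)
qed

lemma slide_functorial:
  assumes "slide G G' f e a d u w v"
  shows "functorial (FG G) (FG G') (slide_functor G G' f e a d u w v)"
  unfolding slide_functor_def
  by (rule star_functorial[OF fund.gpd_axioms]) (use assms slide_mor[OF assms] in \<open>auto simp: slide_def\<close>)

lemma slide_functor_obj:
  assumes "slide G G' f e a d u w v" "x \<in> edges G"
  shows "fst (slide_functor G G' f e a d u w v) x = x"
  using assms(2) by (simp add: slide_functor_def star_functor_def)

lemma slide_functor_base:
  assumes "slide G G' f e a d u w v" "x \<in> incident G t"
  shows "snd (slide_functor G G' f e a d u w v) (gen G x t (slide_base G' f e u w t))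
    = slide_mor G' f e a d u w v t x"
proof -
  let ?b = "slide_base G' f e u w t"
  have "snd (slide_functor G G' f e a d u w v) (gen G x t ?b)
    = gpd_comp (FG G') (slide_mor G' f e a d u w v t x) (gpd_inv (FG G') (slide_mor G' f e a d u w v t ?b))"
    unfolding slide_functor_def
    by (rule star_functor_gen[OF fund.gpd_axioms]) 
      (use assms slide_mor[OF assms(1)] slide_base[OF assms] in \<open>auto simp: slide_def\<close>)
  moreover have "slide_mor G' f e a d u w v t ?b = gpd_ident (FG G') ?b"
    using assms slide_base[OF assms] by (auto simp: slide_mor_def slide_base_def slide_def gen_self)
  ultimately show ?thesis 
    using slide_mor[OF assms] slide_base[OF assms] incident_edges[of ?b G' t] by simp
qed

lemma slide_functor_a:
  "slide G G' f e a d u w v \<Longrightarrow> snd (slide_functor G G' f e a d u w v) (gen G a u f)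
    = gpd_comp (FG G') (gen G' a w e) (gen G' e v f)"
  using slide_functor_base[of G G' f e a d u w v a u] by (auto simp: slide_def slide_mor_def slide_base_def)

lemma slide_functor_d:
  "slide G G' f e a d u w v \<Longrightarrow> snd (slide_functor G G' f e a d u w v) (gen G d w e)
    = gpd_comp (FG G') (gen G' d u f) (gen G' f v e)"
  using slide_functor_base[of G G' f e a d u w v d w] by (auto simp: slide_def slide_mor_def slide_base_def)

lemma slide_functor_u:
  "\<lbrakk>slide G G' f e a d u w v; x \<in> incident G u; x \<noteq> a\<rbrakk> 
    \<Longrightarrow> snd (slide_functor G G' f e a d u w v) (gen G x u f) = gen G' x u f"
  using slide_functor_base[of G G' f e a d u w v x u] by (auto simp: slide_def slide_mor_def slide_base_def)

lemma slide_functor_w: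
  "\<lbrakk>slide G G' f e a d u w v; x \<in> incident G w; x \<noteq> d\<rbrakk> 
    \<Longrightarrow> snd (slide_functor G G' f e a d u w v) (gen G x w e) = gen G' x w e"
  using slide_functor_base[of G G' f e a d u w v x w] by (auto simp: slide_def slide_mor_def slide_base_def)

lemma slide_functor_other:
  assumes "slide G G' f e a d u w v" "t \<noteq> u" "t \<noteq> w" "x \<in> incident G t" "y \<in> incident G t"
  shows "snd (slide_functor G G' f e a d u w v) (gen G x t y) = gen G' x t y"
proof -
  have i: "incident G' t = incident G t" using assms by (simp add: slide_def)
  have "snd (slide_functor G G' f e a d u w v) (gen G x t y)
    = gpd_comp (FG G') (slide_mor G' f e a d u w v t x) (gpd_inv (FG G') (slide_mor G' f e a d u w v t y))"
    unfolding slide_functor_def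
    by (rule star_functor_gen[OF fund.gpd_axioms]) 
      (use assms slide_mor[OF assms(1)] slide_base[OF assms(1)] in \<open>auto simp: slide_def\<close>)
  then show ?thesis using assms slide_base[OF assms(1,4)] i 
    by (simp add: slide_mor_def gen_inv gen_comp)
qed

text \<open>It suffices to look at paths into base edges. The detour of \<open>a\<close> or
  \<open>d\<close> is undone by the detour of the reverse slide, up to crossing the twin pair forth
  and back, which cancels.\<close>

lemma slide_functor_inverse:
  assumes s: "slide G G' f e a d u w v"
  defines "F \<equiv> slide_functor G G' f e a d u w v" and "K \<equiv> slide_functor G' G f e d a u w v"
  assumes m: "m \<in> gpd_mor (FG G)"
  shows "snd K (snd F m) = m"
proof -
  note s' = slide_sym[OF s]
  note F = slide_functorial[OF s, folded F_def] and K = slide_functorial[OF s', folded K_def]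
  have KF: "functorial (FG G) (FG G) (functor_comp (FG G) K F)"
    by (rule functorial_comp[OF fund.gpd_axioms F K])
  have e: "edges G' = edges G" using s by (simp add: slide_def)
  have i: "incident G' u = insert d (incident G u - {a})" "incident G' w = insert a (incident G w - {d})"
    using s by (auto simp: slide_def)
  have "snd (functor_comp (FG G) K F) m = snd (functor_id (FG G)) m"
  proof (rule functor_eqI[OF fund.gpd_axioms KF functorial_id[OF fund.gpd_axioms] _ _ m, where b = "slide_base G' f e u w"])
    show "fst (functor_comp (FG G) K F) x = fst (functor_id (FG G)) x" if "x \<in> edges G" for x
      using that s s' e by (simp add: functor_comp_def functor_id_def compose_def F_def K_def slide_functor_obj)
    fix t x assume x: "x \<in> incident G t"
    let ?b = "slide_base G' f e u w t"
    have b: "?b \<in> incident G t" "?b \<in> incident G' t" using slide_base[OF s x] by auto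
    have "snd K (snd F (gen G x t ?b)) = gen G x t ?b"
    proof (cases "t = u \<or> t = w")
      case False
      then have "incident G' t = incident G t" using s by (simp add: slide_def)
      then show ?thesis using False x b by (simp add: F_def K_def slide_functor_other[OF s] slide_functor_other[OF s'])
    next
      case True
      have v: "e \<in> incident G v" "f \<in> incident G v" "e \<in> incident G' v" "f \<in> incident G' v" "v \<noteq> u" "v \<noteq> w" 
        "e \<in> incident G' w" "f \<in> incident G' u" "e \<in> incident G w" "f \<in> incident G u"
        using s by (auto simp: slide_def)
      have K1: "snd K (gen G' e v f) = gen G e v f" "snd K (gen G' f v e) = gen G f v e"
        using v by (simp_all add: K_def slide_functor_other[OF s'])
      from True consider "t = u" "x = a" | "t = u" "x \<noteq> a" | "t = w" "x = d" | "t = w" "x \<noteq> d" by blast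
      then show ?thesis
      proof cases
        case 1
        have "snd K (gpd_comp (FG G') (gen G' a w e) (gen G' e v f)) 
          = gpd_comp (FG G) (gpd_comp (FG G) (gen G a u f) (gen G f v e)) (gen G e v f)"
          using functorialD(5)[OF K, of "gen G' a w e" "gen G' e v f"] v i slide_functor_d[OF s'] K1 by (simp add: K_def)
        then show ?thesis using 1 v x b
          by (simp add: F_def slide_functor_a[OF s] slide_base_def fund.comp_assoc gen_comp gen_self)
      next
        case 2
        then have "x \<noteq> d" "x \<in> incident G' u" using x s by (auto simp: slide_def)
        then show ?thesis using 2 x
          by (simp add: F_def K_def slide_functor_u[OF s] slide_functor_u[OF s'] slide_base_def)
      next
        case 3
        have "snd K (gpd_comp (FG G') (gen G' d u f) (gen G' f v e)) 
          = gpd_comp (FG G) (gpd_comp (FG G) (gen G d w e) (gen G e v f)) (gen G f v e)"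
          using functorialD(5)[OF K, of "gen G' d u f" "gen G' f v e"] v i slide_functor_a[OF s'] K1 by (simp add: K_def)
        moreover have "w \<noteq> u" using s by (auto simp: slide_def)
        ultimately show ?thesis using 3 v x b
          by (simp add: F_def slide_functor_d[OF s] slide_base_def fund.comp_assoc gen_comp gen_self)
      next
        case 4
        then have "x \<noteq> a" "x \<in> incident G' w" "w \<noteq> u" using x s by (auto simp: slide_def)
        then show ?thesis using 4 x
          by (simp add: F_def K_def slide_functor_w[OF s] slide_functor_w[OF s'] slide_base_def)
      qed
    qed
    then show "?b \<in> incident G t \<and> snd (functor_comp (FG G) K F) (gen G x t ?b) = snd (functor_id (FG G)) (gen G x t ?b)"
      using x b by (simp add: functor_comp_def functor_id_def compose_def)
  qed
  then show ?thesis using m by (simp add: functor_comp_def functor_id_def compose_def)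
qed

lemma slide_functor_iso:
  assumes "slide G G' f e a d u w v"
  shows "slide_functor G G' f e a d u w v \<in> gpd_iso (FG G) (FG G')"
    and "functor_comp (FG G) (slide_functor G' G f e d a u w v) (slide_functor G G' f e a d u w v)
      = functor_id (FG G)"
proof -
  note s = slide_sym[OF assms]
  let ?F = "slide_functor G G' f e a d u w v" and ?K = "slide_functor G' G f e d a u w v"
  have e: "edges G' = edges G" using assms by (simp add: slide_def)
  have ext: "fst ?F \<in> extensional (edges G)" "snd ?F \<in> extensional (gpd_mor (FG G))"
    by (simp_all add: slide_functor_def star_functor_def)
  show "?F \<in> gpd_iso (FG G) (FG G')"
    by (rule gpd_iso_of_inverse[OF fund.gpd_axioms fund.gpd_axioms slide_functorial[OF assms] slide_functorial[OF s]])
      (use ext e in \<open>auto simp: slide_functor_obj[OF assms] slide_functor_obj[OF s] 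
        slide_functor_inverse[OF assms] slide_functor_inverse[OF s]\<close>)
  show "functor_comp (FG G) ?K ?F = functor_id (FG G)"
    by (auto simp: functor_comp_def functor_id_def compose_def fun_eq_iff e 
        slide_functor_obj[OF assms] slide_functor_obj[OF s] slide_functor_inverse[OF assms])
qed

section \<open>Flips as slides, and uniqueness of the functor induced by a flip\<close>

locale nontrivial_flip =
  fixes G :: "('v, 'e) ribbon_graph" and f :: 'e
  assumes G: "modular_graph G" and f: "f \<in> edges G" and nontrivial: "\<not> trivial_flip G f"
begin

definition "e = twin G f"
definition "u = vert3 G f"
definition "w = vert3 G e"
definition "v = vert2 G f"
definition "a = rot G u f"
definition "b = rot G u a"
definition "d = rot G w e"
definition "c = rot G w d"
definition "G' = flip G f"

lemma G'_simps [simp]: "verts G' = verts G" "edges G' = edges G"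
  "ends G' = (ends G)(a := insert w (ends G a - {u}), d := insert u (ends G d - {w}))"
  "rot G' = (rot G)(u := id(f := b, b := d, d := f), w := id(e := c, c := a, a := e))"
  using nontrivial by (simp_all add: G'_def flip_def Let_def a_def b_def c_def d_def e_def u_def w_def)

lemma ef: "e \<in> edges G" "vert3 G e = w" "vert3 G f = u" "u \<noteq> w" "e \<noteq> f" "twin G f = e"
  using nontrivial G f by (auto simp: trivial_flip_def e_def w_def u_def)

lemma star_u: "incident G u = {f, a, b}" "a \<noteq> f" "b \<noteq> f" "a \<noteq> b" "rot G u f = a" "rot G u a = b" "rot G u b = f"
  using star3[OF G f] by (auto simp: a_def b_def u_def)

lemma star_w: "incident G w = {e, d, c}" "d \<noteq> e" "c \<noteq> e" "c \<noteq> d" "rot G w e = d" "rot G w d = c" "rot G w c = e"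
  using star3[OF G ef(1)] ef(2) by (auto simp: c_def d_def)

lemma star_edges: "a \<in> edges G" "b \<in> edges G" "c \<in> edges G" "d \<in> edges G"
  using star_u(1) star_w(1) incident_edges[of _ G] by fastforce+

lemma star_vert3: "vert3 G a = u" "vert3 G b = u" "vert3 G c = w" "vert3 G d = w"
  using incident_vert3[OF G f] incident_vert3[OF G ef(1)] ef star_u(1) star_w(1) by auto

lemma star_disjoint: "a \<noteq> c" "a \<noteq> d" "a \<noteq> e" "b \<noteq> c" "b \<noteq> d" "b \<noteq> e" "f \<noteq> c" "f \<noteq> d"
  using star_vert3 ef by auto

lemma v: "v \<noteq> u" "v \<noteq> w" "incident G v = {f, e}" "v = vert2 G e"
  using vert2_neq_vert3(1)[OF G f f] vert2_neq_vert3(1)[OF G f ef(1)] ef incident_vert2[OF G f]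
    vert2_twin[OF G f] by (auto simp: v_def)

lemma vert2_ends: "x \<in> edges G \<Longrightarrow> vert2 G x \<noteq> u" "x \<in> edges G \<Longrightarrow> vert2 G x \<noteq> w"
  using vert2_neq_vert3(1)[OF G _ f] vert2_neq_vert3(1)[OF G _ ef(1)] ef by auto

lemma ends_G': "x \<in> edges G \<Longrightarrow> 
  ends G' x = {vert2 G x, if x = a then w else if x = d then u else vert3 G x}"
  using mg_ends(1)[OF G, of x] vert2_ends[of x] star_vert3 star_disjoint ef by auto

lemma incident_G': "incident G' u = {f, b, d}" "incident G' w = {e, c, a}"
    "t \<noteq> u \<Longrightarrow> t \<noteq> w \<Longrightarrow> incident G' t = incident G t"
proof -
  have mem: "x \<in> incident G' t \<longleftrightarrow> x \<in> edges G 
    \<and> (t = vert2 G x \<or> t = (if x = a then w else if x = d then u else vert3 G x))" for x t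
    using ends_G'[of x] by (simp only: incident_def G'_simps(2)) auto
  have "incident G' u = insert d (incident G u - {a})"
  proof (rule Set.set_eqI)
    fix x show "x \<in> incident G' u \<longleftrightarrow> x \<in> insert d (incident G u - {a})"
    proof (cases "x \<in> edges G")
      case True
      note * = vert2_ends(1)[OF True, symmetric]
      show ?thesis unfolding mem incident_iff[OF G] insert_iff Diff_iff
        using True * ef(4) star_disjoint(2) by (cases "x = a"; cases "x = d") simp_all
    next
      case False
      then show ?thesis using star_edges(4) incident_edges[of x G'] incident_edges[of x G] by auto
    qed
  qed
  then show "incident G' u = {f, b, d}" using star_u(1-4) by auto
  have "incident G' w = insert a (incident G w - {d})"
  proof (rule Set.set_eqI)
    fix x show "x \<in> incident G' w \<longleftrightarrow> x \<in> insert a (incident G w - {d})"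
    proof (cases "x \<in> edges G")
      case True
      note * = vert2_ends(2)[OF True, symmetric]
      show ?thesis unfolding mem incident_iff[OF G] insert_iff Diff_iff
        using True * ef(4) star_disjoint(2) by (cases "x = a"; cases "x = d") simp_all
    next
      case False
      then show ?thesis using star_edges(1) incident_edges[of x G'] incident_edges[of x G] by auto
    qed
  qed
  then show "incident G' w = {e, c, a}" using star_w(1-4) by auto
  show "incident G' t = incident G t" if "t \<noteq> u" "t \<noteq> w"
  proof (intro Set.set_eqI)
    fix x show "x \<in> incident G' t \<longleftrightarrow> x \<in> incident G t"
      unfolding mem incident_iff[OF G] using that star_vert3(1,4) 
      by (cases "x = a"; cases "x = d"; simp)
  qed
qed

lemma slide: "slide G G' f e a d u w v"
  unfolding slide_def incident_G'(1,2) star_u(1) star_w(1)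
  using ef v star_u(2-4) star_w(2-4) star_disjoint incident_G'(3) by auto

lemma degree_G' [simp]: "degree G' t = degree G t"
proof -
  consider "t = u" | "t = w" | "t \<noteq> u" "t \<noteq> w" by blast
  then show ?thesis
    by cases (use star_u(2-4) star_w(2-4) star_disjoint ef(5) in \<open>auto simp: degree_def incident_G' star_u(1) star_w(1)\<close>)
qed

text \<open>Degrees and cyclic orders are checked directly at \<open>u\<close> and \<open>w\<close>.
  Connectedness has no local argument; it is carried over by the slide functor, which fixes all
  objects.\<close>

lemma modular_G': "modular_graph G'"
proof -
  have deg: "degree G u = 3" "degree G w = 3" using mg_ends(3)[OF G] f ef by (metis, metis)
  have ribbon: "ribbon_graph G'"
    unfolding ribbon_graph_def
  proof (intro conjI ballI)
    fix x assume "x \<in> edges G'"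
    then have x: "x \<in> edges G" by simp
    have "u \<in> verts G" "w \<in> verts G" using vert_verts[OF G] f ef by metis+
    then show "ends G' x \<subseteq> verts G'" using x G by (simp only: ends_G'[OF x]) simp
    show "card (ends G' x) = 2" using x G vert2_ends[of x] vert2_neq_vert3(1)[OF G x x]
      by (simp only: ends_G'[OF x]) (auto simp: card_insert_if)
  next
    fix t assume t: "t \<in> verts G'"
    consider "t = u" | "t = w" | "t \<noteq> u" "t \<noteq> w" by blast
    then show "cyclic_on (rot G' t) (incident G' t)"
    proof cases
      case 1
      show ?thesis unfolding 1 incident_G' 
        by (rule cyclic_on_3I) (use ef star_u star_w star_disjoint in auto)
    next
      case 2
      show ?thesis unfolding 2 incident_G' 
        by (rule cyclic_on_3I) (use ef star_u star_w star_disjoint in auto)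
    next
      case 3
      then show ?thesis using rot_cyclic[OF G, of t] t by (simp add: incident_G'(3))
    qed
  qed
  have conn: "connected_graph G'"
  proof (rule connected_graphI[OF ribbon])
    show "verts G' \<noteq> {}" using vert_verts[OF G f] by auto
    fix x y assume "x \<in> edges G'" "y \<in> edges G'"
    then obtain m where m: "m \<in> gpd_hom (FG G) x y" using fund_connected[OF G, of x y] by auto
    have "snd (slide_functor G G' f e a d u w v) m \<in> gpd_hom (FG G') x y"
      using m functorialD[OF slide_functorial[OF slide]] slide_functor_obj[OF slide] \<open>x \<in> edges G'\<close> \<open>y \<in> edges G'\<close>
      by (auto simp: gpd_hom_def)
    then show "gpd_hom (FG G') x y \<noteq> {}" by blast
  qed
  show ?thesis
    unfolding modular_graph_def
  proof (intro conjI ballI ribbon conn)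
    fix x assume "x \<in> edges G'"
    then have x: "x \<in> edges G" by simp
    show "\<exists>s t. ends G' x = {s, t} \<and> degree G' s = 2 \<and> degree G' t = 3"
      using ends_G'[OF x] deg mg_ends[OF G x] by (intro exI) (rule conjI, assumption, simp)
  qed
qed

lemma vert2_G' [simp]: "x \<in> edges G \<Longrightarrow> vert2 G' x = vert2 G x"
  and vert3_G': "x \<in> edges G \<Longrightarrow> vert3 G' x = (if x = a then w else if x = d then u else vert3 G x)"
proof -
  assume x: "x \<in> edges G"
  let ?t = "if x = a then w else if x = d then u else vert3 G x"
  have deg: "degree G u = 3" "degree G w = 3" using mg_ends(3)[OF G] f ef by (metis, metis)
  have "{vert2 G' x, vert3 G' x} = {vert2 G x, ?t}" "degree G (vert2 G' x) = 2" "degree G (vert3 G' x) = 3"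
    using ends_G'[OF x] mg_ends[OF modular_G', of x] x by simp_all
  moreover have "degree G ?t = 3" "degree G (vert2 G x) = 2" using deg mg_ends(2,3)[OF G x] by auto
  moreover have "(2::nat) \<noteq> 3" by simp
  ultimately have "vert2 G' x = vert2 G x \<and> vert3 G' x = ?t" 
    unfolding doubleton_eq_iff by metis
  then show "vert2 G' x = vert2 G x" "vert3 G' x = ?t" by auto
qed

lemma twin_G' [simp]: "x \<in> edges G \<Longrightarrow> twin G' x = twin G x"
proof -
  assume x: "x \<in> edges G"
  have "{x, twin G' x} = {x, twin G x}"
    using incident_vert2[OF modular_G', of x] incident_vert2[OF G x] x incident_G'(3) vert2_ends by simp
  then show ?thesis using twin_neq(1)[OF modular_G', of x] x by auto
qed

text \<open>Existence is the slide functor. Uniqueness holds because the values prescribed by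
  \<open>flip_induces\<close> include those of all generators into one base edge per vertex, which
  is what \<open>functor_eqI\<close> asks for.\<close>

lemma flip_induces_iff: "flip_induces G f F \<longleftrightarrow> F = slide_functor G G' f e a d u w v" (is "_ \<longleftrightarrow> F = ?S")
proof -
  have f_v: "f \<in> incident G u" "e \<in> incident G w" "a \<in> incident G u" "b \<in> incident G u" "c \<in> incident G w" "d \<in> incident G w"
    "f \<in> incident G v" "e \<in> incident G v"
    using star_u star_w v by auto
  have unfold: "flip_induces G f F \<longleftrightarrow> F \<in> gpd_iso (FG G) (FG G') \<and> (\<forall>x\<in>edges G. fst F x = x)
           \<and> snd F (gen G a u f) = gpd_comp (FG G') (gen G' a w e) (gen G' e v f)
           \<and> snd F (gen G b u f) = gen G' b u f
           \<and> snd F (gen G c w e) = gen G' c w e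
           \<and> snd F (gen G d w e) = gpd_comp (FG G') (gen G' d u f) (gen G' f v e)
           \<and> snd F (gen G f v e) = gen G' f v e
           \<and> (\<forall>t\<in>verts G - {u, w, v}. \<forall>x\<in>incident G t. \<forall>y\<in>incident G t.
                snd F (gen G x t y) = gen G' x t y)" for F
    using nontrivial 
    by (simp add: flip_induces_def Let_def e_def u_def w_def v_def a_def b_def c_def d_def G'_def)
  have S: "flip_induces G f ?S"
    unfolding unfold
    using slide_functor_iso[OF slide] slide_functor_obj[OF slide] slide_functor_a[OF slide]
      slide_functor_d[OF slide] slide_functor_u[OF slide] slide_functor_w[OF slide] 
      slide_functor_other[OF slide] f_v v(1,2) star_u(2-4) star_w(2-4) by auto
  have "F = ?S" if "flip_induces G f F"
  proof -
    note F = that[unfolded unfold] and S = S[unfolded unfold]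
    have iF: "F \<in> gpd_iso (FG G) (FG G')" using F by blast
    have iS: "?S \<in> gpd_iso (FG G) (FG G')" using S by blast
    note fF = gpd_iso_functorial[OF iF] and fS = gpd_iso_functorial[OF iS]
    \<comment> \<open>Unlike in \<open>slide_base\<close>, the base edge at \<open>v\<close> has to
      be \<open>e\<close>: the only value prescribed there is that of the generator from
      \<open>f\<close> to \<open>e\<close>.\<close>
    define base where "base t = (if t = u then f else if t = w then e else if t = v then e else (SOME x. x \<in> incident G t))" for t
    have "snd F m = snd ?S m" if "m \<in> gpd_mor (FG G)" for m
    proof (rule functor_eqI[OF fund.gpd_axioms fF fS _ _ that, where b = base])
      show "fst F x = fst ?S x" if "x \<in> edges G" for x using F S that by simp
      fix t x assume x: "x \<in> incident G t"
      have id: "snd F (gen G x t x) = snd ?S (gen G x t x)"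
        using x functorial_ident[OF fund.gpd_axioms fund.gpd_axioms fF] incident_edges[OF x]
        functorial_ident[OF fund.gpd_axioms fund.gpd_axioms fS] F S by (simp add: gen_self)
      have tv: "t \<in> verts G" using x G by (auto simp: incident_iff)
      consider "t = u" | "t = w" | "t = v" | "t \<notin> {u, w, v}" by blast
      then show "base t \<in> incident G t \<and> snd F (gen G x t (base t)) = snd ?S (gen G x t (base t))"
      proof cases
        case 1
        then have "x \<in> {f, a, b}" using x star_u by simp
        then show ?thesis using F S id f_v 1 by (auto simp: base_def)
      next
        case 2
        then have "x \<in> {e, d, c}" using x star_w by simp
        then show ?thesis using F S id f_v 2 ef(4) by (auto simp: base_def)
      next
        case 3
        then have "x \<in> {f, e}" using x v by simp
        then show ?thesis using F S id f_v 3 v(1,2) by (auto simp: base_def)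
      next
        case 4
        then have "base t \<in> incident G t" using x by (auto simp: base_def intro: someI)
        then show ?thesis using F S 4 x tv by auto
      qed
    qed
    then have "snd F = snd ?S"
      by (intro extensionalityI[of _ "gpd_mor (FG G)"]) (use iF iS in \<open>auto simp: gpd_iso_def\<close>)
    moreover have "fst F = fst ?S"
      by (rule extensionalityI[of _ "edges G"]) (use F S iF iS in \<open>auto simp: gpd_iso_def\<close>)
    ultimately show ?thesis by (rule prod_eqI[rotated])
  qed
  then show ?thesis using S by blast
qed

end


section \<open>Isomorphisms of labeled graphs\<close>

abbreviation path_map :: "('v \<Rightarrow> 'v) \<Rightarrow> ('e \<Rightarrow> 'e) \<Rightarrow> ('v, 'e) path \<Rightarrow> ('v, 'e) path" where
  "path_map \<phi> \<psi> \<equiv> map_prod \<psi> (map (map_prod \<phi> \<psi>))"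

locale graph_iso =
  fixes G G' :: "('v, 'e) ribbon_graph" and l l' \<phi> \<psi>
  assumes G: "modular_graph G" and iso: "labeled_graph_iso (G, l) (G', l') \<phi> \<psi>"
begin

lemma bij: "bij_betw \<phi> (verts G) (verts G')" "bij_betw \<psi> (edges G) (edges G')"
  and ends: "x \<in> edges G \<Longrightarrow> ends G' (\<psi> x) = \<phi> ` ends G x"
  and label: "x \<in> edges G \<Longrightarrow> l' (\<psi> x) = l x"
  and rot: "\<lbrakk>v \<in> verts G; x \<in> incident G v\<rbrakk> \<Longrightarrow> rot G' (\<phi> v) (\<psi> x) = \<psi> (rot G v x)"
  using iso by (auto simp: labeled_graph_iso_def)

lemma ends_verts: "x \<in> edges G \<Longrightarrow> ends G x \<subseteq> verts G"
  using G by (auto simp: modular_graph_def ribbon_graph_def)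

lemma map_edges: "x \<in> edges G \<Longrightarrow> \<psi> x \<in> edges G'"
  using bij by (auto simp: bij_betw_def)

lemma edges_surj: "y \<in> edges G' \<Longrightarrow> \<exists>x\<in>edges G. y = \<psi> x"
  and verts_surj: "t \<in> verts G' \<Longrightarrow> \<exists>v\<in>verts G. t = \<phi> v"
  using bij by (auto simp: bij_betw_def image_iff set_eq_iff)

lemma incident_map: 
  assumes "v \<in> verts G" shows "incident G' (\<phi> v) = \<psi> ` incident G v"
proof -
  have "\<phi> v \<in> \<phi> ` ends G x \<longleftrightarrow> v \<in> ends G x" if "x \<in> edges G" for x
    using bij(1) assms ends_verts[OF that] by (auto simp: bij_betw_def inj_on_def)
  then have "{y \<in> \<psi> ` edges G. \<phi> v \<in> ends G' y} = \<psi> ` {x \<in> edges G. v \<in> ends G x}"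
    using ends by auto
  then show ?thesis using bij(2) by (simp add: incident_def bij_betw_def)
qed

lemma incident_mapI: "x \<in> incident G v \<Longrightarrow> \<psi> x \<in> incident G' (\<phi> v)"
  using incident_map[of v] ends_verts by (auto simp: incident_def)

lemma inverse: 
  assumes "modular_graph G'"
  shows "graph_iso G' G l' l (inv_into (verts G) \<phi>) (inv_into (edges G) \<psi>)"
proof
  let ?\<phi> = "inv_into (verts G) \<phi>" and ?\<psi> = "inv_into (edges G) \<psi>"
  have i: "inj_on \<phi> (verts G)" "inj_on \<psi> (edges G)" "\<phi> ` verts G = verts G'" "\<psi> ` edges G = edges G'"
    using bij by (auto simp: bij_betw_def)
  have 1: "ends G (?\<psi> y) = ?\<phi> ` ends G' y \<and> l (?\<psi> y) = l' y" if y: "y \<in> edges G'" for y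
  proof -
    obtain x where x: "x \<in> edges G" "y = \<psi> x" using edges_surj[OF y] by blast
    have "?\<phi> ` \<phi> ` ends G x = ends G x"
      using ends_verts[OF x(1)] i(1) by (simp add: inv_into_image_cancel)
    then show ?thesis using x i ends label by simp
  qed
  have 2: "rot G (?\<phi> v) (?\<psi> y) = ?\<psi> (rot G' v y)" if v: "v \<in> verts G'" and y: "y \<in> incident G' v" for v y
  proof -
    obtain t where t: "t \<in> verts G" "v = \<phi> t" using v verts_surj by blast
    then obtain x where x: "x \<in> incident G t" "y = \<psi> x" using y incident_map by auto
    have "rot G t x \<in> edges G" using rot_cyclic[OF G t(1)] x(1) cyclic_on_inI incident_edges by metis
    then show ?thesis using rot[OF t(1) x(1)] x t i incident_edges[OF x(1)] by simp
  qed
  show "labeled_graph_iso (G', l') (G, l) ?\<phi> ?\<psi>"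
    using bij 1 2 by (auto simp: labeled_graph_iso_def bij_betw_inv_into)
qed (rule assms)

lemma path_map:
  assumes "is_path G p" 
  shows "is_path G' (path_map \<phi> \<psi> p)" "path_end (path_map \<phi> \<psi> p) = \<psi> (path_end p)"
proof -
  have "is_path G (x, p) \<Longrightarrow> is_path G' (\<psi> x, map (map_prod \<phi> \<psi>) p) 
      \<and> path_end (\<psi> x, map (map_prod \<phi> \<psi>) p) = \<psi> (path_end (x, p))" for x p
    by (induction p arbitrary: x) (auto simp: map_edges incident_mapI)
  from this[of "fst p" "snd p"] assms 
  show "is_path G' (path_map \<phi> \<psi> p)" "path_end (path_map \<phi> \<psi> p) = \<psi> (path_end p)" 
    by (simp_all add: map_prod_def case_prod_unfold)
qed

lemma path_map_homotopic:
  assumes "homotopic G p q" "is_path G p"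
  shows "homotopic G' (path_map \<phi> \<psi> p) (path_map \<phi> \<psi> q)"
proof (rule homotopic_map[OF assms])
  fix p q assume e: "elem_homotopy G p q"
  note p = path_map[OF elem_homotopyD(1)[OF e]]
  from e show "homotopic G' (path_map \<phi> \<psi> p) (path_map \<phi> \<psi> q)"
  proof (cases rule: elem_homotopy.cases)
    case (stationary x r v y s)
    then have "elem_homotopy G' (path_map \<phi> \<psi> p) (path_map \<phi> \<psi> q)"
      using p(1) path_map(2)[of "(x, r)"] by (auto intro!: elem_homotopy.stationary)
    then show ?thesis by (rule homotopic_elem)
  next
    case (shortcut x r v y z s)
    then have "elem_homotopy G' (path_map \<phi> \<psi> p) (path_map \<phi> \<psi> q)"
      using p(1) by (auto intro!: elem_homotopy.shortcut)
    then show ?thesis by (rule homotopic_elem)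
  qed
qed

lemma modular_image_if_connected:
  assumes conn: "\<And>x y. x \<in> edges G' \<Longrightarrow> y \<in> edges G' \<Longrightarrow> gpd_hom (FG G') x y \<noteq> {}"
  shows "modular_graph G'"
proof -
  have i: "inj_on \<phi> (verts G)" "inj_on \<psi> (edges G)" "\<phi> ` verts G = verts G'" "\<psi> ` edges G = edges G'"
    using bij by (auto simp: bij_betw_def)
  have deg: "degree G' (\<phi> v) = degree G v" if "v \<in> verts G" for v
    unfolding degree_def incident_map[OF that]
    by (rule card_image) (use i(2) in \<open>auto simp: inj_on_def incident_edges\<close>)
  have ribbon: "ribbon_graph G'"
    unfolding ribbon_graph_def
  proof (intro conjI ballI)
    fix y assume "y \<in> edges G'"
    then obtain x where x: "x \<in> edges G" "y = \<psi> x" using edges_surj by blast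
    have c: "card (ends G x) = 2" using G x by (auto simp: modular_graph_def ribbon_graph_def)
    show "ends G' y \<subseteq> verts G'" using x ends ends_verts i(3) by blast
    have "inj_on \<phi> (ends G x)" using i(1) ends_verts[OF x(1)] inj_on_subset by blast
    then show "card (ends G' y) = 2" using x ends c by (simp add: card_image)
  next
    fix t assume "t \<in> verts G'"
    then obtain v where v: "v \<in> verts G" "t = \<phi> v" using verts_surj by blast
    show "cyclic_on (rot G' t) (incident G' t)"
      unfolding v(2) incident_map[OF v(1)]
      by (rule cyclic_on_image[OF rot_cyclic[OF G v(1)]]) (use rot[OF v(1)] in auto)
  qed
  have "verts G' \<noteq> {}" using G i by (auto simp: modular_graph_def connected_graph_def)
  then have "connected_graph G'" using connected_graphI[OF ribbon] conn by blast
  moreover have "\<exists>u v. ends G' y = {u, v} \<and> degree G' u = 2 \<and> degree G' v = 3" if y: "y \<in> edges G'" for y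
  proof -
    obtain x where x: "x \<in> edges G" "y = \<psi> x" using edges_surj[OF y] by blast
    show ?thesis using x ends mg_ends[OF G x(1)] deg vert_verts[OF G x(1)] 
      by (intro exI[of _ "\<phi> (vert2 G x)"] exI[of _ "\<phi> (vert3 G x)"]) auto
  qed
  ultimately show ?thesis using ribbon by (simp add: modular_graph_def)
qed

lemma modular_image: "modular_graph G'"
proof (rule modular_image_if_connected)
  fix x y assume "x \<in> edges G'" "y \<in> edges G'"
  then obtain x' y' where xy: "x' \<in> edges G" "y' \<in> edges G" "x = \<psi> x'" "y = \<psi> y'" 
    using edges_surj by blast
  then obtain m where m: "m \<in> gpd_hom (FG G) x' y'" using fund_connected[OF G, of x' y'] by auto
  then obtain p where p: "is_path G (x', p)" "path_end (x', p) = y'" 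
    using mor_class by (fastforce simp: gpd_hom_def)
  have "homotopy_class G' (path_map \<phi> \<psi> (x', p)) \<in> gpd_hom (FG G') x y"
    using path_map[OF p(1)] p xy by (simp add: gpd_hom_def)
  then show "gpd_hom (FG G') x y \<noteq> {}" by blast
qed

lemma path_map_inverse:
  assumes "is_path G p"
  shows "path_map (inv_into (verts G) \<phi>) (inv_into (edges G) \<psi>) (path_map \<phi> \<psi> p) = p"
proof -
  have i: "inj_on \<phi> (verts G)" "inj_on \<psi> (edges G)" using bij by (auto simp: bij_betw_def)
  have "is_path G (x, q) \<Longrightarrow> path_map (inv_into (verts G) \<phi>) (inv_into (edges G) \<psi>) (path_map \<phi> \<psi> (x, q)) = (x, q)" for x q
  proof (induction q arbitrary: x)
    case (Cons s q)
    then obtain v y where s: "s = (v, y)" by fastforce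
    have "v \<in> verts G" using Cons.prems s ends_verts by (auto simp: incident_def)
    then show ?case using Cons.IH[of y] Cons.prems s i incident_edges[of x G v] by auto
  qed (use i in auto)
  then show ?thesis using assms by (cases p) simp
qed

lemma path_map_inverse':
  assumes "is_path G' q"
  shows "path_map \<phi> \<psi> (path_map (inv_into (verts G) \<phi>) (inv_into (edges G) \<psi>) q) = q"
proof -
  interpret I: graph_iso G' G l' l "inv_into (verts G) \<phi>" "inv_into (edges G) \<psi>"
    by (rule inverse[OF modular_image])
  have i: "\<phi> ` verts G = verts G'" "\<psi> ` edges G = edges G'" using bij by (auto simp: bij_betw_def)
  have "is_path G' (x, q) \<Longrightarrow> path_map \<phi> \<psi> (path_map (inv_into (verts G) \<phi>) (inv_into (edges G) \<psi>) (x, q)) = (x, q)" for x q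
  proof (induction q arbitrary: x)
    case (Cons s q)
    then obtain v y where s: "s = (v, y)" by fastforce
    have "v \<in> verts G'" using Cons.prems s I.ends_verts by (auto simp: incident_def)
    then show ?case using Cons.IH[of y] Cons.prems s i incident_edges[of x G' v] by (auto simp: f_inv_into_f)
  qed (use i in \<open>auto simp: f_inv_into_f\<close>)
  then show ?thesis using assms by (cases q) simp
qed

text \<open>Homotopy invariance of \<open>path_map\<close> gives one inclusion. That the image is
  the whole class needs the inverse graph isomorphism, which pulls every homotopic path
  back.\<close>

lemma iso_functor_class:
  assumes "is_path G p"
  shows "snd (iso_functor G \<phi> \<psi>) (homotopy_class G p) = homotopy_class G' (path_map \<phi> \<psi> p)"
proof -
  interpret I: graph_iso G' G l' l "inv_into (verts G) \<phi>" "inv_into (edges G) \<psi>"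
    by (rule inverse[OF modular_image])
  let ?inv = "path_map (inv_into (verts G) \<phi>) (inv_into (edges G) \<psi>)"
  have "path_map \<phi> \<psi> ` homotopy_class G p = homotopy_class G' (path_map \<phi> \<psi> p)"
  proof (intro equalityI subsetI)
    fix r assume "r \<in> path_map \<phi> \<psi> ` homotopy_class G p"
    then obtain q where q: "q \<in> homotopy_class G p" "r = path_map \<phi> \<psi> q" by (rule imageE)
    then have "is_path G q" "homotopic G p q" by (auto simp: homotopy_class_def)
    then show "r \<in> homotopy_class G' (path_map \<phi> \<psi> p)"
      unfolding q(2) homotopy_class_def using path_map(1) path_map_homotopic assms by blast
  next
    fix r assume "r \<in> homotopy_class G' (path_map \<phi> \<psi> p)"
    then have r: "is_path G' r" "homotopic G' (path_map \<phi> \<psi> p) r" by (auto simp: homotopy_class_def)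
    have "homotopic G (?inv (path_map \<phi> \<psi> p)) (?inv r)"
      using I.path_map_homotopic r path_map(1)[OF assms] by blast
    then have "?inv r \<in> homotopy_class G p" 
      using path_map_inverse[OF assms] I.path_map(1)[OF r(1)] by (simp add: homotopy_class_def)
    then show "r \<in> path_map \<phi> \<psi> ` homotopy_class G p" 
      using path_map_inverse'[OF r(1)] by (metis imageI)
  qed
  then show ?thesis using assms by (simp add: iso_functor_def)
qed

lemma iso_functorial: "functorial (FG G) (FG G') (iso_functor G \<phi> \<psi>)"
  unfolding functorial_def
proof (intro conjI ballI impI)
  show "fst (iso_functor G \<phi> \<psi>) x \<in> gpd_obj (FG G')" if "x \<in> gpd_obj (FG G)" for x
    using that map_edges by (simp add: iso_functor_def)
  fix m assume "m \<in> gpd_mor (FG G)"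
  then obtain x p where m: "is_path G (x, p)" "m = homotopy_class G (x, p)" using mor_class by blast
  show "snd (iso_functor G \<phi> \<psi>) m \<in> gpd_mor (FG G')" 
    "gpd_src (FG G') (snd (iso_functor G \<phi> \<psi>) m) = fst (iso_functor G \<phi> \<psi>) (gpd_src (FG G) m)"
    "gpd_tgt (FG G') (snd (iso_functor G \<phi> \<psi>) m) = fst (iso_functor G \<phi> \<psi>) (gpd_tgt (FG G) m)"
    using m path_map[OF m(1)] iso_functor_class[OF m(1)] is_path_fst[OF m(1)] is_path_end[OF m(1)]
    by (simp_all add: iso_functor_def[of G \<phi> \<psi>])
  fix n assume "n \<in> gpd_mor (FG G)" "gpd_tgt (FG G) m = gpd_src (FG G) n"
  then obtain y q where n: "is_path G (y, q)" "n = homotopy_class G (y, q)" "y = path_end (x, p)" 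
    using mor_class m by fastforce
  show "snd (iso_functor G \<phi> \<psi>) (gpd_comp (FG G) m n) 
    = gpd_comp (FG G') (snd (iso_functor G \<phi> \<psi>) m) (snd (iso_functor G \<phi> \<psi>) n)"
    using m n path_map[OF m(1)] path_map[OF n(1)] by (simp add: iso_functor_class comp_class)
qed

lemma iso_functor_inverse:
  "x \<in> edges G \<Longrightarrow> fst (iso_functor G' (inv_into (verts G) \<phi>) (inv_into (edges G) \<psi>)) (fst (iso_functor G \<phi> \<psi>) x) = x"
  "m \<in> gpd_mor (FG G) \<Longrightarrow> 
    snd (iso_functor G' (inv_into (verts G) \<phi>) (inv_into (edges G) \<psi>)) (snd (iso_functor G \<phi> \<psi>) m) = m"
  "y \<in> edges G' \<Longrightarrow> fst (iso_functor G \<phi> \<psi>) (fst (iso_functor G' (inv_into (verts G) \<phi>) (inv_into (edges G) \<psi>)) y) = y"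
  "n \<in> gpd_mor (FG G') \<Longrightarrow> 
    snd (iso_functor G \<phi> \<psi>) (snd (iso_functor G' (inv_into (verts G) \<phi>) (inv_into (edges G) \<psi>)) n) = n"
proof -
  interpret I: graph_iso G' G l' l "inv_into (verts G) \<phi>" "inv_into (edges G) \<psi>"
    by (rule inverse[OF modular_image])
  let ?K = "iso_functor G' (inv_into (verts G) \<phi>) (inv_into (edges G) \<psi>)"
  have i: "inj_on \<psi> (edges G)" "\<psi> ` edges G = edges G'" using bij by (auto simp: bij_betw_def)
  show "fst ?K (fst (iso_functor G \<phi> \<psi>) x) = x" if "x \<in> edges G" 
    using that i map_edges by (simp add: iso_functor_def)
  show "fst (iso_functor G \<phi> \<psi>) (fst ?K y) = y" if "y \<in> edges G'" 
    using that i I.map_edges by (auto simp: iso_functor_def f_inv_into_f)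
  show "snd ?K (snd (iso_functor G \<phi> \<psi>) m) = m" if m': "m \<in> gpd_mor (FG G)"
  proof -
    obtain p where m: "is_path G p" "m = homotopy_class G p" using mor_class[OF m'] by blast
    show ?thesis using m iso_functor_class[OF m(1)] I.iso_functor_class[OF path_map(1)[OF m(1)]]
        path_map_inverse[OF m(1)] by simp
  qed
  show "snd (iso_functor G \<phi> \<psi>) (snd ?K n) = n" if n': "n \<in> gpd_mor (FG G')"
  proof -
    obtain p where m: "is_path G' p" "n = homotopy_class G' p" using mor_class[OF n'] by blast
    show ?thesis using m I.iso_functor_class[OF m(1)] iso_functor_class[OF I.path_map(1)[OF m(1)]]
        path_map_inverse'[OF m(1)] by simp
  qed
qed

lemma iso_functor_iso: "iso_functor G \<phi> \<psi> \<in> gpd_iso (FG G) (FG G')"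
proof -
  interpret I: graph_iso G' G l' l "inv_into (verts G) \<phi>" "inv_into (edges G) \<psi>"
    by (rule inverse[OF modular_image])
  show ?thesis
    by (rule gpd_iso_of_inverse[OF fund.gpd_axioms fund.gpd_axioms iso_functorial I.iso_functorial])
      (use iso_functor_inverse in \<open>auto simp: iso_functor_def\<close>)
qed

lemma iso_functor_comp:
  "functor_comp (FG G) (iso_functor G' (inv_into (verts G) \<phi>) (inv_into (edges G) \<psi>)) (iso_functor G \<phi> \<psi>) = functor_id (FG G)"
  using iso_functor_inverse(1,2) by (auto simp: functor_comp_def functor_id_def compose_def fun_eq_iff)

lemma iso_functor_gen:
  "\<lbrakk>x \<in> incident G v; y \<in> incident G v\<rbrakk> \<Longrightarrow> snd (iso_functor G \<phi> \<psi>) (gen G x v y) = gen G' (\<psi> x) (\<phi> v) (\<psi> y)"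
  using incident_edges[of y G v] by (simp add: gen_def iso_functor_class)

lemma vert_map:
  assumes "x \<in> edges G" shows "vert2 G' (\<psi> x) = \<phi> (vert2 G x)" "vert3 G' (\<psi> x) = \<phi> (vert3 G x)"
proof -
  have i: "inj_on \<psi> (edges G)" using bij by (auto simp: bij_betw_def)
  have deg: "degree G' (\<phi> v) = degree G v" if "v \<in> verts G" for v
    unfolding degree_def incident_map[OF that]
    by (rule card_image) (use i in \<open>auto simp: inj_on_def incident_edges\<close>)
  have "{vert2 G' (\<psi> x), vert3 G' (\<psi> x)} = {\<phi> (vert2 G x), \<phi> (vert3 G x)}"
    using ends[OF assms] mg_ends(1)[OF G assms] mg_ends(1)[OF modular_image map_edges[OF assms]] by simp
  moreover have "degree G' (\<phi> (vert2 G x)) = 2" "degree G' (\<phi> (vert3 G x)) = 3" 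
     "degree G' (vert2 G' (\<psi> x)) = 2" "degree G' (vert3 G' (\<psi> x)) = 3" "(2::nat) \<noteq> 3"
    using deg vert_verts[OF G assms] mg_ends[OF G assms] mg_ends[OF modular_image map_edges[OF assms]] by auto
  ultimately have "vert2 G' (\<psi> x) = \<phi> (vert2 G x) \<and> vert3 G' (\<psi> x) = \<phi> (vert3 G x)" 
    unfolding doubleton_eq_iff by metis
  then show "vert2 G' (\<psi> x) = \<phi> (vert2 G x)" "vert3 G' (\<psi> x) = \<phi> (vert3 G x)" by auto
qed

lemma twin_map: "x \<in> edges G \<Longrightarrow> twin G' (\<psi> x) = \<psi> (twin G x)"
proof -
  assume x: "x \<in> edges G"
  have i: "inj_on \<psi> (edges G)" using bij by (auto simp: bij_betw_def)
  have "incident G' (vert2 G' (\<psi> x)) = \<psi> ` incident G (vert2 G x)"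
    using incident_map[of "vert2 G x"] vert_map(1)[OF x] vert_verts[OF G x] by simp
  then have "{\<psi> x, twin G' (\<psi> x)} = {\<psi> x, \<psi> (twin G x)}"
    using incident_vert2[OF modular_image map_edges[OF x]] incident_vert2[OF G x] by simp
  then show ?thesis using twin_neq(1)[OF modular_image map_edges[OF x]] by auto
qed

end


section \<open>Morphisms of the outer modular groupoid\<close>

lemma iso_functor_id: "iso_functor G id id = functor_id (FG G)"
  by (simp add: iso_functor_def functor_id_def map_prod.id cong: restrict_cong)

text \<open>Records of the same graph can differ in irrelevant values, such as \<open>rot\<close> at
  edges that are not incident, for example after a shuffle is undone. The rule
  \<open>identify\<close> with identity maps absorbs these differences.\<close>

lemma OMG_mor_cong:
  assumes "verts G' = verts G" "edges G' = edges G" "\<And>x. x \<in> edges G \<Longrightarrow> ends G' x = ends G x"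
    and "\<And>v x. \<lbrakk>v \<in> verts G; x \<in> incident G v\<rbrakk> \<Longrightarrow> rot G' v x = rot G v x" 
    and "\<And>x. x \<in> edges G \<Longrightarrow> l' x = l x"
  shows "OMG_mor (G, l) (G', l') (functor_id (FG G))"
proof -
  have "labeled_graph_iso (G, l) (G', l') id id" using assms by (simp add: labeled_graph_iso_def)
  then show ?thesis using OMG_mor.identify iso_functor_id by metis
qed

lemma OMG_mor_compose_id_right:
  assumes "OMG_mor (G, l) (G', l') F" "F \<in> gpd_iso (FG G) (FG G')" "OMG_mor (G', l') (G'', l'') (functor_id (FG G'))"
  shows "OMG_mor (G, l) (G'', l'') F"
  using OMG_mor.compose[OF assms(1,3)] functor_comp_id_left[OF assms(2)] by simp

lemma OMG_mor_compose_id_left: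
  assumes "OMG_mor (G, l) (G', l') (functor_id (FG G))" "OMG_mor (G', l') (G'', l'') F" 
    "F \<in> gpd_iso (FG G) Y"
  shows "OMG_mor (G, l) (G'', l'') F"
  using OMG_mor.compose[OF assms(1,2)] functor_comp_id_right[OF assms(3)] by simp

section \<open>Shuffles, and the inverses of shuffles and flips\<close>

lemma shuffle_simps [simp]: "verts (shuffle G v) = verts G" "edges (shuffle G v) = edges G"
  "ends (shuffle G v) = ends G" "incident (shuffle G v) = incident G" "degree (shuffle G v) = degree G"
  "vert2 (shuffle G v) = vert2 G" "vert3 (shuffle G v) = vert3 G" "twin (shuffle G v) = twin G" 
  "rot (shuffle G v) = (rot G)(v := inv_into (incident G v) (rot G v))"
  by (auto simp: shuffle_def incident_def[abs_def] degree_def[abs_def] vert2_def[abs_def] vert3_def[abs_def] 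
      twin_def[abs_def] fun_eq_iff)

lemma shuffle_FG [simp]: "FG (shuffle G v) = FG G"
  by (rule fund_groupoid_cong) auto

text \<open>The inverse of a 3-cycle is its square, which makes the order after a shuffle computable
  from the old one.\<close>

lemma inv_into_cycle:
  assumes "S = {x, f x, f (f x)}" "f (f (f x)) = x" "x \<noteq> f x" "f x \<noteq> f (f x)" "x \<noteq> f (f x)"
  shows "inv_into S f x = f (f x)"
proof -
  have "inj_on f S" using assms by (auto simp: inj_on_def)
  then show ?thesis using inv_into_f_f[of f S "f (f x)"] assms by simp
qed

lemma connected_graph_cong:
  assumes "verts G' = verts G" "edges G' = edges G" "ends G' = ends G"
  shows "connected_graph G' = connected_graph G"
  using assms by (simp add: connected_graph_def)

lemma modular_graph_rot:
  assumes "modular_graph G" "verts G' = verts G" "edges G' = edges G" "ends G' = ends G"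
    and "\<And>v. v \<in> verts G \<Longrightarrow> cyclic_on (rot G' v) (incident G v)"
  shows "modular_graph G'"
proof -
  have "incident G' = incident G" "degree G' = degree G" 
    using assms(3,4) by (auto simp: incident_def[abs_def] degree_def[abs_def])
  then show ?thesis using assms connected_graph_cong[OF assms(2-4)] 
    by (simp add: modular_graph_def ribbon_graph_def)
qed

lemma shuffle_rot:
  assumes "modular_graph G" "x \<in> edges G"
  shows "rot (shuffle G (vert3 G x)) (vert3 G x) x = rot G (vert3 G x) (rot G (vert3 G x) x)"
  using inv_into_cycle[OF star3[OF assms]] by simp

lemma modular_shuffle:
  assumes "modular_graph G" "v \<in> verts G" "degree G v = 3" 
  shows "modular_graph (shuffle G v)"
proof (rule modular_graph_rot[OF assms(1)])
  obtain x where x: "x \<in> edges G" "v = vert3 G x" using verts3[OF assms(1)] assms by blast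
  fix t assume t: "t \<in> verts G"
  show "cyclic_on (rot (shuffle G v) t) (incident G t)"
  proof (cases "t = v")
    case True
    let ?r = "rot G v" 
    note star = star3[OF assms(1) x(1), folded x(2)]
    have e: "?r x \<in> edges G" "?r (?r x) \<in> edges G" "vert3 G (?r x) = v" "vert3 G (?r (?r x)) = v"
      using star(1) incident_vert3[OF assms(1) x(1)] x(2) by auto
    have s: "rot (shuffle G v) v x = ?r (?r x)" "rot (shuffle G v) v (?r (?r x)) = ?r x" 
       "rot (shuffle G v) v (?r x) = x"
      using shuffle_rot[OF assms(1) x(1)] shuffle_rot[OF assms(1) e(1)] shuffle_rot[OF assms(1) e(2)] x(2) e star(2)
      by simp_all
    have "incident G v = {x, ?r (?r x), ?r x}" using star(1) by auto
    then show ?thesis unfolding True using cyclic_on_3I[OF s(1-3)] by simp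
  qed (use rot_cyclic[OF assms(1) t] in simp)
qed simp_all

text \<open>Two shuffles apply the rotation four times, and a 3-cycle has order 3. Agreement is
  claimed only on incident edges, so equality of records is replaced by \<open>OMG_mor_cong\<close>
  afterwards.\<close>

lemma shuffle_shuffle:
  assumes "modular_graph G" "v \<in> verts G" "degree G v = 3" "t \<in> verts G" "x \<in> incident G t"
  shows "rot (shuffle (shuffle G v) v) t x = rot G t x"
proof (cases "t = v")
  case True
  note m = modular_shuffle[OF assms(1-3)]
  have x: "x \<in> edges G" "v = vert3 G x" using assms True incident_iff[OF assms(1)] mg_ends(2)[OF assms(1)] by fastforce+
  note star = star3[OF assms(1) x(1), folded x(2)]
  have e: "rot G v (rot G v x) \<in> edges G" "vert3 G (rot G v (rot G v x)) = v"
      using star(1) incident_vert3[OF assms(1) x(1)] x(2) by auto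
  have "rot (shuffle (shuffle G v) v) v x = rot (shuffle G v) v (rot (shuffle G v) v x)"
    using shuffle_rot[OF m, of x] x(1) x(2)[symmetric] by (simp del: shuffle_simps(9))
  also have "\<dots> = rot (shuffle G v) v (rot G v (rot G v x))" 
    using shuffle_rot[OF assms(1) x(1)] x(2)[symmetric] by (simp del: shuffle_simps(9))
  also have "\<dots> = rot G v (rot G v (rot G v (rot G v x)))"
    using shuffle_rot[OF assms(1) e(1)] e(2) by (simp del: shuffle_simps(9))
  finally show ?thesis using star(2) True by simp
qed simp

lemma OMG_shuffle_inverse:
  assumes "modular_graph G" "v \<in> verts G" "degree G v = 3"
  shows "OMG_mor (shuffle G v, l) (G, l) (functor_id (FG G))"
proof -
  have "OMG_mor (shuffle G v, l) (shuffle (shuffle G v) v, l) (functor_id (FG (shuffle G v)))"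
    by (rule OMG_mor.shuffle) (use assms in simp_all)
  moreover have "OMG_mor (shuffle (shuffle G v) v, l) (G, l) (functor_id (FG (shuffle (shuffle G v) v)))"
    by (rule OMG_mor_cong) (use shuffle_shuffle[OF assms] in simp_all)
  ultimately show ?thesis
    using OMG_mor_compose_id_right[of "shuffle G v" l "shuffle (shuffle G v) v" l] functor_id_iso[OF fund.gpd_axioms]
    by (metis shuffle_FG)
qed

text \<open>A flip is undone by shuffles at its two vertices, a flip at the same edge, and shuffles at the two
  vertices again.\<close>

lemma (in nontrivial_flip) OMG_flip_inverse:
  "OMG_mor (G', l) (G, l) (slide_functor G' G f e d a u w v)"
proof -
  let ?S1 = "shuffle G' u" let ?S = "shuffle ?S1 w"
  have uw: "u \<in> verts G" "w \<in> verts G" "degree G u = 3" "degree G w = 3" 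
    using vert_verts(2)[OF G f] vert_verts(2)[OF G ef(1)] mg_ends(3)[OF G f] mg_ends(3)[OF G ef(1)] ef by auto
  have m1: "modular_graph ?S1" by (rule modular_shuffle[OF modular_G']) (use uw in simp_all)
  have m2: "modular_graph ?S" by (rule modular_shuffle[OF m1]) (use uw in simp_all)
  have S: "incident ?S = incident G'" "edges ?S = edges G" "vert3 ?S = vert3 G'" "vert2 ?S = vert2 G'" "twin ?S = twin G'"
    "ends ?S = ends G'" "verts ?S = verts G" by simp_all
  have v3: "vert3 G' f = u" "vert3 G' e = w" "vert3 G' b = u" "vert3 G' c = w" "vert3 G' a = w" "vert3 G' d = u"
    using vert3_G' star_edges f ef star_u star_w star_disjoint star_vert3 by auto
  have r': "rot G' u f = b" "rot G' u b = d" "rot G' u d = f" "rot G' w e = c" "rot G' w c = a" "rot G' w a = e"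
    using ef star_u star_w star_disjoint by simp_all
  have rot_S: "rot ?S u f = d" "rot ?S u d = b" "rot ?S u b = f" "rot ?S w e = a" "rot ?S w a = c" "rot ?S w c = e"
  proof -
    have 1: "rot ?S1 u x = rot G' u (rot G' u x)" if "x \<in> edges G" "vert3 G' x = u" for x
      using shuffle_rot[OF modular_G', of x] that by (simp del: shuffle_simps(9) G'_simps(4))
    have 2: "rot ?S w x = rot ?S1 w (rot ?S1 w x)" if "x \<in> edges G" "vert3 G' x = w" for x
      using shuffle_rot[OF m1, of x] that uw by (simp del: shuffle_simps(9) G'_simps(4))
    have 3: "rot ?S u x = rot ?S1 u x" "rot ?S1 w x = rot G' w x" for x
      using ef(4) by simp_all
    show "rot ?S u f = d" "rot ?S u d = b" "rot ?S u b = f" "rot ?S w e = a" "rot ?S w a = c" "rot ?S w c = e"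
      using 1 2 3 v3 f ef(1) star_edges r' by (simp_all del: shuffle_simps(9) G'_simps(4))
  qed
  have nt: "\<not> trivial_flip ?S f" using ef v3 twin_G'[OF f] by (simp add: trivial_flip_def)
  interpret S: nontrivial_flip ?S f by unfold_locales (use m2 f nt in simp_all)
  have uw_S: "S.u = u" "S.e = e" "S.w = w" "S.v = v"
    using v3 ef f by (simp_all add: S.u_def S.e_def S.w_def S.v_def v_def)
  \<comment> \<open>In the reversed orders \<open>d\<close> follows \<open>f\<close> and
    \<open>a\<close> follows \<open>e\<close>. So the second flip sends \<open>d\<close> back to
    \<open>w\<close> and \<open>a\<close> back to \<open>u\<close>: it is the reverse slide.\<close>
  have abcd: "S.a = d" "S.b = b" "S.d = a" "S.c = c"
    unfolding S.a_def S.b_def S.c_def S.d_def uw_S using rot_S by (simp_all del: shuffle_simps(9) G'_simps(4))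
  let ?H = "S.G'"
  have inc: "incident ?H t = incident G t" for t
  proof -
    consider "t = u" | "t = w" | "t \<noteq> u" "t \<noteq> w" by blast
    then show ?thesis
      by cases (use S.incident_G' incident_G' star_u(1) star_w(1) in \<open>auto simp: uw_S abcd S\<close>)
  qed
  have FH: "FG ?H = FG G" "gen ?H = gen G" 
    by (rule fund_groupoid_cong gen_cong; use S.G'_simps(2) inc in simp)+
  \<comment> \<open>The slide functor is built from incidences alone, and these agree with those of
    \<open>G'\<close> before and of \<open>G\<close> after the second flip.\<close>
  have slides: "slide_functor ?S ?H f e d a u w v = slide_functor G' G f e d a u w v"
    unfolding slide_functor_def star_functor_def slide_mor_def slide_base_def inc FH by simp
  have 1: "OMG_mor (?S, l) (?H, l) (slide_functor G' G f e d a u w v)"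
  proof -
    have "flip_induces ?S f (slide_functor ?S ?H f e d a u w v)" 
      using S.flip_induces_iff uw_S abcd by simp
    then show ?thesis using OMG_mor.flip[of f ?S _ l] f S(2) slides S.G'_def by simp
  qed
  have iso: "slide_functor G' G f e d a u w v \<in> gpd_iso (FG G') (FG G)"
    using slide_functor_iso(1)[OF slide_sym[OF slide]] .
  have 2: "OMG_mor (G', l) (?S, l) (functor_id (FG G'))"
  proof -
    have "OMG_mor (G', l) (?S1, l) (functor_id (FG G'))" by (rule OMG_mor.shuffle) (use uw in simp_all)
    moreover have "OMG_mor (?S1, l) (?S, l) (functor_id (FG ?S1))" by (rule OMG_mor.shuffle) (use uw in simp_all)
    ultimately show ?thesis
      using OMG_mor_compose_id_right[of G' l ?S1 l "functor_id (FG G')" ?S l] functor_id_iso[OF fund.gpd_axioms, of G'] by simp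
  qed
  \<comment> \<open>At this point the ends are those of \<open>G\<close>, but the orders at
    \<open>u\<close> and \<open>w\<close> are still the opposite ones; two more shuffles restore
    them.\<close>
  let ?T1 = "shuffle ?H u" let ?T = "shuffle ?T1 w"
  have degH: "degree ?H = degree G" "verts ?H = verts G" "edges ?H = edges G"
    using inc S.G'_simps(1,2) S by (auto simp: degree_def)
  have mT1: "modular_graph ?T1" using modular_shuffle[OF S.modular_G', of u] uw degH by simp
  have 3: "OMG_mor (?H, l) (?T, l) (functor_id (FG G))"
  proof -
    have "OMG_mor (?H, l) (?T1, l) (functor_id (FG ?H))" by (rule OMG_mor.shuffle) (use uw degH in simp_all)
    moreover have "OMG_mor (?T1, l) (?T, l) (functor_id (FG ?T1))" by (rule OMG_mor.shuffle) (use uw degH in simp_all)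
    ultimately show ?thesis
      using OMG_mor_compose_id_right[of ?H l ?T1 l "functor_id (FG G)" ?T l] functor_id_iso[OF fund.gpd_axioms, of G] FH by simp
  qed
  have rot_H: "rot ?H u f = b" "rot ?H u b = a" "rot ?H u a = f" "rot ?H w e = c" "rot ?H w c = d" "rot ?H w d = e"
    "t \<noteq> u \<Longrightarrow> t \<noteq> w \<Longrightarrow> rot ?H t = rot G t" for t
    unfolding S.G'_simps(4) uw_S abcd using ef star_u(2-4) star_w(2-4) star_disjoint by simp_all
  have v3H: "vert3 ?H x = vert3 G x" if "x \<in> edges G" for x
    using that S.vert3_G'[of x] vert3_G' star_disjoint star_vert3 by (auto simp: abcd uw_S S)
  have 4: "OMG_mor (?T, l) (G, l) (functor_id (FG G))"
  proof -
    have T_rot: "rot ?T t x = rot G t x" if "t \<in> verts G" "x \<in> incident G t" for t x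
    proof -
      have 1: "rot ?T1 u x = rot ?H u (rot ?H u x)" if "x \<in> edges G" "vert3 G x = u" for x
        using shuffle_rot[OF S.modular_G', of x] that degH v3H by (simp del: shuffle_simps(9) S.G'_simps(4))
      have 2: "rot ?T w x = rot ?T1 w (rot ?T1 w x)" if "x \<in> edges G" "vert3 G x = w" for x
        using shuffle_rot[OF mT1, of x] that degH v3H by (simp del: shuffle_simps(9) S.G'_simps(4))
      have 3: "rot ?T u x = rot ?T1 u x" "rot ?T1 w x = rot ?H w x" "t \<noteq> u \<Longrightarrow> t \<noteq> w \<Longrightarrow> rot ?T t = rot ?H t" for x t
        using ef(4) by (simp_all del: S.G'_simps(4))
      consider "t = u" | "t = w" | "t \<noteq> u" "t \<noteq> w" by blast
      then show ?thesis
      proof cases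
        case 1
        then have "x \<in> {f, a, b}" using that star_u(1) by simp
        then show ?thesis 
          using 1 3(1) \<open>\<And>x. \<lbrakk>x \<in> edges G; vert3 G x = u\<rbrakk> \<Longrightarrow> rot ?T1 u x = rot ?H u (rot ?H u x)\<close> 
            star_vert3 ef(3) star_edges f rot_H star_u(5-7) by (auto simp del: shuffle_simps(9) S.G'_simps(4))
      next
        case 2
        then have "x \<in> {e, d, c}" using that star_w(1) by simp
        then show ?thesis 
          using 2 3(2) \<open>\<And>x. \<lbrakk>x \<in> edges G; vert3 G x = w\<rbrakk> \<Longrightarrow> rot ?T w x = rot ?T1 w (rot ?T1 w x)\<close> 
            star_vert3 ef(1,2) star_edges f rot_H star_w(5-7) by (auto simp del: shuffle_simps(9) S.G'_simps(4))
      next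
        case 3
        then show ?thesis using \<open>\<And>t. \<lbrakk>t \<noteq> u; t \<noteq> w\<rbrakk> \<Longrightarrow> rot ?T t = rot ?H t\<close> rot_H(7)
          by (simp del: shuffle_simps(9) S.G'_simps(4))
      qed
    qed
    have ends_T: "ends ?T x = ends G x" if "x \<in> edges G" for x
    proof -
      have "x \<in> incident ?H t \<longleftrightarrow> x \<in> incident G t" for t by (simp add: inc)
      then show ?thesis using that degH by (auto simp: incident_def simp del: S.G'_simps(3))
    qed
    have i: "incident ?T t = incident G t" for t using inc by simp
    have "OMG_mor (?T, l) (G, l) (functor_id (FG ?T))"
    proof (rule OMG_mor_cong)
      fix t x assume "t \<in> verts ?T" "x \<in> incident ?T t"
      then show "rot G t x = rot ?T t x" using T_rot[of t x] i degH by (simp del: shuffle_simps(9) S.G'_simps(4))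
    qed (use degH ends_T in simp_all)
    then show ?thesis using FH by simp
  qed
  have "OMG_mor (G', l) (?H, l) (slide_functor G' G f e d a u w v)"
    by (rule OMG_mor_compose_id_left[OF 2 1 iso])
  then have "OMG_mor (G', l) (?T, l) (slide_functor G' G f e d a u w v)"
    by (rule OMG_mor_compose_id_right) (use iso 3 FH in simp_all)
  then show ?thesis
    by (rule OMG_mor_compose_id_right) (use iso 4 FH in simp_all)
qed


section \<open>Labels, relabelings and invertibility of all morphisms\<close>

lemma label_twin_iff:
  assumes "modular_graph G" "labeling G l" "x \<in> edges G"
  shows "fst (l (twin G x)) = fst (l x)" "snd (l (twin G x)) = (\<not> snd (l x))"
proof -
  obtain k where k: "{l x, l (twin G x)} = {(k, True), (k, False)}"
    using assms by (auto simp: labeling_def)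
  then show "fst (l (twin G x)) = fst (l x)" "snd (l (twin G x)) = (\<not> snd (l x))"
    by (auto simp: doubleton_eq_iff)
qed

lemma label_perm_inverse:
  assumes "label_perm G \<sigma>"
  shows "label_perm G (inv_into (label_indices G \<times> UNIV) \<sigma>)"
proof -
  let ?L = "label_indices G \<times> (UNIV :: bool set)" and ?\<tau> = "inv_into (label_indices G \<times> UNIV) \<sigma>"
  have b: "bij_betw \<sigma> ?L ?L" using assms by (simp add: label_perm_def)
  have "\<exists>k. ?\<tau> ` {(m, True), (m, False)} = {(k, True), (k, False)}" if m: "m \<in> label_indices G" for m
  proof -
    obtain k c where kc: "?\<tau> (m, True) = (k, c)" "k \<in> label_indices G" 
      using bij_betwE[OF bij_betw_inv_into[OF b]] m by (metis mem_Sigma_iff surj_pair UNIV_I)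
    obtain j where j: "\<sigma> ` {(k, True), (k, False)} = {(j, True), (j, False)}"
      using assms kc by (auto simp: label_perm_def)
    have "\<sigma> (k, c) = (m, True)" using bij_betw_inv_into_right[OF b] kc m by (metis mem_Sigma_iff UNIV_I)
    then have "(m, True) \<in> {(j, True), (j, False)}" using j by (cases c) (auto simp: set_eq_iff)
    then have "j = m" by auto
    then have "?\<tau> ` {(m, True), (m, False)} = ?\<tau> ` \<sigma> ` {(k, True), (k, False)}" using j by simp
    also have "\<dots> = {(k, True), (k, False)}"
      using kc b by (intro inv_into_image_cancel) (auto simp: bij_betw_def)
    finally show ?thesis by blast
  qed
  then show ?thesis using bij_betw_inv_into[OF b] by (simp add: label_perm_def)
qed

lemma labeling_relabel:
  assumes "labeling G l" "label_perm G \<sigma>"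
  shows "labeling G (\<sigma> \<circ> l)"
proof -
  have "bij_betw (\<sigma> \<circ> l) (edges G) (label_indices G \<times> UNIV)"
    using assms by (auto simp: labeling_def label_perm_def intro: bij_betw_trans)
  moreover have "\<exists>k. {\<sigma> (l x), \<sigma> (l (twin G x))} = {(k, True), (k, False)}" if x: "x \<in> edges G" for x
  proof -
    obtain k where k: "{l x, l (twin G x)} = {(k, True), (k, False)}" using assms x by (auto simp: labeling_def)
    have "l x \<in> label_indices G \<times> UNIV" using assms(1) x by (auto simp: labeling_def bij_betw_def)
    then have "k \<in> label_indices G" using k by (auto simp: doubleton_eq_iff)
    then have "\<exists>j. \<sigma> ` {l x, l (twin G x)} = {(j, True), (j, False)}" using assms(2) k by (simp add: label_perm_def)
    then show ?thesis by simp
  qed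
  ultimately show ?thesis by (simp add: labeling_def)
qed

text \<open>Each rule is inverted by morphisms of the same kind. Modularity, the labeling and
  finiteness are carried through the same induction, because a composite needs them at its middle
  graph before its second factor can be inverted.\<close>

lemma OMG_mor_iso_inverse:
  assumes "OMG_mor X Y F" "modular_graph (fst X)" "labeling (fst X) (snd X)" "finite (edges (fst X))"
  shows "modular_graph (fst Y) \<and> labeling (fst Y) (snd Y) \<and> finite (edges (fst Y))
    \<and> F \<in> gpd_iso (FG (fst X)) (FG (fst Y))
    \<and> (\<exists>K \<in> gpd_iso (FG (fst Y)) (FG (fst X)). OMG_mor Y X K 
        \<and> functor_comp (FG (fst X)) K F = functor_id (FG (fst X)))"
  using assms
proof (induction rule: OMG_mor.induct)
  case (flip f G F l)
  show ?case
  proof (cases "trivial_flip G f")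
    case True
    then have "F = functor_id (FG G)" "flip G f = G" using flip by (simp_all add: flip_induces_def flip_def)
    moreover have "OMG_mor (G, l) (G, l) (functor_id (FG G))" by (rule OMG_mor_cong) auto
    ultimately show ?thesis using flip functor_id_iso[OF fund.gpd_axioms, of G] 
        functor_comp_id_left[OF functor_id_iso[OF fund.gpd_axioms, of G]] by auto
  next
    case False
    then interpret nontrivial_flip G f using flip by unfold_locales auto
    have F: "F = slide_functor G G' f e a d u w v" using flip_induces_iff flip by simp
    have "labeling G' l" 
      using flip by (auto simp: labeling_def label_indices_def simp del: G'_simps(3,4))
    moreover have "finite (edges G')" using flip by simp
    ultimately show ?thesis
      using modular_G' F slide_functor_iso[OF slide] slide_functor_iso(1)[OF slide_sym[OF slide]] 
        OMG_flip_inverse[of l] by (auto simp: G'_def[symmetric] simp del: G'_simps)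
  qed
next
  case (shuffle v G l)
  then have G: "modular_graph G" by simp
  have l: "labeling (shuffle G v) l" "finite (edges (shuffle G v))" 
    using shuffle by (auto simp: labeling_def label_indices_def)
  show ?case
    using modular_shuffle[OF G shuffle(1,2)] OMG_shuffle_inverse[OF G shuffle(1,2), of l] l
      functor_id_iso[OF fund.gpd_axioms, of G] functor_comp_id_left[OF functor_id_iso[OF fund.gpd_axioms, of G]]
    by auto
next
  case (relabel G \<sigma> l)
  let ?\<tau> = "inv_into (label_indices G \<times> UNIV) \<sigma>"
  have "OMG_mor (G, \<sigma> \<circ> l) (G, ?\<tau> \<circ> (\<sigma> \<circ> l)) (functor_id (FG G))"
    by (rule OMG_mor.relabel[OF label_perm_inverse[OF relabel(1)]])
  moreover have "OMG_mor (G, ?\<tau> \<circ> (\<sigma> \<circ> l)) (G, l) (functor_id (FG G))"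
  proof (rule OMG_mor_cong)
    fix x assume "x \<in> edges G"
    then have "l x \<in> label_indices G \<times> UNIV" using relabel by (auto simp: labeling_def bij_betw_def)
    then show "l x = (?\<tau> \<circ> (\<sigma> \<circ> l)) x" 
      using relabel(1) bij_betw_inv_into_left[of \<sigma> "label_indices G \<times> UNIV" "label_indices G \<times> UNIV" "l x"]
      by (simp add: label_perm_def)
  qed simp_all
  ultimately have "OMG_mor (G, \<sigma> \<circ> l) (G, l) (functor_id (FG G))"
    using OMG_mor_compose_id_right functor_id_iso[OF fund.gpd_axioms] by blast
  then show ?case
    using relabel labeling_relabel[of G l \<sigma>] functor_id_iso[OF fund.gpd_axioms, of G] 
      functor_comp_id_left[OF functor_id_iso[OF fund.gpd_axioms, of G]] unfolding fst_conv snd_conv by blast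
next
  case (identify G l G' l' \<phi> \<psi>)
  then interpret I: graph_iso G G' l l' \<phi> \<psi> by unfold_locales auto
  interpret J: graph_iso G' G l' l "inv_into (verts G) \<phi>" "inv_into (edges G) \<psi>"
    by (rule I.inverse[OF I.modular_image])
  have fin: "finite (edges G')" using identify I.bij(2) bij_betw_finite by auto
  have card: "card (edges G) = card (edges G')" using I.bij(2) by (rule bij_betw_same_card)
  have inv: "bij_betw (inv_into (edges G) \<psi>) (edges G') (edges G)" using I.bij(2) by (rule bij_betw_inv_into)
  have ind: "label_indices G' = label_indices G" using fin card identify by (simp add: label_indices_def)
  have "bij_betw (l \<circ> inv_into (edges G) \<psi>) (edges G') (label_indices G' \<times> UNIV)"
    using inv identify ind by (auto simp: labeling_def intro: bij_betw_trans)
  then have "bij_betw l' (edges G') (label_indices G' \<times> UNIV)"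
    using bij_betw_cong[of "edges G'" l' "l \<circ> inv_into (edges G) \<psi>"] J.label by simp
  moreover have "\<exists>k. {l' y, l' (twin G' y)} = {(k, True), (k, False)}" if y: "y \<in> edges G'" for y
  proof -
    obtain x where x: "x \<in> edges G" "y = \<psi> x" using I.edges_surj[OF y] by blast
    then show ?thesis using identify I.twin_map[OF x(1)] I.label twin_edge[OF I.G x(1)] by (simp add: labeling_def)
  qed
  ultimately have lab: "labeling G' l'" by (simp add: labeling_def)
  show ?case 
    using I.modular_image lab fin I.iso_functor_iso J.iso_functor_iso I.iso_functor_comp OMG_mor.identify[OF J.iso] by auto
next
  case (compose G l G' l' F G'' l'' F')
  from compose obtain K where 1: "modular_graph G'" "labeling G' l'" "finite (edges G')" "F \<in> gpd_iso (FG G) (FG G')"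
    "K \<in> gpd_iso (FG G') (FG G)" "OMG_mor (G', l') (G, l) K" "functor_comp (FG G) K F = functor_id (FG G)" by auto
  with compose obtain K' where 2: "modular_graph G''" "labeling G'' l''" "finite (edges G'')" "F' \<in> gpd_iso (FG G') (FG G'')"
    "K' \<in> gpd_iso (FG G'') (FG G')" "OMG_mor (G'', l'') (G', l') K'" "functor_comp (FG G') K' F' = functor_id (FG G')" by auto
  have "functor_comp (FG G) (functor_comp (FG G'') K K') (functor_comp (FG G) F' F)
    = functor_comp (FG G) K (functor_comp (FG G) K' (functor_comp (FG G) F' F))"
    by (rule functor_comp_assoc) (rule functor_comp_iso[OF fund.gpd_axioms fund.gpd_axioms 1(4) 2(4)])
  also have "functor_comp (FG G) K' (functor_comp (FG G) F' F) = functor_comp (FG G) (functor_comp (FG G') K' F') F"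
    by (rule functor_comp_assoc[OF 1(4), symmetric])
  also have "\<dots> = F" using 2(7) functor_comp_id_left[OF 1(4)] by simp
  finally have "functor_comp (FG G) (functor_comp (FG G'') K K') (functor_comp (FG G) F' F) = functor_id (FG G)"
    using 1(7) by simp
  then show ?case
    using 1 2 functor_comp_iso[OF fund.gpd_axioms fund.gpd_axioms 1(4) 2(4)] 
      functor_comp_iso[OF fund.gpd_axioms fund.gpd_axioms 2(5) 1(5)] OMG_mor.compose[OF 2(6) 1(6)] by auto
qed

lemma OMG_mor_iso:
  assumes "OMG_mor (G, l) (G', l') F" "modular_graph G" "labeling G l" "finite (edges G)"
  shows "modular_graph G'" "labeling G' l'" "finite (edges G')" "F \<in> gpd_iso (FG G) (FG G')"
  using OMG_mor_iso_inverse[OF assms(1)] assms(2-4) by auto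

lemma OMG_subgroup:
  assumes "modular_graph G" "labeling G l" "finite (edges G)"
  shows "subgroup {F. OMG_mor (G, l) (G, l) F} (gpd_Aut (FG G))"
proof -
  interpret A: group "gpd_Aut (FG G)" by (rule group_gpd_Aut[OF fund.gpd_axioms])
  have iso: "F \<in> gpd_iso (FG G) (FG G)" if "OMG_mor (G, l) (G, l) F" for F 
    using OMG_mor_iso[OF that assms] by simp
  have id: "OMG_mor (G, l) (G, l) (functor_id (FG G))" by (rule OMG_mor_cong) auto
  show ?thesis
  proof (rule A.subgroupI)
    fix F assume "F \<in> {F. OMG_mor (G, l) (G, l) F}"
    then have F: "OMG_mor (G, l) (G, l) F" by simp
    then obtain K where K: "K \<in> gpd_iso (FG G) (FG G)" "OMG_mor (G, l) (G, l) K" "functor_comp (FG G) K F = functor_id (FG G)"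
      using OMG_mor_iso_inverse[OF F] assms by auto
    then show "inv\<^bsub>gpd_Aut (FG G)\<^esub> F \<in> {F. OMG_mor (G, l) (G, l) F}"
      using inv_gpd_Aut[OF fund.gpd_axioms iso[OF F] K(1,3)] by simp
  next
    show "{F. OMG_mor (G, l) (G, l) F} \<noteq> {}" using id by blast
  qed (use iso OMG_mor.compose in \<open>auto simp: gpd_Aut_def\<close>)
qed

lemma group_OMG:
  assumes "modular_graph G" "labeling G l" "finite (edges G)"
  shows "group (OMG G l)"
  unfolding OMG_def 
  by (rule subgroup.subgroup_is_group[OF OMG_subgroup[OF assms] group_gpd_Aut[OF fund.gpd_axioms]])

lemma hom_restrict: "\<lbrakk>h \<in> hom A B; S \<subseteq> carrier A\<rbrakk> \<Longrightarrow> h \<in> hom (A\<lparr>carrier := S\<rparr>) B"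
  by (auto simp: hom_def subset_iff)

lemma natural_hom_OMG:
  assumes "modular_graph G" "labeling G l" "finite (edges G)" "x \<in> edges G"
  shows "natural_hom (FG G) x \<in> hom (OMG G l) (Out (pi1 G x))"
proof -
  have "natural_hom (FG G) x \<in> hom (gpd_Aut (FG G)) (Out (pi1 G x))"
    unfolding pi1_def using assms fund_connected[OF assms(1)]
    by (intro natural_hom_hom[OF fund.gpd_axioms]) auto
  moreover have "{F. OMG_mor (G, l) (G, l) F} \<subseteq> carrier (gpd_Aut (FG G))"
    using OMG_subgroup[OF assms(1-3)] subgroup.subset by blast
  ultimately show ?thesis unfolding OMG_def by (rule hom_restrict)
qed


section \<open>Free groups\<close>

lemma inverse_letter_simps [simp]: "inverse_letter (inverse_letter s) = s" "inverse_letter s \<noteq> s" 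
  "s \<noteq> inverse_letter s" "inverse_letter s = inverse_letter t \<longleftrightarrow> s = t"
  by (cases s; cases t; auto)+

lemma inverse_letter_eq_iff: "inverse_letter s = t \<longleftrightarrow> s = inverse_letter t"
  by (cases s; cases t; auto)

lemma reduced_Nil [simp]: "reduced []"
  by (simp add: reduced_def)

lemma reduced_Cons: "reduced (s # w) \<longleftrightarrow> (w \<noteq> [] \<longrightarrow> hd w \<noteq> inverse_letter s) \<and> reduced w"
  by (cases w) (auto simp: reduced_def)

lemma push_letter_Cons: "w = [] \<or> hd w \<noteq> inverse_letter s \<Longrightarrow> push_letter s w = s # w"
  by (cases w) auto

lemma reduced_push [simp]: "reduced w \<Longrightarrow> reduced (push_letter s w)"
  by (cases w) (auto simp: reduced_Cons)

lemma push_inverse [simp]: "reduced w \<Longrightarrow> push_letter (inverse_letter s) (push_letter s w) = w"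
  by (cases w) (auto simp: reduced_Cons push_letter_Cons split: if_splits)

lemma push_inverse' [simp]: "reduced w \<Longrightarrow> push_letter s (push_letter (inverse_letter s) w) = w"
  using push_inverse[of w "inverse_letter s"] by simp

lemma reduced_foldr [simp]: "reduced w \<Longrightarrow> reduced (foldr push_letter v w)"
  by (induction v) auto

lemma foldr_push:
  assumes "reduced v" "reduced w" 
  shows "foldr push_letter (push_letter s v) w = push_letter s (foldr push_letter v w)"
  using assms by (cases v) auto

lemma foldr_assoc:
  assumes "reduced v" "reduced w" "reduced u" 
  shows "foldr push_letter (foldr push_letter v w) u = foldr push_letter v (foldr push_letter w u)"
  using assms by (induction v) (auto simp: foldr_push reduced_Cons)

lemma foldr_append: "reduced (v @ w) \<Longrightarrow> foldr push_letter v w = v @ w"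
proof (induction v)
  case (Cons s v)
  then have "reduced (v @ w)" "v @ w \<noteq> [] \<longrightarrow> hd (v @ w) \<noteq> inverse_letter s" by (auto simp: reduced_Cons)
  then show ?case using Cons.IH push_letter_Cons[of "v @ w" s] by auto
qed simp

lemma foldr_Nil: "reduced v \<Longrightarrow> foldr push_letter v [] = v"
  using foldr_append[of v "[]"] by simp

definition inverse_word :: "('a \<times> bool) list \<Rightarrow> ('a \<times> bool) list" where
  "inverse_word w = rev (map inverse_letter w)"

lemma reduced_inverse_word [simp]: "reduced w \<Longrightarrow> reduced (inverse_word w)"
  unfolding reduced_def inverse_word_def successively_rev successively_map
  by (erule successively_mono) (auto simp: inverse_letter_eq_iff)

lemma hd_inverse_word: "w \<noteq> [] \<Longrightarrow> hd (inverse_word w) = inverse_letter (last w)"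
  by (simp add: inverse_word_def hd_rev last_map)

lemma set_inverse_word: "set w \<subseteq> S \<times> UNIV \<Longrightarrow> set (inverse_word w) \<subseteq> S \<times> UNIV"
  by (auto simp: inverse_word_def)

lemma foldr_inverse_word: "reduced w \<Longrightarrow> foldr push_letter (inverse_word w) w = []"
proof (induction w)
  case (Cons s w)
  then have "foldr push_letter (inverse_word (s # w)) (s # w) 
    = foldr push_letter (inverse_word w) (push_letter (inverse_letter s) (s # w))"
    by (simp add: inverse_word_def)
  then show ?case using Cons by (simp add: reduced_Cons)
qed (simp add: inverse_word_def)

text \<open>Free groups as types, in additive notation, so that the class \<open>group_add\<close> applies.\<close>

typedef 'a fgp = "{w :: ('a \<times> bool) list. reduced w}" morphisms word of_word
  by (rule exI[of _ "[]"]) simp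

lemma reduced_word [simp]: "reduced (word a)"
  using word by blast

lemma word_of_word [simp]: "reduced w \<Longrightarrow> word (of_word w) = w"
  by (simp add: of_word_inverse)

instantiation fgp :: (type) group_add
begin

definition "0 = of_word []"
definition "a + b = of_word (foldr push_letter (word a) (word b))"
definition "- a = of_word (inverse_word (word a))"
definition "a - b = a + (- b)" for a b :: "'a fgp"

lemma word_zero [simp]: "word 0 = []"
  by (simp add: zero_fgp_def)

lemma word_add: "word (a + b) = foldr push_letter (word a) (word b)"
  by (simp add: plus_fgp_def)

lemma word_uminus: "word (- a) = inverse_word (word a)"
  by (simp add: uminus_fgp_def)

instance
  by standard (simp_all add: word_inject[symmetric] word_add word_uminus foldr_assoc foldr_Nil 
      foldr_inverse_word minus_fgp_def)

end

section \<open>Letters, word length and first letters\<close>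

definition lt :: "'a \<times> bool \<Rightarrow> 'a fgp" where
  "lt s = of_word [s]"

lemma word_lt [simp]: "word (lt s) = [s]"
  by (simp add: lt_def reduced_Cons)

lemma word_lt_add: "word (lt s + a) = push_letter s (word a)"
  by (simp add: word_add)

lemma lt_inverse: "lt (inverse_letter s) = - lt s"
  by (simp add: word_inject[symmetric] word_uminus inverse_word_def)

lemma lt_eq_iff [simp]: "lt s = lt t \<longleftrightarrow> s = t"
  by (metis list.inject word_lt)

lemma lt_neq_0 [simp]: "lt s \<noteq> 0"
  by (simp add: word_inject[symmetric])

lemma word_eq_Nil [simp]: "word a = [] \<longleftrightarrow> a = 0"
  by (simp add: word_inject[symmetric])

lemma word_add_append: "reduced (word a @ word b) \<Longrightarrow> word (a + b) = word a @ word b"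
  by (simp add: word_add foldr_append)

definition len :: "'a fgp \<Rightarrow> nat" where
  "len a = length (word a)"

lemma len_uminus [simp]: "len (- a) = len a"
  by (simp add: len_def word_uminus inverse_word_def)

lemma len_zero_iff [simp]: "len a = 0 \<longleftrightarrow> a = 0"
  by (simp add: len_def)

lemma len_lt_add_le: "len (lt s + a) \<le> len a + 1"
  by (cases "word a") (auto simp: len_def word_lt_add)

lemma len_minus_lt_add_le: "len (- lt s + a) \<le> len a + 1"
  using len_lt_add_le[of "inverse_letter s" a] by (simp add: lt_inverse)

lemma len_add_lt_le: "len (a + lt s) \<le> len a + 1"
  using len_minus_lt_add_le[of s "- a"] by (metis len_uminus minus_add minus_minus)

definition starts :: "'a \<times> bool \<Rightarrow> 'a fgp \<Rightarrow> bool" where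
  "starts s a \<longleftrightarrow> word a \<noteq> [] \<and> hd (word a) = s"

lemma starts_ex: "a \<noteq> 0 \<Longrightarrow> \<exists>s. starts s a"
  by (simp add: starts_def)

lemma starts_word: "starts s a \<Longrightarrow> \<exists>w. word a = s # w"
  by (cases "word a") (auto simp: starts_def)

lemma word_starts: "starts s a \<Longrightarrow> word (- lt s + a) = tl (word a)"
  using starts_word[of s a] reduced_word[of a]
  by (auto simp: lt_inverse[symmetric] word_lt_add simp del: reduced_word)

lemma len_starts: "starts s a \<Longrightarrow> len (- lt s + a) + 1 = len a"
  using starts_word[of s a] by (auto simp: len_def word_starts)

lemma len_ends: "starts s (- a) \<Longrightarrow> len (a + lt s) + 1 = len a"
proof -
  assume "starts s (- a)"
  then have "len (- lt s + - a) + 1 = len (- a)" by (rule len_starts)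
  moreover have "- lt s + - a = - (a + lt s)" by (simp add: minus_add)
  ultimately show ?thesis by (simp only: len_uminus)
qed

text \<open>The word begins with \<open>s\<close> and ends with its inverse. Both cancellations take
  place independently, so the length drops by exactly 2; this is the case of an edge path shortened
  at both of its ends.\<close>

lemma starts_both:
  assumes "starts s a" "starts s (- a)" 
  shows "len (- lt s + a + lt s) + 2 = len a"
proof -
  obtain w where w: "word a = s # w" using starts_word[OF assms(1)] by blast
  have last: "last (word a) = inverse_letter s"
    using assms(2) w hd_inverse_word[of "word a"] unfolding starts_def word_uminus
    by (metis inverse_letter_simps(1) list.distinct(1))
  \<comment> \<open>Otherwise first and last letter would coincide, and \<open>s\<close> would be
    its own inverse; this excludes overlapping cancellations.\<close>
  have "w \<noteq> []" using last w by auto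
  then have w': "last w = inverse_letter s" using last w by simp
  have 1: "word (- lt s + a) = w" using word_starts[OF assms(1)] w by simp
  have "starts s (- (- lt s + a))"
    unfolding starts_def word_uminus 1 using \<open>w \<noteq> []\<close> w' hd_inverse_word[of w]
    by (simp add: inverse_word_def)
  from len_ends[OF this] show ?thesis using len_starts[OF assms(1)] by simp
qed

lemma push_set: "set (push_letter s w) \<subseteq> insert s (set w)"
  by (cases w) auto

lemma foldr_set: "set (foldr push_letter v w) \<subseteq> set v \<union> set w"
  by (induction v) (use push_set in fastforce)+

lemma free_group_simps:
  "carrier (free_group S) = {w. set w \<subseteq> S \<times> UNIV \<and> reduced w}" "\<one>\<^bsub>free_group S\<^esub> = []"
  "v \<otimes>\<^bsub>free_group S\<^esub> w = foldr push_letter v w"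
  by (simp_all add: free_group_def)

lemma group_free_group: "group (free_group S)"
proof (rule groupI)
  fix v w assume "v \<in> carrier (free_group S)" "w \<in> carrier (free_group S)"
  then show "v \<otimes>\<^bsub>free_group S\<^esub> w \<in> carrier (free_group S)"
    using foldr_set[of v w] by (auto simp: free_group_simps)
next
  fix w assume "w \<in> carrier (free_group S)"
  then show "\<exists>v\<in>carrier (free_group S). v \<otimes>\<^bsub>free_group S\<^esub> w = \<one>\<^bsub>free_group S\<^esub>"
    by (intro bexI[of _ "inverse_word w"]) 
      (auto simp: free_group_simps foldr_inverse_word set_inverse_word)
qed (auto simp: free_group_simps foldr_assoc)

lemma word_sum_list: "reduced w \<Longrightarrow> word (sum_list (map lt w)) = w"
  by (induction w) (auto simp: reduced_Cons word_lt_add push_letter_Cons)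


section \<open>Normal forms of paths\<close>

text \<open>An edge path between vertices of degree 3, recorded by the edges along which it leaves
  these vertices. Each entry \<open>f\<close> stands for crossing the whole twin pair, from the
  degree-3 vertex of \<open>f\<close> to that of its twin.\<close>

fun chain :: "('v, 'e) ribbon_graph \<Rightarrow> 'v \<Rightarrow> 'e list \<Rightarrow> 'v \<Rightarrow> bool" where
  "chain G p [] q \<longleftrightarrow> p = q"
| "chain G p (f # fs) q \<longleftrightarrow> f \<in> edges G \<and> vert3 G f = p \<and> chain G (vert3 G (twin G f)) fs q"

definition no_backtrack :: "('v, 'e) ribbon_graph \<Rightarrow> 'e list \<Rightarrow> bool" where
  "no_backtrack G fs \<longleftrightarrow> successively (\<lambda>f g. g \<noteq> twin G f) fs"

lemma chain_append: "chain G p (fs @ gs) q \<longleftrightarrow> (\<exists>t. chain G p fs t \<and> chain G t gs q)"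
  by (induction fs arbitrary: p) auto

lemma chain_edges: "chain G p fs q \<Longrightarrow> set fs \<subseteq> edges G"
  by (induction fs arbitrary: p) auto

lemma chain_end: "chain G p fs q \<Longrightarrow> q = (if fs = [] then p else vert3 G (twin G (last fs)))"
  by (induction fs arbitrary: p) auto

lemma no_backtrack_Cons: "no_backtrack G (f # fs) \<longleftrightarrow> (fs \<noteq> [] \<longrightarrow> hd fs \<noteq> twin G f) \<and> no_backtrack G fs"
  by (cases fs) (auto simp: no_backtrack_def)

text \<open>Realizes a chain as a morphism between edge midpoints, with a turn inside a degree-3
  star before each crossing and one at the end.\<close>

fun chain_class :: "('v, 'e) ribbon_graph \<Rightarrow> 'e \<Rightarrow> 'e list \<Rightarrow> 'e \<Rightarrow> ('v, 'e) path set" where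
  "chain_class G x [] y = gen G x (vert3 G x) y"
| "chain_class G x (f # fs) y = gpd_comp (FG G) (gen G x (vert3 G x) f) 
    (gpd_comp (FG G) (gen G f (vert2 G f) (twin G f)) (chain_class G (twin G f) fs y))"

locale labeled =
  fixes G :: "('v, 'e) ribbon_graph" and l :: "'e \<Rightarrow> label"
  assumes G: "modular_graph G" and l: "labeling G l"
begin

lemma l_inj: "inj_on l (edges G)"
  using l by (auto simp: labeling_def bij_betw_def)

lemma l_eq_iff: "\<lbrakk>x \<in> edges G; y \<in> edges G\<rbrakk> \<Longrightarrow> l x = l y \<longleftrightarrow> x = y"
  using l_inj by (auto simp: inj_on_def)

lemma l_twin [simp]: "x \<in> edges G \<Longrightarrow> l (twin G x) = inverse_letter (l x)"
  using label_twin_iff[OF G l, of x] by (cases "l x"; cases "l (twin G x)") auto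

lemma reduced_map_l: "set fs \<subseteq> edges G \<Longrightarrow> reduced (map l fs) \<longleftrightarrow> no_backtrack G fs"
proof (induction fs)
  case (Cons f fs)
  have "l (hd fs) = inverse_letter (l f) \<longleftrightarrow> hd fs = twin G f" if "fs \<noteq> []"
    using Cons.prems that l_eq_iff[of "hd fs" "twin G f"] G hd_in_set[OF that] by (auto simp: subset_iff)
  then show ?case using Cons by (auto simp: reduced_Cons no_backtrack_Cons hd_map)
qed (simp add: no_backtrack_def)

text \<open>Edge paths without backtracking are reduced words in the labels, since twins carry
  inverse letters. Thus \<open>PW p q\<close> is a copy, inside one free group, of the homotopy
  classes of paths from \<open>p\<close> to \<open>q\<close>, and path composition is
  addition.\<close>

definition PW :: "'v \<Rightarrow> 'v \<Rightarrow> nat fgp set" where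
  "PW p q = {a. \<exists>fs. chain G p fs q \<and> word a = map l fs}"

lemma PW_zero [simp]: "0 \<in> PW p q \<longleftrightarrow> p = q"
  by (auto simp: PW_def)

lemma PW_lt [simp]: "f \<in> edges G \<Longrightarrow> lt (l f) \<in> PW (vert3 G f) (vert3 G (twin G f))"
  unfolding PW_def by (rule CollectI, rule exI[of _ "[f]"]) auto

text \<open>Free cancellation of adjacent letters is removal of a backtracking step, and this leaves
  a path with the same ends.\<close>

lemma chain_foldr:
  assumes "chain G p fs t" "chain G t gs q" 
  shows "\<exists>hs. chain G p hs q \<and> foldr push_letter (map l fs) (map l gs) = map l hs"
  using assms
proof (induction fs arbitrary: p)
  case (Cons f fs)
  then obtain hs where hs: "chain G (vert3 G (twin G f)) hs q" 
    "foldr push_letter (map l fs) (map l gs) = map l hs" by auto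
  have f: "f \<in> edges G" "vert3 G f = p" using Cons.prems by auto
  show ?case
  proof (cases "hs \<noteq> [] \<and> hd hs = twin G f")
    case True
    then obtain hs' where hs': "hs = twin G f # hs'" by (cases hs) auto
    then show ?thesis using hs f G by (intro exI[of _ hs']) auto
  next
    case False
    have "set hs \<subseteq> edges G" using chain_edges[OF hs(1)] .
    then have "map l hs = [] \<or> hd (map l hs) \<noteq> inverse_letter (l f)"
      using False f l_eq_iff[of "hd hs" "twin G f"] G by (cases hs) auto
    then have "push_letter (l f) (map l hs) = map l (f # hs)" by (simp add: push_letter_Cons)
    then show ?thesis using hs f by (intro exI[of _ "f # hs"]) auto
  qed
qed auto

lemma PW_add: "\<lbrakk>a \<in> PW p t; b \<in> PW t q\<rbrakk> \<Longrightarrow> a + b \<in> PW p q"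
proof -
  assume "a \<in> PW p t" "b \<in> PW t q"
  then obtain fs gs where "chain G p fs t" "word a = map l fs" "chain G t gs q" "word b = map l gs"
    by (auto simp: PW_def)
  then show ?thesis using chain_foldr[of p fs t gs q] by (auto simp: PW_def word_add)
qed

lemma chain_rev: "chain G p fs q \<Longrightarrow> chain G q (rev (map (twin G) fs)) p"
proof (induction fs arbitrary: p)
  case (Cons f fs)
  then show ?case using G by (auto simp: chain_append)
qed auto

lemma PW_uminus: "a \<in> PW p q \<Longrightarrow> - a \<in> PW q p"
proof -
  assume "a \<in> PW p q"
  then obtain fs where fs: "chain G p fs q" "word a = map l fs" by (auto simp: PW_def)
  have "inverse_word (map l fs) = map l (rev (map (twin G) fs))"
    using chain_edges[OF fs(1)] by (auto simp: inverse_word_def rev_map)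
  then have "chain G q (rev (map (twin G) fs)) p \<and> word (- a) = map l (rev (map (twin G) fs))"
    using chain_rev[OF fs(1)] fs(2) by (simp add: word_uminus)
  then show ?thesis unfolding PW_def by blast
qed

lemma PW_uminus_iff [simp]: "- a \<in> PW q p \<longleftrightarrow> a \<in> PW p q"
  using PW_uminus[of a p q] PW_uminus[of "- a" q p] by auto

text \<open>This is where the valence of \<open>G\<close> enters: the first letter of a nontrivial
  path is one of the three labels at its starting vertex.\<close>

lemma PW_start:
  assumes "a \<in> PW p q" "starts s a" 
  shows "\<exists>f\<in>edges G. s = l f \<and> vert3 G f = p"
proof -
  obtain fs where "chain G p fs q" "word a = map l fs" using assms by (auto simp: PW_def)
  then show ?thesis using assms(2) by (cases fs) (auto simp: starts_def)
qed

text \<open>Contracts all degree-3 stars to one point and reads off the labels of the crossed twin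
  pairs. It forgets the end points, but is faithful on each hom set.\<close>

definition \<iota> :: "('v, 'e) path set \<Rightarrow> nat fgp" where
  "\<iota> = val G (\<lambda>x. lt (l x))"

lemma \<iota>_odd: "twin_odd G (\<lambda>x. lt (l x))"
  by (simp add: twin_odd_def lt_inverse)

lemmas \<iota>_comp = val_comp[OF G \<iota>_odd, folded \<iota>_def]
lemmas \<iota>_ident = val_ident[OF G \<iota>_odd, folded \<iota>_def]
lemmas \<iota>_inv = val_inv[OF G \<iota>_odd, folded \<iota>_def]
lemma incident_vert3_iff: "x \<in> edges G \<Longrightarrow> y \<in> incident G (vert3 G x) \<longleftrightarrow> y \<in> edges G \<and> vert3 G y = vert3 G x"
  using incident_vert3[OF G] by auto

lemma gen_vert3_hom: 
  "\<lbrakk>x \<in> edges G; y \<in> edges G; vert3 G y = vert3 G x\<rbrakk> \<Longrightarrow> gen G x (vert3 G x) y \<in> gpd_hom (FG G) x y"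
  using G by (simp add: gpd_hom_def incident_vert3_iff)

lemma gen_twin_hom: "x \<in> edges G \<Longrightarrow> gen G x (vert2 G x) (twin G x) \<in> gpd_hom (FG G) x (twin G x)"
  using G by (simp add: gpd_hom_def incident_vert2)

lemma comp_hom: "\<lbrakk>a \<in> gpd_hom (FG G) x y; b \<in> gpd_hom (FG G) y z\<rbrakk> \<Longrightarrow> gpd_comp (FG G) a b \<in> gpd_hom (FG G) x z"
  by (simp add: gpd_hom_def)

lemma chain_class_hom:
  "\<lbrakk>x \<in> edges G; y \<in> edges G; chain G (vert3 G x) fs (vert3 G y)\<rbrakk> \<Longrightarrow> chain_class G x fs y \<in> gpd_hom (FG G) x y"
proof (induction fs arbitrary: x)
  case Nil
  show ?case unfolding chain_class.simps by (rule gen_vert3_hom) (use Nil in simp_all)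
next
  case (Cons f fs)
  then have "chain_class G (twin G f) fs y \<in> gpd_hom (FG G) (twin G f) y" using G by simp
  then show ?case
    unfolding chain_class.simps using Cons.prems gen_vert3_hom[of x f] gen_twin_hom[of f] comp_hom by fastforce
qed

lemma val_chain_class:
  assumes m: "twin_odd G m"
  shows "\<lbrakk>x \<in> edges G; y \<in> edges G; chain G (vert3 G x) fs (vert3 G y)\<rbrakk> 
    \<Longrightarrow> val G m (chain_class G x fs y) = sum_list (map m fs)"
proof (induction fs arbitrary: x)
  case Nil
  show ?case using val_gen_vert3[OF G m, of x y] Nil unfolding chain_class.simps by simp
next
  case (Cons f fs)
  then have h: "chain_class G (twin G f) fs y \<in> gpd_hom (FG G) (twin G f) y" 
    "gen G x (vert3 G x) f \<in> gpd_hom (FG G) x f" "gen G f (vert2 G f) (twin G f) \<in> gpd_hom (FG G) f (twin G f)"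
    using G chain_class_hom[of "twin G f"] gen_vert3_hom[of x f] gen_twin_hom[of f] by auto
  have "val G m (chain_class G (twin G f) fs y) = sum_list (map m fs)"
    using Cons G by simp
  then show ?case
    using h Cons.prems val_gen_vert3[OF G m, of x f] val_gen_twin[OF G m, of f]
    by (simp add: gpd_hom_def val_comp[OF G m])
qed

lemma \<iota>_chain_class:
  assumes "x \<in> edges G" "y \<in> edges G" "chain G (vert3 G x) fs (vert3 G y)" "no_backtrack G fs"
  shows "word (\<iota> (chain_class G x fs y)) = map l fs"
proof -
  have "\<iota> (chain_class G x fs y) = sum_list (map lt (map l fs))"
    unfolding \<iota>_def using val_chain_class[OF \<iota>_odd assms(1-3)] by (simp add: comp_def)
  moreover have "reduced (map l fs)" using reduced_map_l[OF chain_edges[OF assms(3)]] assms(4) by simp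
  ultimately show ?thesis using word_sum_list by metis
qed

lemma chain_class_start:
  assumes "x \<in> edges G" "z \<in> edges G" "y \<in> edges G" "vert3 G z = vert3 G x" "chain G (vert3 G z) fs (vert3 G y)"
  shows "gpd_comp (FG G) (gen G x (vert3 G x) z) (chain_class G z fs y) = chain_class G x fs y"
proof (cases fs)
  case Nil
  have i: "x \<in> incident G (vert3 G x)" "z \<in> incident G (vert3 G x)" "y \<in> incident G (vert3 G x)"
    using assms Nil by (simp_all add: incident_vert3_iff)
  show ?thesis unfolding Nil chain_class.simps using gen_comp[OF i] assms(4) by simp
next
  case (Cons f gs)
  have f: "f \<in> edges G" "vert3 G f = vert3 G x" "chain G (vert3 G (twin G f)) gs (vert3 G y)" 
    using assms Cons by auto
  have i: "x \<in> incident G (vert3 G x)" "z \<in> incident G (vert3 G x)" "f \<in> incident G (vert3 G x)"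
    using assms f by (simp_all add: incident_vert3_iff)
  have h: "gpd_comp (FG G) (gen G f (vert2 G f) (twin G f)) (chain_class G (twin G f) gs y) \<in> gpd_hom (FG G) f y"
    using gen_twin_hom[OF f(1)] chain_class_hom[of "twin G f" y gs] f assms(3) G by (intro comp_hom) auto
  then show ?thesis unfolding Cons chain_class.simps assms(4) gen_comp[OF i, symmetric]
    using i by (subst fund.comp_assoc) (auto simp: gpd_hom_def)
qed

text \<open>Prepend one generator at a time. A turn at a degree-3 vertex is absorbed into the first
  turn of the chain; a crossing at a degree-2 vertex either becomes a new first entry or cancels the
  old one when that is its twin.\<close>

lemma normal_form:
  assumes "a \<in> gpd_mor (FG G)"
  shows "\<exists>fs. chain G (vert3 G (gpd_src (FG G) a)) fs (vert3 G (gpd_tgt (FG G) a)) \<and> no_backtrack G fs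
    \<and> a = chain_class G (gpd_src (FG G) a) fs (gpd_tgt (FG G) a)"
  using assms
proof (induction rule: fund_induct)
  case (ident x)
  then show ?case using G by (intro exI[of _ "[]"]) (simp add: gen_self no_backtrack_def)
next
  case (comp x v z a)
  let ?y = "gpd_tgt (FG G) a"
  have e: "x \<in> edges G" "z \<in> edges G" "?y \<in> edges G" 
    using comp incident_edges[of x G v] incident_edges[of z G v] fund.tgt_obj[of a G] by auto
  obtain fs where fs: "chain G (vert3 G z) fs (vert3 G ?y)" "no_backtrack G fs" "a = chain_class G z fs ?y"
    using comp by auto
  have "\<exists>gs. chain G (vert3 G x) gs (vert3 G ?y) \<and> no_backtrack G gs
    \<and> gpd_comp (FG G) (gen G x v z) a = chain_class G x gs ?y"
  proof (cases "v = vert3 G x")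
    case True
    then have "vert3 G z = vert3 G x" using comp(2) e(1) incident_vert3_iff by auto
    note zx = this
    then have "gpd_comp (FG G) (gen G x v z) (chain_class G z fs ?y) = chain_class G x fs ?y"
      using True fs(1) chain_class_start[OF e] by simp
    then have "gpd_comp (FG G) (gen G x v z) a = chain_class G x fs ?y" by (simp only: fs(3)[symmetric])
    then show ?thesis using fs(1,2) zx by (intro exI[of _ fs]) simp
  next
    case False
    then have v: "v = vert2 G x" using comp(1) by (simp add: incident_iff[OF G])
    then have "z = x \<or> z = twin G x" using comp(2) incident_vert2[OF G e(1)] by auto
    then show ?thesis
    proof
      assume z: "z = x"
      then have "gpd_comp (FG G) (gen G x v z) a = a" using comp by (simp add: gen_self)
      then show ?thesis using z fs by (intro exI[of _ fs]) simp
    next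
      assume z: "z = twin G x"
      show ?thesis
      proof (cases "fs \<noteq> [] \<and> hd fs = twin G x")
        case True
        then obtain gs where gs: "fs = twin G x # gs" by (cases fs) auto
        have c: "chain G (vert3 G x) gs (vert3 G ?y)" "no_backtrack G gs" 
          using fs gs e G by (auto simp: no_backtrack_Cons)
        have h: "chain_class G x gs ?y \<in> gpd_hom (FG G) x ?y" by (rule chain_class_hom[OF e(1,3) c(1)])
        have t: "gen G (twin G x) (vert3 G (twin G x)) (twin G x) = gpd_ident (FG G) (twin G x)"
           "gen G x v z \<in> gpd_hom (FG G) x z" "gpd_inv (FG G) (gen G x v z) = gen G z v x"
          using G e comp by (simp_all add: gen_self gpd_hom_def gen_inv)
        have "chain_class G z fs ?y = gpd_comp (FG G) (gen G z v x) (chain_class G x gs ?y)"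
          using h t(1) v e G comp(1,2) by (simp add: gs z gpd_hom_def)
        then have "a = gpd_comp (FG G) (gen G z v x) (chain_class G x gs ?y)" by (simp only: fs(3)[symmetric])
        then have "gpd_comp (FG G) (gen G x v z) a 
          = gpd_comp (FG G) (gen G x v z) (gpd_comp (FG G) (gpd_inv (FG G) (gen G x v z)) (chain_class G x gs ?y))"
          using t(3) by simp
        also have "\<dots> = chain_class G x gs ?y"
          using t(2) h by (intro fund.inv_comp_cancel) (simp_all add: gpd_hom_def)
        finally have "gpd_comp (FG G) (gen G x v z) a = chain_class G x gs ?y" .
        then show ?thesis using c by blast
      next
        case False
        have "gen G x (vert3 G x) x = gpd_ident (FG G) x" using G e by (simp add: gen_self)
        moreover have "gpd_comp (FG G) (gen G x v z) a \<in> gpd_mor (FG G)" 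
          "gpd_src (FG G) (gpd_comp (FG G) (gen G x v z) a) = x" using comp by simp_all
        ultimately have "chain_class G x (x # fs) ?y = gpd_comp (FG G) (gen G x v z) a"
          unfolding chain_class.simps v[symmetric] z[symmetric] fs(3)[symmetric] by simp
        moreover have "chain G (vert3 G x) (x # fs) (vert3 G ?y)" using fs(1) z e by simp
        moreover have "no_backtrack G (x # fs)" using False fs(2) by (auto simp: no_backtrack_Cons)
        ultimately show ?thesis by metis
      qed
    qed
  qed
  then show ?case using comp by simp
qed

lemma normal_form_hom:
  assumes "a \<in> gpd_hom (FG G) x y" 
  obtains fs where "chain G (vert3 G x) fs (vert3 G y)" "no_backtrack G fs" 
    "a = chain_class G x fs y" "word (\<iota> a) = map l fs"
proof -
  have xy: "x \<in> edges G" "y \<in> edges G" using assms fund.src_obj[of a G] fund.tgt_obj[of a G] by (auto simp: gpd_hom_def)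
  obtain fs where fs: "chain G (vert3 G x) fs (vert3 G y)" "no_backtrack G fs" "a = chain_class G x fs y"
    using normal_form[of a] assms by (auto simp: gpd_hom_def)
  then show ?thesis using that[OF fs] \<iota>_chain_class[OF xy fs(1,2)] by simp
qed

text \<open>The word spells the chain of the normal form, because the labels are injective, and the
  chain together with the end points determines the morphism.\<close>

lemma \<iota>_inj:
  assumes "a \<in> gpd_hom (FG G) x y" "b \<in> gpd_hom (FG G) x y" "\<iota> a = \<iota> b" 
  shows "a = b"
proof -
  obtain fs where fs: "chain G (vert3 G x) fs (vert3 G y)" "a = chain_class G x fs y" "word (\<iota> a) = map l fs"
    using normal_form_hom[OF assms(1)] by metis
  obtain gs where gs: "chain G (vert3 G x) gs (vert3 G y)" "b = chain_class G x gs y" "word (\<iota> b) = map l gs"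
    using normal_form_hom[OF assms(2)] by metis
  have "map l fs = map l gs" using fs gs assms by simp
  then have "fs = gs" using l_inj chain_edges[OF fs(1)] chain_edges[OF gs(1)] 
    by (metis inj_on_map_eq_map inj_on_subset sup.bounded_iff)
  then show ?thesis using fs gs by simp
qed

lemma \<iota>_PW: "a \<in> gpd_hom (FG G) x y \<Longrightarrow> \<iota> a \<in> PW (vert3 G x) (vert3 G y)"
  by (erule normal_form_hom) (auto simp: PW_def)

lemma \<iota>_surj:
  assumes "x \<in> edges G" "y \<in> edges G" "c \<in> PW (vert3 G x) (vert3 G y)" 
  shows "\<exists>a\<in>gpd_hom (FG G) x y. \<iota> a = c"
proof -
  obtain fs where fs: "chain G (vert3 G x) fs (vert3 G y)" "word c = map l fs"
    using assms by (auto simp: PW_def)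
  have "no_backtrack G fs" using reduced_map_l[OF chain_edges[OF fs(1)]] fs(2) reduced_word[of c] by simp
  then have "word (\<iota> (chain_class G x fs y)) = word c" using \<iota>_chain_class[OF assms(1,2) fs(1)] fs(2) by simp
  then show ?thesis using chain_class_hom[OF assms(1,2) fs(1)] by (auto simp: word_inject)
qed

lemma \<iota>_bij:
  assumes "x \<in> edges G" "y \<in> edges G" 
  shows "bij_betw \<iota> (gpd_hom (FG G) x y) (PW (vert3 G x) (vert3 G y))"
proof (rule bij_betw_imageI)
  show "inj_on \<iota> (gpd_hom (FG G) x y)" using \<iota>_inj by (intro inj_onI)
  show "\<iota> ` gpd_hom (FG G) x y = PW (vert3 G x) (vert3 G y)" 
    using \<iota>_PW \<iota>_surj[OF assms] by (intro equalityI subsetI) (auto simp: image_iff, metis)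
qed

end


section \<open>Folding\<close>

lemma card_3_pair:
  assumes "card S = 3" "a \<in> S" "b \<in> S" "a \<noteq> b" 
  shows "\<exists>c. S = {a, b, c} \<and> c \<noteq> a \<and> c \<noteq> b"
proof -
  have "finite S" using assms(1) by (metis card.infinite zero_neq_numeral)
  then have "card (S - {a, b}) = 1" using assms by (simp add: card_Diff_subset)
  then obtain c where "S - {a, b} = {c}" by (rule card_1_singletonE)
  then have "S = {a, b, c}" "c \<noteq> a" "c \<noteq> b" using assms by auto
  then show ?thesis by blast
qed

lemma gpd_iso_hom_bij:
  assumes "gpd X" "gpd Y" "F \<in> gpd_iso X Y" "x \<in> gpd_obj X" "y \<in> gpd_obj X"
  shows "bij_betw (snd F) (gpd_hom X x y) (gpd_hom Y (fst F x) (fst F y))"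
proof -
  note f = functorialD[OF gpd_iso_functorial[OF assms(3)]]
  have b: "inj_on (fst F) (gpd_obj X)" "inj_on (snd F) (gpd_mor X)" "snd F ` gpd_mor X = gpd_mor Y"
    using assms(3) by (auto simp: gpd_iso_def bij_betw_def)
  have "snd F ` gpd_hom X x y = gpd_hom Y (fst F x) (fst F y)"
  proof (intro equalityI subsetI)
    fix n assume n: "n \<in> gpd_hom Y (fst F x) (fst F y)"
    then obtain m where m: "m \<in> gpd_mor X" "n = snd F m" using b(3) by (auto simp: gpd_hom_def)
    then have "fst F (gpd_src X m) = fst F x" "fst F (gpd_tgt X m) = fst F y" using f(3,4) n by (auto simp: gpd_hom_def)
    then have "gpd_src X m = x" "gpd_tgt X m = y" 
      using b(1) assms m(1) gpd.src_obj[OF assms(1)] gpd.tgt_obj[OF assms(1)] by (auto dest: inj_onD)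
    then show "n \<in> snd F ` gpd_hom X x y" using m by (auto simp: gpd_hom_def)
  qed (use f in \<open>auto simp: gpd_hom_def\<close>)
  then show ?thesis using b(2) by (auto simp: bij_betw_def inj_on_def gpd_hom_def)
qed

lemma val_cong:
  assumes "vert2 K = vert2 G" shows "val K m = val G m"
proof -
  have "path_val K m (x, p) = path_val G m (x, p)" for x p
    by (induction p arbitrary: x) (auto simp: step_val_def assms)
  then have "path_val K m = path_val G m" by auto
  then show ?thesis by (simp add: val_def[abs_def])
qed

context labeled
begin

text \<open>A map from the modular graph \<open>K\<close> to \<open>G\<close> that is an isomorphism on fundamental groupoids, up to
  the choice of base points: the vertex \<open>v\<close> of degree 3 goes to \<open>\<phi> v\<close>, and the path from \<open>x\<close>
  to its twin goes to the edge path \<open>m x\<close>. Folding makes these edge paths shorter.\<close>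

definition marking :: "('v, 'e) ribbon_graph \<Rightarrow> ('e \<Rightarrow> nat fgp) \<Rightarrow> ('v \<Rightarrow> 'v) \<Rightarrow> bool" where
  "marking K m \<phi> \<longleftrightarrow> modular_graph K \<and> labeling K l \<and> edges K = edges G \<and> twin_odd K m
    \<and> (\<forall>x\<in>edges K. m x \<in> PW (\<phi> (vert3 K x)) (\<phi> (vert3 K (twin K x))))
    \<and> (\<forall>x\<in>edges K. \<forall>y\<in>edges K.
        bij_betw (val K m) (gpd_hom (FG K) x y) (PW (\<phi> (vert3 K x)) (\<phi> (vert3 K y))))"

text \<open>\<open>N\<close> is the given automorphism of \<open>\<pi>\<^sub>1\<close>, with values written as edge paths. The marked graph
  \<open>K\<close> is related to it by a morphism \<open>\<Phi>\<close> of the outer modular groupoid.\<close>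

definition marked :: "(('v, 'e) path set \<Rightarrow> nat fgp) \<Rightarrow> 'e \<Rightarrow> ('v, 'e) ribbon_graph \<Rightarrow> ('e \<Rightarrow> nat fgp) 
    \<Rightarrow> ('v \<Rightarrow> 'v) \<Rightarrow> bool" where
  "marked N x0 K m \<phi> \<longleftrightarrow> marking K m \<phi> \<and> (\<exists>\<Phi> c. OMG_mor (G, l) (K, l) \<Phi> \<and> \<Phi> \<in> gpd_iso (FG G) (FG K)
    \<and> fst \<Phi> x0 = x0 \<and> c \<in> PW (vert3 G x0) (\<phi> (vert3 K x0))
    \<and> (\<forall>\<gamma>\<in>gpd_hom (FG G) x0 x0. val K m (snd \<Phi> \<gamma>) = - c + N \<gamma> + c))"

lemma markingD:
  assumes "marking K m \<phi>"
  shows "modular_graph K" "labeling K l" "edges K = edges G" "twin_odd K m" "labeled K l"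
    and "x \<in> edges K \<Longrightarrow> m x \<in> PW (\<phi> (vert3 K x)) (\<phi> (vert3 K (twin K x)))"
    and "x \<in> edges K \<Longrightarrow> y \<in> edges K \<Longrightarrow>
      bij_betw (val K m) (gpd_hom (FG K) x y) (PW (\<phi> (vert3 K x)) (\<phi> (vert3 K y)))"
    and "x \<in> edges K \<Longrightarrow> m (twin K x) = - m x"
  using assms by (auto simp: marking_def labeled_def twin_odd_def)

lemma marked_shuffle:
  assumes "marked N x0 K m \<phi>" "v \<in> verts K" "degree K v = 3"
  shows "marked N x0 (shuffle K v) m \<phi>"
proof -
  have mk: "marking K m \<phi>" using assms by (simp add: marked_def)
  note M = markingD[OF mk]
  have "val (shuffle K v) m = val K m" by (rule val_cong) simp
  moreover have "labeling (shuffle K v) l" using M(2) by (auto simp: labeling_def label_indices_def)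
  ultimately have mk': "marking (shuffle K v) m \<phi>"
    using mk modular_shuffle[OF M(1) assms(2,3)] by (simp add: marking_def twin_odd_def)
  obtain \<Phi> c where \<Phi>: "OMG_mor (G, l) (K, l) \<Phi>" "\<Phi> \<in> gpd_iso (FG G) (FG K)" "fst \<Phi> x0 = x0" 
    "c \<in> PW (vert3 G x0) (\<phi> (vert3 K x0))" 
    "\<forall>\<gamma>\<in>gpd_hom (FG G) x0 x0. val K m (snd \<Phi> \<gamma>) = - c + N \<gamma> + c"
    using assms(1) by (auto simp: marked_def)
  have "OMG_mor (G, l) (shuffle K v, l) \<Phi>"
    by (rule OMG_mor_compose_id_right[OF \<Phi>(1,2) OMG_mor.shuffle[OF assms(2,3)]])
  then show ?thesis unfolding marked_def
    using \<Phi> mk' \<open>val (shuffle K v) m = val K m\<close> by (intro conjI exI[of _ \<Phi>] exI[of _ c]) simp_all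
qed

text \<open>Both \<open>m f\<close> and the value at its twin are 0, so the detours of
  \<open>a\<close> and \<open>d\<close> contribute nothing: values before the flip equal values of
  the images after it. Also \<open>\<phi>\<close> agrees at the two ends of \<open>f\<close>, so the
  edges that change their vertex keep the image of their start.\<close>

lemma marked_flip:
  assumes x0: "x0 \<in> edges G" and "marked N x0 K m \<phi>" "f \<in> edges K" "m f = 0" "\<not> trivial_flip K f"
  shows "marked N x0 (flip K f) m \<phi>"
proof -
  have mk: "marking K m \<phi>" using assms by (simp add: marked_def)
  note M = markingD[OF mk]
  interpret F: nontrivial_flip K f by unfold_locales (use M assms in auto)
  have F': "flip K f = F.G'" by (simp add: F.G'_def)
  let ?K = "F.G'" and ?S = "slide_functor K F.G' f F.e F.a F.d F.u F.w F.v"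
  have odd: "twin_odd ?K m" using M(4) by (simp add: twin_odd_def)
  note S = slide_functor_iso(1)[OF F.slide]
  note fS = functorialD[OF gpd_iso_functorial[OF S]]
  have me: "m F.e = 0" using M(8)[OF F.f] F.ef assms by simp
  have uw: "\<phi> F.w = \<phi> F.u" using M(6)[OF F.f] F.ef assms(4) by simp
  have val_S: "val ?K m (snd ?S \<gamma>) = val K m \<gamma>" if \<gamma>: "\<gamma> \<in> gpd_mor (FG K)" for \<gamma>
  proof (rule group_functor_eqI[OF _ val_comp[OF M(1,4)] _ \<gamma>, where b = "slide_base ?K f F.e F.u F.w"])
    fix a b assume "a \<in> gpd_mor (FG K)" "b \<in> gpd_mor (FG K)" "gpd_tgt (FG K) a = gpd_src (FG K) b"
    then show "val ?K m (snd ?S (gpd_comp (FG K) a b)) = val ?K m (snd ?S a) + val ?K m (snd ?S b)"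
      using fS val_comp[OF F.modular_G' odd, of "snd ?S a" "snd ?S b"] by simp
  next
    fix t x assume x: "x \<in> incident K t"
    let ?b = "slide_base ?K f F.e F.u F.w t"
    note b = slide_base[OF F.slide x]
    have v: "F.v \<noteq> F.u" "F.v \<noteq> F.w" "F.e \<in> incident K F.v" "f \<in> incident K F.v" using F.v by auto
    have fe: "f \<in> edges K" "F.e \<in> edges K" "vert2 K f = F.v" "vert2 K F.e = F.v" "F.e \<noteq> f" "vert2 K F.a \<noteq> F.w" "vert2 K F.d \<noteq> F.u"
      using F.f F.ef F.v F.v_def F.vert2_ends F.star_edges by auto
    have "val ?K m (slide_mor ?K f F.e F.a F.d F.u F.w F.v t x) = step_val K m x t ?b"
    proof -
      consider "t = F.u" "x = F.a" | "t = F.w" "x = F.d" | "\<not> (t = F.u \<and> x = F.a)" "\<not> (t = F.w \<and> x = F.d)" by blast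
      then show ?thesis
      proof cases
        case 1
        have g: "val ?K m (gen ?K F.a F.w F.e) = 0" "val ?K m (gen ?K F.e F.v f) = 0"
          using F.incident_G' v fe me by (subst val_gen[OF F.modular_G' odd]; simp add: step_val_def F.star_edges)+
        have "vert2 K F.a \<noteq> F.u" using F.vert2_ends F.star_edges by auto
        then have "step_val K m x t ?b = 0" using 1 by (simp add: step_val_def)
        moreover have "val ?K m (gpd_comp (FG ?K) (gen ?K F.a F.w F.e) (gen ?K F.e F.v f)) = 0"
          using g F.incident_G' v by (subst val_comp[OF F.modular_G' odd]) simp_all
        ultimately show ?thesis using 1 by (simp add: slide_mor_def)
      next
        case 2
        have g: "val ?K m (gen ?K F.d F.u f) = 0" "val ?K m (gen ?K f F.v F.e) = 0"
          using F.incident_G' v fe assms(4) by (subst val_gen[OF F.modular_G' odd]; simp add: step_val_def F.star_edges)+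
        have "vert2 K F.d \<noteq> F.w" using F.vert2_ends F.star_edges by auto
        then have "step_val K m x t ?b = 0" using 2 by (simp add: step_val_def)
        moreover have "val ?K m (gpd_comp (FG ?K) (gen ?K F.d F.u f) (gen ?K f F.v F.e)) = 0"
          using g F.incident_G' v by (subst val_comp[OF F.modular_G' odd]) simp_all
        ultimately show ?thesis using 2 F.ef(4) by (simp add: slide_mor_def)
      next
        case 3
        have x': "x \<in> incident ?K t"
          using 3 x F.incident_G' F.star_u(1) F.star_w(1) by (cases "t = F.u"; cases "t = F.w") auto
        have "slide_mor ?K f F.e F.a F.d F.u F.w F.v t x = gen ?K x t ?b"
          unfolding slide_mor_def if_not_P[OF 3(1)] if_not_P[OF 3(2)] ..
        then show ?thesis using x' b incident_edges[OF x]
          by (simp add: val_gen[OF F.modular_G' odd] step_val_def)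
      qed
    qed
    then show "?b \<in> incident K t \<and> val ?K m (snd ?S (gen K x t ?b)) = val K m (gen K x t ?b)"
      using b x by (simp add: slide_functor_base[OF F.slide] val_gen[OF M(1,4)])
  qed
  have \<phi>_eq: "\<phi> (vert3 ?K x) = \<phi> (vert3 K x)" if "x \<in> edges K" for x
    using F.vert3_G'[OF that] uw F.star_vert3 by auto
  have lab: "labeling ?K l" using M(2) by (auto simp: labeling_def label_indices_def simp del: F.G'_simps(3,4))
  have bij: "bij_betw (val ?K m) (gpd_hom (FG ?K) x y) (PW (\<phi> (vert3 ?K x)) (\<phi> (vert3 ?K y)))" 
    if xy: "x \<in> edges K" "y \<in> edges K" for x y
  proof -
    have S_hom: "bij_betw (snd ?S) (gpd_hom (FG K) x y) (gpd_hom (FG ?K) x y)"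
      using gpd_iso_hom_bij[OF fund.gpd_axioms fund.gpd_axioms S, of x y] xy slide_functor_obj[OF F.slide] by simp
    have "bij_betw (val ?K m \<circ> snd ?S) (gpd_hom (FG K) x y) (PW (\<phi> (vert3 K x)) (\<phi> (vert3 K y)))"
      using M(7)[OF xy] val_S by (subst bij_betw_cong[where g = "val K m"]) (auto simp: gpd_hom_def)
    then show ?thesis unfolding \<phi>_eq[OF xy(1)] \<phi>_eq[OF xy(2)] by (rule iffD2[OF bij_betw_comp_iff[OF S_hom]])
  qed
  have mk': "marking ?K m \<phi>"
    unfolding marking_def using F.modular_G' lab odd bij M(3,6) \<phi>_eq twin_edge[OF M(1)] by (simp del: F.G'_simps(3,4))
  obtain \<Phi> c where \<Phi>: "OMG_mor (G, l) (K, l) \<Phi>" "\<Phi> \<in> gpd_iso (FG G) (FG K)" "fst \<Phi> x0 = x0" 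
    "c \<in> PW (vert3 G x0) (\<phi> (vert3 K x0))" 
    "\<forall>\<gamma>\<in>gpd_hom (FG G) x0 x0. val K m (snd \<Phi> \<gamma>) = - c + N \<gamma> + c"
    using assms(2) by (auto simp: marked_def)
  note f\<Phi> = functorialD[OF gpd_iso_functorial[OF \<Phi>(2)]]
  have "flip_induces K f ?S" using F.flip_induces_iff by simp
  then have 1: "OMG_mor (G, l) (?K, l) (functor_comp (FG G) ?S \<Phi>)"
    using OMG_mor.compose[OF \<Phi>(1) OMG_mor.flip[OF F.f]] F' by metis
  have 2: "functor_comp (FG G) ?S \<Phi> \<in> gpd_iso (FG G) (FG ?K)"
    by (rule functor_comp_iso[OF fund.gpd_axioms fund.gpd_axioms \<Phi>(2) S])
  have 3: "fst (functor_comp (FG G) ?S \<Phi>) x0 = x0"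
    using x0 M(3) \<Phi>(3) slide_functor_obj[OF F.slide, of x0] by (simp add: functor_comp_def compose_def)
  have 4: "val ?K m (snd (functor_comp (FG G) ?S \<Phi>) \<gamma>) = - c + N \<gamma> + c" if "\<gamma> \<in> gpd_hom (FG G) x0 x0" for \<gamma>
    using that \<Phi>(5) val_S[of "snd \<Phi> \<gamma>"] f\<Phi>(2)[of \<gamma>] by (simp add: functor_comp_def compose_def gpd_hom_def)
  show ?thesis unfolding F' marked_def 
    using mk' 1 2 3 4 \<Phi>(4) \<phi>_eq[of x0] x0 M(3) by (intro conjI exI[of _ "functor_comp (FG G) ?S \<Phi>"] exI[of _ c]) auto
qed

text \<open>A homotopy that drags the image of the vertex \<open>u\<close> along the path
  \<open>h\<close>. The values change by the coboundary of \<open>k\<close>; as \<open>k x\<close>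
  depends only on the degree-3 vertex of \<open>x\<close>, turns inside degree-3 stars keep the
  value 0. The connecting path \<open>c\<close> is prolonged by \<open>k x0\<close>.\<close>

lemma marked_gauge:
  assumes x0: "x0 \<in> edges G" and "marked N x0 K m \<phi>" "h \<in> PW (\<phi> u) q"
  defines "k \<equiv> \<lambda>x. if vert3 K x = u then h else 0"
  shows "marked N x0 K (\<lambda>x. - k x + m x + k (twin K x)) (\<phi>(u := q))"
proof -
  have mk: "marking K m \<phi>" using assms by (simp add: marked_def)
  note M = markingD[OF mk]
  let ?m = "\<lambda>x. - k x + m x + k (twin K x)" and ?\<phi> = "\<phi>(u := q)"
  have k: "k x \<in> PW (\<phi> (vert3 K x)) (?\<phi> (vert3 K x))" for x
    using assms(3) by (simp add: k_def)
  have odd: "twin_odd K ?m" 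
    using M(1,8) by (auto simp: twin_odd_def minus_add add.assoc simp del: add_uminus_conv_diff)
  have val: "val K ?m \<gamma> = - k (gpd_src (FG K) \<gamma>) + val K m \<gamma> + k (gpd_tgt (FG K) \<gamma>)" if \<gamma>: "\<gamma> \<in> gpd_mor (FG K)" for \<gamma>
  proof (rule group_functor_eqI[OF val_comp[OF M(1) odd] _ _ \<gamma>, where b = "\<lambda>v. SOME x. x \<in> incident K v"])
    fix a b assume "a \<in> gpd_mor (FG K)" "b \<in> gpd_mor (FG K)" "gpd_tgt (FG K) a = gpd_src (FG K) b"
    then show "- k (gpd_src (FG K) (gpd_comp (FG K) a b)) + val K m (gpd_comp (FG K) a b) + k (gpd_tgt (FG K) (gpd_comp (FG K) a b))
      = - k (gpd_src (FG K) a) + val K m a + k (gpd_tgt (FG K) a) + (- k (gpd_src (FG K) b) + val K m b + k (gpd_tgt (FG K) b))"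
      by (simp add: val_comp[OF M(1,4)] add.assoc)
  next
    fix v x assume x: "x \<in> incident K v"
    let ?b = "SOME x. x \<in> incident K v"
    have b: "?b \<in> incident K v" using x by (rule someI)
    have e: "x \<in> edges K" "?b \<in> edges K" using x b incident_edges by fast+
    have "step_val K ?m x v ?b = - k x + step_val K m x v ?b + k ?b"
    proof (cases "v = vert2 K x")
      case True
      then have "?b = x \<or> ?b = twin K x" using b incident_vert2[OF M(1) e(1)] by auto
      then show ?thesis using True e(1) M(1) by (auto simp: step_val_def)
    next
      case False
      then have "v = vert3 K x" using x incident_iff[OF M(1)] by auto
      then have "vert3 K ?b = vert3 K x" using b incident_vert3[OF M(1) e(1)] by auto
      then show ?thesis using False by (simp add: step_val_def k_def)
    qed
    then show "?b \<in> incident K v \<and> val K ?m (gen K x v ?b) 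
      = - k (gpd_src (FG K) (gen K x v ?b)) + val K m (gen K x v ?b) + k (gpd_tgt (FG K) (gen K x v ?b))"
      using x b by (simp add: val_gen[OF M(1,4)] val_gen[OF M(1) odd])
  qed
  have pw: "?m x \<in> PW (?\<phi> (vert3 K x)) (?\<phi> (vert3 K (twin K x)))" if "x \<in> edges K" for x
    using M(6)[OF that] k PW_uminus PW_add by blast
  have bij: "bij_betw (val K ?m) (gpd_hom (FG K) x y) (PW (?\<phi> (vert3 K x)) (?\<phi> (vert3 K y)))"
    if xy: "x \<in> edges K" "y \<in> edges K" for x y
  proof -
    have "bij_betw (\<lambda>w. - k x + w + k y) (PW (\<phi> (vert3 K x)) (\<phi> (vert3 K y))) (PW (?\<phi> (vert3 K x)) (?\<phi> (vert3 K y)))"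
    proof (rule bij_betwI[where g = "\<lambda>w. k x + w + - k y"])
      show "(\<lambda>w. - k x + w + k y) \<in> PW (\<phi> (vert3 K x)) (\<phi> (vert3 K y)) \<rightarrow> PW (?\<phi> (vert3 K x)) (?\<phi> (vert3 K y))"
        using PW_add[OF PW_add[OF PW_uminus[OF k]] k] by (intro funcsetI)
      show "(\<lambda>w. k x + w + - k y) \<in> PW (?\<phi> (vert3 K x)) (?\<phi> (vert3 K y)) \<rightarrow> PW (\<phi> (vert3 K x)) (\<phi> (vert3 K y))"
        using PW_add[OF PW_add[OF k] PW_uminus[OF k]] by (intro funcsetI)
    qed (simp_all add: add.assoc)
    from bij_betw_trans[OF M(7)[OF xy] this] show ?thesis
      by (subst bij_betw_cong) (auto simp: gpd_hom_def val)
  qed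
  have mk': "marking K ?m ?\<phi>"
    unfolding marking_def using M(1-3) odd bij pw by blast
  obtain \<Phi> c where \<Phi>: "OMG_mor (G, l) (K, l) \<Phi>" "\<Phi> \<in> gpd_iso (FG G) (FG K)" "fst \<Phi> x0 = x0" 
    "c \<in> PW (vert3 G x0) (\<phi> (vert3 K x0))" 
    "\<forall>\<gamma>\<in>gpd_hom (FG G) x0 x0. val K m (snd \<Phi> \<gamma>) = - c + N \<gamma> + c"
    using assms(2) by (auto simp: marked_def)
  note f\<Phi> = functorialD[OF gpd_iso_functorial[OF \<Phi>(2)]]
  have "val K ?m (snd \<Phi> \<gamma>) = - (c + k x0) + N \<gamma> + (c + k x0)" if "\<gamma> \<in> gpd_hom (FG G) x0 x0" for \<gamma>
  proof -
    have "val K ?m (snd \<Phi> \<gamma>) = - k x0 + val K m (snd \<Phi> \<gamma>) + k x0"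
      using val[of "snd \<Phi> \<gamma>"] that \<Phi>(3) f\<Phi>(2-4)[of \<gamma>] by (simp add: gpd_hom_def)
    also have "\<dots> = - k x0 + (- c + N \<gamma> + c) + k x0" using \<Phi>(5) that by simp
    finally show ?thesis by (simp only: minus_add add.assoc)
  qed
  moreover have "c + k x0 \<in> PW (vert3 G x0) (?\<phi> (vert3 K x0))" by (rule PW_add[OF \<Phi>(4) k])
  ultimately show ?thesis unfolding marked_def using mk' \<Phi>(1-3) by blast
qed

definition total_len :: "('v, 'e) ribbon_graph \<Rightarrow> ('e \<Rightarrow> nat fgp) \<Rightarrow> nat" where
  "total_len K m = (\<Sum>x\<in>edges K. len (m x))"

text \<open>If the images of two edges at a vertex start with the same letter, moving the image of the vertex
  along this letter shortens these two images by 1 and lengthens the image of the third edge by at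
  most 1.\<close>

lemma fold_at_vertex:
  assumes x0: "x0 \<in> edges G" and "marked N x0 K m \<phi>" and fin: "finite (edges K)"
    and a: "a \<in> edges K" "a' \<in> edges K" "a \<noteq> a'" "vert3 K a' = vert3 K a" 
    and s: "starts s (m a)" "starts s (m a')"
  shows "\<exists>m' \<phi>'. marked N x0 K m' \<phi>' \<and> total_len K m' < total_len K m"
proof -
  have mk: "marking K m \<phi>" using assms by (simp add: marked_def)
  note M = markingD[OF mk]
  let ?u = "vert3 K a"
  \<comment> \<open>The common first letter is an edge \<open>y\<close> of \<open>G\<close> at the
    image of the vertex; the image will be moved across \<open>y\<close> to the degree-3 vertex at
    its other side.\<close>
  obtain y where y: "y \<in> edges G" "s = l y" "vert3 G y = \<phi> ?u"
    using PW_start[OF M(6)[OF a(1)] s(1)] by blast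
  have h: "lt s \<in> PW (\<phi> ?u) (vert3 G (twin G y))" using PW_lt[OF y(1)] y by simp
  define k where "k x = (if vert3 K x = ?u then lt s else 0)" for x
  define m' where "m' x = - k x + m x + k (twin K x)" for x
  have mk': "marked N x0 K m' (\<phi>(?u := vert3 G (twin G y)))"
    using marked_gauge[OF x0 assms(2) h] unfolding m'_def k_def .
  have "card (incident K ?u) = 3" using mg_ends(3)[OF M(1) a(1)] by (simp add: degree_def)
  moreover have "{a, a'} \<subseteq> incident K ?u" using a incident_vert3[OF M(1) a(1)] by auto
  ultimately obtain b where star: "incident K ?u = {a, a', b}" "b \<noteq> a" "b \<noteq> a'"
    using card_3_pair[of "incident K ?u" a a'] a(3) by auto
  have b: "b \<in> edges K" using star(1) incident_edges[of b K] by auto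
  have k_star: "k x = (if x \<in> {a, a', b} then lt s else 0)" if "x \<in> edges K" for x
    using star(1) incident_vert3[OF M(1) a(1)] that by (auto simp: k_def)
  \<comment> \<open>\<open>\<epsilon> x\<close> bounds the change of length caused at the start of
    \<open>x\<close>: a letter is lost at \<open>a\<close> and \<open>a'\<close>, and at most one is
    gained at \<open>b\<close>. The end of \<open>x\<close> is the start of its twin. So the total
    changes by at most twice the sum of \<open>\<epsilon>\<close>, that is by -2.\<close>
  define \<epsilon> :: "'e \<Rightarrow> int" where "\<epsilon> x = (if x = a \<or> x = a' then - 1 else if x = b then 1 else 0)" for x
  have bound: "int (len (m' x)) \<le> int (len (m x)) + \<epsilon> x + \<epsilon> (twin K x)" if x: "x \<in> edges K" for x
  proof -
    let ?t = "twin K x"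
    have t: "?t \<in> edges K" "?t \<noteq> x" using x M(1) by auto
    have st: "starts s (m x)" if "x = a \<or> x = a'" using that s by auto
    have en: "starts s (- m x)" if "?t = a \<or> ?t = a'" using that s M(8)[OF x] by auto
    note k = k_star[OF x] k_star[OF t(1)]
    \<comment> \<open>An edge path may start and end at the moved vertex; then both changes apply to
      the same word. In case 1 both ends lose a letter, for which \<open>starts_both\<close> rules
      out that it is the same letter.\<close>
    consider (1) "x = a \<or> x = a'" "?t = a \<or> ?t = a'" | (2) "x = a \<or> x = a'" "?t = b" 
      | (3) "x = a \<or> x = a'" "?t \<notin> {a, a', b}" | (4) "x = b" "?t = a \<or> ?t = a'" | (5) "x = b" "?t \<notin> {a, a', b}"
      | (6) "x \<notin> {a, a', b}" "?t = a \<or> ?t = a'" | (7) "x \<notin> {a, a', b}" "?t = b" | (8) "x \<notin> {a, a', b}" "?t \<notin> {a, a', b}"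
      using t(2) by (metis insertE emptyE)
    then show ?thesis
    proof cases
      case 1
      then have "m' x = - lt s + m x + lt s" using k by (auto simp: m'_def)
      moreover have "\<epsilon> x = -1" "\<epsilon> ?t = -1" using 1 by (auto simp: \<epsilon>_def)
      ultimately show ?thesis using starts_both[OF st[OF 1(1)] en[OF 1(2)]] by simp
    next
      case 2
      then have "m' x = - lt s + m x + lt s" using k by (auto simp: m'_def)
      moreover have "\<epsilon> x = -1" "\<epsilon> ?t = 1" using 2 star by (auto simp: \<epsilon>_def)
      ultimately show ?thesis using len_starts[OF st[OF 2(1)]] len_add_lt_le[of "- lt s + m x" s] by simp
    next
      case 3
      then have "m' x = - lt s + m x" using k by (auto simp: m'_def)
      moreover have "\<epsilon> x = -1" "\<epsilon> ?t = 0" using 3 star by (auto simp: \<epsilon>_def)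
      ultimately show ?thesis using len_starts[OF st[OF 3(1)]] by simp
    next
      case 4
      then have "m' x = - lt s + (m x + lt s)" using k by (auto simp: m'_def add.assoc)
      moreover have "\<epsilon> x = 1" "\<epsilon> ?t = -1" using 4 star by (auto simp: \<epsilon>_def)
      ultimately show ?thesis using len_ends[OF en[OF 4(2)]] len_minus_lt_add_le[of s "m x + lt s"] by simp
    next
      case 5
      then have "m' x = - lt s + m x" using k by (auto simp: m'_def)
      moreover have "\<epsilon> x = 1" "\<epsilon> ?t = 0" using 5 star by (auto simp: \<epsilon>_def)
      ultimately show ?thesis using len_minus_lt_add_le[of s "m x"] by simp
    next
      case 6
      then have "m' x = m x + lt s" using k by (auto simp: m'_def)
      moreover have "\<epsilon> x = 0" "\<epsilon> ?t = -1" using 6 star by (auto simp: \<epsilon>_def)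
      ultimately show ?thesis using len_ends[OF en[OF 6(2)]] by simp
    next
      case 7
      then have "m' x = m x + lt s" using k by (auto simp: m'_def)
      moreover have "\<epsilon> x = 0" "\<epsilon> ?t = 1" using 7 star by (auto simp: \<epsilon>_def)
      ultimately show ?thesis using len_add_lt_le[of "m x" s] by simp
    next
      case 8
      then have "m' x = m x" using k by (auto simp: m'_def)
      moreover have "\<epsilon> x = 0" "\<epsilon> ?t = 0" using 8 by (auto simp: \<epsilon>_def)
      ultimately show ?thesis by simp
    qed
  qed
  have sum1: "(\<Sum>x\<in>edges K. \<epsilon> x) = -1"
  proof -
    have "(\<Sum>x\<in>edges K. \<epsilon> x) = (\<Sum>x\<in>{a, a', b}. \<epsilon> x)"
      by (rule sum.mono_neutral_right) (use fin a b in \<open>auto simp: \<epsilon>_def\<close>)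
    also have "\<dots> = -1" using star a(3) by (auto simp: \<epsilon>_def)
    finally show ?thesis .
  qed
  have "bij_betw (twin K) (edges K) (edges K)"
    by (rule bij_betwI[where g = "twin K"]) (use M(1) in auto)
  then have sum2: "(\<Sum>x\<in>edges K. \<epsilon> (twin K x)) = -1" using sum.reindex_bij_betw[of "twin K" "edges K" "edges K" \<epsilon>] sum1 by simp
  have "int (total_len K m') \<le> (\<Sum>x\<in>edges K. int (len (m x)) + \<epsilon> x + \<epsilon> (twin K x))"
    unfolding total_len_def of_nat_sum by (rule sum_mono) (rule bound)
  also have "\<dots> = int (total_len K m) - 2"
    using sum1 sum2 by (simp add: sum.distrib total_len_def)
  finally have "total_len K m' < total_len K m" by linarith
  then show ?thesis using mk' by blast
qed

end


text \<open>The edges of the list are mapped to points. The path does not traverse \<open>a\<close> and \<open>a'\<close>: they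
  are directions other than its own at its first and its last vertex.\<close>

fun zero_path :: "('v, 'e) ribbon_graph \<Rightarrow> ('e \<Rightarrow> nat fgp) \<Rightarrow> 'e \<Rightarrow> 'e list \<Rightarrow> 'e \<Rightarrow> bool" where
  "zero_path K m a [] a' \<longleftrightarrow> a \<in> edges K \<and> a' \<in> edges K \<and> a \<noteq> a' \<and> vert3 K a' = vert3 K a"
| "zero_path K m a (f # fs) a' \<longleftrightarrow> a \<in> edges K \<and> f \<in> edges K \<and> m f = 0 \<and> f \<noteq> a \<and> vert3 K f = vert3 K a
    \<and> zero_path K m (twin K f) fs a'"

lemma zero_path_chain:
  "zero_path K m a fs a' \<Longrightarrow> chain K (vert3 K a) fs (vert3 K a') \<and> no_backtrack K fs \<and> (\<forall>f\<in>set fs. m f = 0)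
    \<and> (fs \<noteq> [] \<longrightarrow> hd fs \<noteq> a)"
proof (induction fs arbitrary: a)
  case (Cons f fs)
  then show ?case by (auto simp: no_backtrack_Cons)
qed (simp add: no_backtrack_def)

lemma zero_path_of_chain:
  assumes "modular_graph K"
  shows "\<lbrakk>a \<in> edges K; a' \<in> edges K; chain K (vert3 K a) fs (vert3 K a'); no_backtrack K fs; \<forall>f\<in>set fs. m f = 0;
    fs \<noteq> []; hd fs \<noteq> a; a' \<noteq> twin K (last fs)\<rbrakk> \<Longrightarrow> zero_path K m a fs a'"
proof (induction fs arbitrary: a)
  case (Cons f fs)
  show ?case
  proof (cases "fs = []")
    case True
    then show ?thesis using Cons.prems assms by auto
  next
    case False
    have "zero_path K m (twin K f) fs a'"
      by (rule Cons.IH) (use Cons.prems False assms in \<open>auto simp: no_backtrack_Cons\<close>)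
    then show ?thesis using Cons.prems by auto
  qed
qed simp

text \<open>Meant for \<open>S\<close> consisting of the two vertices changed by a flip: a zero path
  that stays away from them survives the flip unchanged.\<close>

lemma zero_path_transfer:
  assumes "edges K' = edges K" "\<And>x. x \<in> edges K \<Longrightarrow> twin K' x = twin K x" 
    and "\<And>x. x \<in> edges K \<Longrightarrow> vert3 K x \<notin> S \<Longrightarrow> vert3 K' x = vert3 K x"
  shows "\<lbrakk>zero_path K m a fs a'; vert3 K a \<notin> S; \<forall>g\<in>set fs. vert3 K (twin K g) \<notin> S\<rbrakk> \<Longrightarrow> zero_path K' m a fs a'"
proof (induction fs arbitrary: a)
  case Nil
  then show ?case using assms by simp
next
  case (Cons f fs)
  then have "zero_path K' m (twin K f) fs a'" by simp
  then show ?case using Cons.prems assms by simp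
qed

section \<open>Collapsed edges form a forest; flips along paths of collapsed edges\<close>

context labeled
begin

text \<open>A closed chain of collapsed edges has the same value as an identity, so it is one by
  injectivity of \<open>val\<close> on hom sets. But without backtracking its normal form is a
  nonempty word.\<close>

lemma zero_chain_not_closed:
  assumes mk: "marking K m \<phi>" and "chain K p fs q" "no_backtrack K fs" "\<forall>f\<in>set fs. m f = 0" "fs \<noteq> []"
  shows "p \<noteq> q"
proof
  assume "p = q"
  note M = markingD[OF mk]
  interpret K: labeled K l by (rule M)
  obtain x where x: "x \<in> edges K" "vert3 K x = p" using assms by (cases fs) auto
  have c: "chain K (vert3 K x) fs (vert3 K x)" using assms x \<open>p = q\<close> by simp
  have "val K m (chain_class K x fs x) = sum_list (map m fs)"
    by (rule K.val_chain_class[OF M(4) x(1) x(1) c])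
  also have "\<dots> = 0" using assms(4) by (induction fs) auto
  also have "\<dots> = val K m (gpd_ident (FG K) x)" using x val_ident[OF M(1,4)] by simp
  finally have "chain_class K x fs x = gpd_ident (FG K) x"
    using M(7)[OF x(1) x(1)] K.chain_class_hom[OF x(1) x(1) c] x(1)
    by (auto simp: bij_betw_def gpd_hom_def dest!: inj_onD)
  then have "map l fs = word (K.\<iota> (gpd_ident (FG K) x))" 
    using K.\<iota>_chain_class[OF x(1) x(1) c assms(3)] by simp
  then show False using assms(5) K.\<iota>_ident[OF x(1)] by simp
qed

text \<open>Apply \<open>zero_chain_not_closed\<close> to the initial segment that ends with
  \<open>g\<close>.\<close>

lemma zero_chain_avoid:
  assumes mk: "marking K m \<phi>" and "chain K p fs q" "no_backtrack K fs" "\<forall>f\<in>set fs. m f = 0" "g \<in> set fs"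
  shows "vert3 K (twin K g) \<noteq> p"
proof -
  obtain xs ys where fs: "fs = (xs @ [g]) @ ys" using assms(5) by (metis append_Cons append_assoc in_set_conv_decomp self_append_conv2)
  then obtain t where t: "chain K p (xs @ [g]) t" using assms(2) chain_append by metis
  then have "t = vert3 K (twin K g)" using chain_end by fastforce
  moreover have "p \<noteq> t"
    by (rule zero_chain_not_closed[OF mk t]) (use assms fs in \<open>auto simp: no_backtrack_def successively_append_iff\<close>)
  ultimately show ?thesis by simp
qed

text \<open>A flip at \<open>f\<close> moves the edge following \<open>f\<close>. A degree-3 star
  has only two cyclic orders, so at most one shuffle makes either of the other edges the one that
  moves.\<close>

lemma marked_rot:
  assumes "marked N x0 K m \<phi>" "f \<in> edges K" "c \<in> edges K" "c \<noteq> f" "vert3 K c = vert3 K f" 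
  shows "\<exists>K'. marked N x0 K' m \<phi> \<and> edges K' = edges K \<and> twin K' = twin K \<and> vert3 K' = vert3 K 
    \<and> rot K' (vert3 K f) f = c \<and> (\<forall>v. v \<noteq> vert3 K f \<longrightarrow> rot K' v = rot K v)"
proof (cases "rot K (vert3 K f) f = c")
  case True
  then show ?thesis using assms by blast
next
  case False
  have mk: "marking K m \<phi>" using assms by (simp add: marked_def)
  note M = markingD[OF mk]
  let ?u = "vert3 K f"
  have "c \<in> incident K ?u" using incident_vert3[OF M(1) assms(2)] assms by simp
  then have "rot K ?u (rot K ?u f) = c" using star3(1)[OF M(1) assms(2)] assms False by auto
  then have "rot (shuffle K ?u) ?u f = c" using shuffle_rot[OF M(1) assms(2)] by simp
  moreover have "marked N x0 (shuffle K ?u) m \<phi>"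
    by (rule marked_shuffle[OF assms(1)]) (use assms M(1) mg_ends(3)[OF M(1) assms(2)] in auto)
  ultimately show ?thesis by (intro exI[of _ "shuffle K ?u"]) (auto simp del: shuffle_simps(9) simp: shuffle_simps(9)[of K ?u])
qed

text \<open>A flip at the first edge of the path moves \<open>a\<close> past this edge and does not change any image. So
  \<open>a\<close> can be brought to the same vertex as \<open>a'\<close>.\<close>

lemma fold_along_zero_path:
  assumes x0: "x0 \<in> edges G" and fin: "finite (edges G)"
  shows "\<lbrakk>marked N x0 K m \<phi>; zero_path K m a fs a'; starts s (m a); starts s (m a')\<rbrakk>
    \<Longrightarrow> \<exists>K' m' \<phi>'. marked N x0 K' m' \<phi>' \<and> total_len K' m' < total_len K m"
proof (induction fs arbitrary: K a)
  case Nil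
  have mk: "marking K m \<phi>" using Nil by (simp add: marked_def)
  note M = markingD[OF mk]
  have "finite (edges K)" using M(3) fin by simp
  then show ?case using fold_at_vertex[OF x0 Nil(1), of a a' s] Nil by auto
next
  case (Cons f fs)
  have mk: "marking K m \<phi>" using Cons.prems by (simp add: marked_def)
  note M = markingD[OF mk]
  note zp = zero_path_chain[OF Cons.prems(2)]
  let ?u = "vert3 K a" and ?e = "twin K f" let ?w = "vert3 K ?e"
  have f: "f \<in> edges K" "m f = 0" "f \<noteq> a" "vert3 K f = ?u" "zero_path K m ?e fs a'" "a \<in> edges K"
    using Cons.prems by auto
  have e: "?e \<in> edges K" using f M(1) by simp
  have uw: "?u \<noteq> ?w"
    by (rule zero_chain_not_closed[OF mk, where fs = "[f]"]) (use f in \<open>auto simp: no_backtrack_def\<close>)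
  \<comment> \<open>The direction in which the path continues at the far end of \<open>f\<close>:
    its next edge, or \<open>a'\<close> if \<open>f\<close> is the last edge. It must stay at that
    vertex, so the third edge \<open>d\<close> is the one exchanged with \<open>a\<close>.\<close>
  define c where "c = (case fs of [] \<Rightarrow> a' | c # _ \<Rightarrow> c)"
  have c: "c \<in> edges K" "c \<noteq> ?e" "vert3 K c = ?w" 
    using f(5) by (auto simp: c_def split: list.splits)
  obtain d where d: "incident K ?w = {?e, c, d}" "d \<noteq> ?e" "d \<noteq> c"
    using card_3_pair[of "incident K ?w" ?e c] mg_ends(3)[OF M(1) e] c e incident_vert3[OF M(1) e] 
    by (auto simp: degree_def)
  have dK: "d \<in> edges K" "vert3 K d = ?w" using d(1) incident_vert3[OF M(1) e] by auto
  obtain K1 where K1: "marked N x0 K1 m \<phi>" "edges K1 = edges K" "twin K1 = twin K" "vert3 K1 = vert3 K" 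
    "rot K1 ?u f = a"
    using marked_rot[OF Cons.prems(1) f(1,6) f(3)[symmetric]] f(4) by auto
  obtain K2 where K2: "marked N x0 K2 m \<phi>" "edges K2 = edges K" "twin K2 = twin K" "vert3 K2 = vert3 K" 
    "rot K2 ?u f = a" "rot K2 ?w ?e = d"
    using marked_rot[OF K1(1), of ?e d] K1 e dK d(2) uw by auto
  have mk2: "marking K2 m \<phi>" using K2 by (simp add: marked_def)
  note M2 = markingD[OF mk2]
  have nt: "\<not> trivial_flip K2 f" using K2 f uw by (simp add: trivial_flip_def)
  interpret F: nontrivial_flip K2 f by unfold_locales (use M2 f K2 nt in auto)
  have F: "F.u = ?u" "F.e = ?e" "F.w = ?w" "F.a = a" "F.d = d" 
    using K2 f by (simp_all add: F.u_def F.e_def F.w_def F.a_def F.d_def)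
  have 1: "marked N x0 F.G' m \<phi>" 
    using marked_flip[OF x0 K2(1), of f] f K2 nt by (simp add: F.G'_def)
  have v3: "vert3 F.G' x = (if x = a then ?w else if x = d then ?u else vert3 K x)" if "x \<in> edges K" for x
    using F.vert3_G'[of x] that F K2 by simp
  have "c \<noteq> a" "c \<noteq> d" using c uw d by auto
  have 2: "zero_path F.G' m a fs a'"
  proof (cases fs)
    case Nil
    then have "a' = c" by (simp add: c_def)
    then show ?thesis using Nil f c \<open>c \<noteq> a\<close> \<open>c \<noteq> d\<close> v3[of a] v3[of c] K2 by simp
  next
    case (Cons g gs)
    then have "g = c" by (simp add: c_def)
    have z: "zero_path K m (twin K c) gs a'" "m c = 0" using f(5) Cons \<open>g = c\<close> by auto
    have ch: "chain K ?u (f # c # gs) (vert3 K a')" "no_backtrack K (f # c # gs)" "\<forall>h\<in>set (f # c # gs). m h = 0"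
      using zp Cons \<open>g = c\<close> by auto
    then have ch': "chain K ?w (c # gs) (vert3 K a')" "no_backtrack K (c # gs)" by (auto simp: no_backtrack_Cons)
    \<comment> \<open>As collapsed edges form a forest, the rest of the path never returns to the
      two vertices of the flip and is not affected by it.\<close>
    have avoid: "vert3 K (twin K h) \<notin> {?u, ?w}" if "h \<in> set (c # gs)" for h
      using zero_chain_avoid[OF mk ch, of h] zero_chain_avoid[OF mk ch', of h] ch(3) that by auto
    have "zero_path F.G' m (twin K c) gs a'"
      by (rule zero_path_transfer[where S = "{?u, ?w}" and K = K]) 
        (use z avoid K2 v3 f(6) dK in \<open>auto split: if_splits\<close>)
    then show ?thesis using Cons \<open>g = c\<close> z c f \<open>c \<noteq> a\<close> \<open>c \<noteq> d\<close> v3[of a] v3[of c] K2 by simp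
  qed
  have "total_len F.G' m = total_len K m" using K2 by (simp add: total_len_def)
  then show ?case using Cons.IH[OF 1 2 Cons.prems(3,4)] by simp
qed

end

section \<open>Folded maps are isomorphisms\<close>

lemma reduced_append:
  "reduced (u @ v) \<longleftrightarrow> reduced u \<and> reduced v \<and> (u \<noteq> [] \<longrightarrow> v \<noteq> [] \<longrightarrow> hd v \<noteq> inverse_letter (last u))"
  by (auto simp: reduced_def successively_append_iff)

text \<open>The last assumption is what minimality of the total length yields through
  \<open>fold_along_zero_path\<close>. The empty zero path covers the case of two different edges at
  one vertex.\<close>

locale folded = labeled G l for G :: "('v, 'e) ribbon_graph" and l +
  fixes K :: "('v, 'e) ribbon_graph" and m :: "'e \<Rightarrow> nat fgp" and \<phi> :: "'v \<Rightarrow> 'v"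
  assumes fin: "finite (edges G)" and marking: "marking K m \<phi>"
    and folded: "\<And>a fs a' s. zero_path K m a fs a' \<Longrightarrow> starts s (m a) \<Longrightarrow> \<not> starts s (m a')"
begin

lemmas M = markingD[OF marking]

sublocale K: labeled K l by (rule M)

lemma finK: "finite (edges K)"
  using fin M(3) by simp

lemma star_K: "x \<in> edges K \<Longrightarrow> card (incident K (vert3 K x)) = 3"
  using mg_ends(3)[OF M(1)] by (simp add: degree_def)

lemma star_others: 
  assumes "x \<in> edges K"
  shows "\<exists>a b. incident K (vert3 K x) = {x, a, b} \<and> a \<noteq> x \<and> b \<noteq> x \<and> a \<noteq> b"
proof -
  note star = star3[OF M(1) assms]
  show ?thesis by (intro exI conjI) (rule star(1), fact star(3)[symmetric], fact star(5)[symmetric], fact star(4))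
qed

text \<open>A repeated edge would cut out a closed chain of collapsed edges without backtracking. So
  the lengths of such chains are bounded by the number of edges.\<close>

lemma zero_chain_bounded:
  "\<lbrakk>chain K p fs q; no_backtrack K fs; \<forall>f\<in>set fs. m f = 0\<rbrakk> \<Longrightarrow> distinct fs"
proof (induction fs arbitrary: p)
  case (Cons f fs)
  have "f \<notin> set fs"
  proof
    assume "f \<in> set fs"
    then obtain xs ys where fs: "fs = xs @ f # ys" using split_list by fast
    then have "\<exists>t. chain K p (f # xs) t \<and> chain K t (f # ys) q"
      using Cons.prems(1) by (auto simp: chain_append)
    then obtain t where t: "chain K p (f # xs) t" "chain K t (f # ys) q" by blast
    then have "t = p" by auto
    moreover have "p \<noteq> t"
      by (rule zero_chain_not_closed[OF marking t(1)]) 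
        (use Cons.prems fs in \<open>auto simp: no_backtrack_def successively_append_iff successively_Cons\<close>)
    ultimately show False by simp
  qed
  then show ?case using Cons by (auto simp: no_backtrack_Cons)
qed simp

text \<open>A longest path of collapsed edges would end at two vertices with the same image, at which
  there are four different directions to this image; but there are only three.\<close>

lemma no_zero_edge: 
  assumes f: "f \<in> edges K" shows "m f \<noteq> 0"
proof
  assume mf: "m f = 0"
  \<comment> \<open>\<open>P\<close> holds of the lengths of paths of collapsed edges. A longest one
    exists, and since it cannot be prolonged, every other direction at either of its ends has a
    nontrivial image.\<close>
  define P where "P n \<longleftrightarrow> (\<exists>p fs q. chain K p fs q \<and> no_backtrack K fs \<and> (\<forall>f\<in>set fs. m f = 0) \<and> length fs = n)" for n
  have "P 1" unfolding P_def
    by (rule exI[of _ "vert3 K f"], rule exI[of _ "[f]"]) (use f mf in \<open>auto simp: no_backtrack_def\<close>)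
  moreover have "n \<le> card (edges K)" if n: "P n" for n
  proof -
    obtain p fs q where fs: "chain K p fs q" "no_backtrack K fs" "\<forall>f\<in>set fs. m f = 0" "length fs = n"
      using n by (auto simp: P_def)
    have "n = card (set fs)" using zero_chain_bounded[OF fs(1-3)] fs(4) distinct_card by metis
    also have "\<dots> \<le> card (edges K)" by (rule card_mono[OF finK chain_edges[OF fs(1)]])
    finally show ?thesis .
  qed
  ultimately obtain n where n: "P n" "\<And>k. P k \<Longrightarrow> k \<le> n" "n \<ge> 1"
    using GreatestI_nat[of P 1 "card (edges K)"] Greatest_le_nat[of P _ "card (edges K)"] by metis
  obtain p fs q where fs: "chain K p fs q" "no_backtrack K fs" "\<forall>f\<in>set fs. m f = 0" "length fs = n"
    using n by (auto simp: P_def)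
  have ne: "fs \<noteq> []" using fs(4) n(3) by auto
  let ?f = "hd fs" and ?e = "twin K (last fs)"
  have hf: "?f \<in> edges K" "vert3 K ?f = p" using fs(1) ne by (cases fs; auto)+
  have le: "last fs \<in> edges K" using chain_edges[OF fs(1)] ne by auto
  have he: "?e \<in> edges K" "vert3 K ?e = q" using chain_end[OF fs(1)] le ne M(1) by auto
  have p: "m x \<noteq> 0" if x: "x \<in> edges K" "vert3 K x = p" "x \<noteq> ?f" for x
  proof
    assume "m x = 0"
    then have "P (Suc n)" unfolding P_def
      by (intro exI[of _ "vert3 K (twin K x)"] exI[of _ "twin K x # fs"] exI[of _ q])
        (use fs x M(1) M(8)[OF x(1)] in \<open>auto simp: no_backtrack_Cons\<close>)
    then show False using n(2) by fastforce
  qed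
  have q: "m x \<noteq> 0" if x: "x \<in> edges K" "vert3 K x = q" "x \<noteq> ?e" for x
  proof
    assume "m x = 0"
    then have "P (Suc n)" unfolding P_def
      by (intro exI[of _ p] exI[of _ "fs @ [x]"] exI[of _ "vert3 K (twin K x)"])
        (use fs x ne M(1) in \<open>auto simp: no_backtrack_def successively_append_iff chain_append\<close>)
    then show False using n(2) by fastforce
  qed
  obtain a b where ab: "incident K p = {?f, a, b}" "a \<noteq> ?f" "b \<noteq> ?f" "a \<noteq> b"
    using star_others[OF hf(1)] hf(2) by auto
  obtain c d where cd: "incident K q = {?e, c, d}" "c \<noteq> ?e" "d \<noteq> ?e" "c \<noteq> d"
    using star_others[OF he(1)] he(2) by auto
  have E: "a \<in> edges K" "b \<in> edges K" "vert3 K a = p" "vert3 K b = p" "c \<in> edges K" "d \<in> edges K" "vert3 K c = q" "vert3 K d = q"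
    using incident_vert3[OF M(1) hf(1)] incident_vert3[OF M(1) he(1)] hf(2) he(2) ab(1) cd(1) by auto
  have "val K m (chain_class K ?f fs ?e) = sum_list (map m fs)"
    by (rule K.val_chain_class[OF M(4)]) (use hf he fs in auto)
  also have "\<dots> = 0" using fs(3) by (induction fs) auto
  finally have "0 \<in> PW (\<phi> p) (\<phi> q)"
    using K.chain_class_hom[OF hf(1) he(1)] fs(1) hf he bij_betwE[OF M(7)[OF hf(1) he(1)]] by metis
  \<comment> \<open>The path from \<open>p\<close> to \<open>q\<close> has value 0, and the empty
    word is a path only from a vertex to itself.\<close>
  then have pq: "\<phi> p = \<phi> q" by simp
  obtain sa sb sc sd where s: "starts sa (m a)" "starts sb (m b)" "starts sc (m c)" "starts sd (m d)"
    using starts_ex p[OF E(1,3)] p[OF E(2,4)] q[OF E(5,7)] q[OF E(6,8)] ab cd by metis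
  have "zero_path K m a [] b" "zero_path K m c [] d" using E ab cd by auto
  then have d1: "sa \<noteq> sb" "sc \<noteq> sd" using folded s by blast+
  have zp: "zero_path K m x fs y" if "x \<in> {a, b}" "y \<in> {c, d}" for x y
    by (rule zero_path_of_chain[OF M(1)]) (use that E ab cd fs ne in auto)
  have d2: "sa \<noteq> sc" "sa \<noteq> sd" "sb \<noteq> sc" "sb \<noteq> sd"
    using folded[OF zp] s by blast+
  obtain y where y: "y \<in> edges G" "vert3 G y = \<phi> p" using PW_start[OF M(6)[OF E(1)] s(1)] E by auto
  have "{sa, sb, sc, sd} \<subseteq> l ` incident G (\<phi> p)"
    using PW_start[OF M(6)[OF E(1)] s(1)] PW_start[OF M(6)[OF E(2)] s(2)] PW_start[OF M(6)[OF E(5)] s(3)]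
      PW_start[OF M(6)[OF E(6)] s(4)] E pq incident_vert3[OF G y(1)] y(2) by auto
  then have "card {sa, sb, sc, sd} \<le> card (l ` incident G (\<phi> p))"
    by (rule card_mono[rotated]) (use fin in \<open>auto simp: incident_def\<close>)
  also have "\<dots> \<le> card (incident G (\<phi> p))" by (rule card_image_le) (use fin in \<open>auto simp: incident_def\<close>)
  also have "\<dots> = 3" using mg_ends(3)[OF G y(1)] y(2) by (simp add: degree_def)
  finally show False using d1 d2 by simp
qed

lemma starts_inj:
  assumes "x \<in> edges K" "y \<in> edges K" "vert3 K y = vert3 K x" "starts s (m x)" "starts s (m y)" 
  shows "x = y"
  using folded[of x "[]" y s] assms by auto

text \<open>No cancellation occurs between consecutive images: the next edge \<open>g\<close> and
  the twin of \<open>f\<close> are different edges at one vertex, so their images start with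
  different letters, and the image of \<open>f\<close> is the inverse of that of its twin. Thus the
  map is an immersion.\<close>

lemma word_chain:
  "\<lbrakk>chain K p fs q; no_backtrack K fs\<rbrakk> \<Longrightarrow> word (sum_list (map m fs)) = concat (map (\<lambda>f. word (m f)) fs)"
proof (induction fs arbitrary: p)
  case (Cons f fs)
  have f: "f \<in> edges K" using Cons.prems by simp
  have IH: "word (sum_list (map m fs)) = concat (map (\<lambda>f. word (m f)) fs)"
    using Cons by (auto simp: no_backtrack_Cons)
  have "reduced (word (m f) @ word (sum_list (map m fs)))"
  proof (cases fs)
    case (Cons g gs)
    have g: "g \<in> edges K" "vert3 K g = vert3 K (twin K f)" "g \<noteq> twin K f" 
      using Cons.prems Cons by (auto simp: no_backtrack_Cons)
    obtain s where s: "starts s (m g)" using starts_ex[OF no_zero_edge[OF g(1)]] by blast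
    have hd: "hd (word (sum_list (map m fs))) = s" using s IH Cons by (auto simp: starts_def)
    have "\<not> starts s (m (twin K f))" using starts_inj[OF g(1), of "twin K f" s] g s f M(1) by auto
    then have "\<not> starts s (- m f)" using M(8)[OF f] by simp
    moreover have "word (- m f) \<noteq> []" "word (m f) \<noteq> []" using no_zero_edge[OF f] by simp_all
    ultimately have "inverse_letter (last (word (m f))) \<noteq> s"
      using hd_inverse_word[of "word (m f)"] unfolding starts_def word_uminus by auto
    then show ?thesis unfolding reduced_append using hd by auto
  qed simp
  from word_add_append[OF this] show ?case using IH by simp
qed simp

lemma length_word_chain:
  assumes "chain K p fs q" "no_backtrack K fs" 
  shows "length fs \<le> len (sum_list (map m fs))"
proof -
  have "length (concat (map (\<lambda>f. word (m f)) fs)) \<ge> length fs" if "set fs \<subseteq> edges K" for fs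
    using that
  proof (induction fs)
    case (Cons f fs)
    then have "word (m f) \<noteq> []" using no_zero_edge[of f] by simp
    then have "length (word (m f)) \<ge> 1" by (simp add: Suc_leI)
    then show ?case using Cons by simp
  qed simp
  then show ?thesis using word_chain[OF assms] chain_edges[OF assms(1)] by (simp add: len_def)
qed

lemma lift:
  assumes "x \<in> edges K" "y \<in> edges K" "w \<in> PW (\<phi> (vert3 K x)) (\<phi> (vert3 K y))"
  obtains fs where "chain K (vert3 K x) fs (vert3 K y)" "no_backtrack K fs" "w = sum_list (map m fs)"
proof -
  obtain \<gamma> where \<gamma>: "\<gamma> \<in> gpd_hom (FG K) x y" "w = val K m \<gamma>"
    using M(7)[OF assms(1,2)] assms(3) by (auto simp: bij_betw_def)
  obtain fs where fs: "chain K (vert3 K x) fs (vert3 K y)" "no_backtrack K fs" "\<gamma> = chain_class K x fs y"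
    using K.normal_form_hom[OF \<gamma>(1)] by metis
  then show ?thesis using that K.val_chain_class[OF M(4) assms(1,2) fs(1)] \<gamma> by simp
qed

text \<open>Lift the empty path between the two images. Its chain has length 0, since every edge
  contributes at least one letter to the value.\<close>

lemma \<phi>_inj: 
  assumes "x \<in> edges K" "y \<in> edges K" "\<phi> (vert3 K x) = \<phi> (vert3 K y)" shows "vert3 K x = vert3 K y"
proof -
  obtain fs where fs: "chain K (vert3 K x) fs (vert3 K y)" "no_backtrack K fs" "0 = sum_list (map m fs)"
    using lift[OF assms(1,2), of 0] assms(3) by auto
  have "length fs \<le> len (0 :: nat fgp)" using length_word_chain[OF fs(1,2)] fs(3) by simp
  then have "length fs \<le> 0" using len_zero_iff by metis
  then show ?thesis using fs(1) by simp
qed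

text \<open>\<open>\<phi>\<close> is injective on degree-3 vertices, and both graphs have the same
  number of them because they have the same number of edges, three at each such vertex.\<close>

lemma \<phi>_surj: "\<phi> ` vert3 K ` edges K = vert3 G ` edges G"
proof (rule card_subset_eq)
  show "finite (vert3 G ` edges G)" using fin by simp
  show "\<phi> ` vert3 K ` edges K \<subseteq> vert3 G ` edges G"
  proof safe
    fix x assume x: "x \<in> edges K"
    obtain s where "starts s (m x)" using starts_ex[OF no_zero_edge[OF x]] by blast
    then obtain f where "f \<in> edges G" "vert3 G f = \<phi> (vert3 K x)" using PW_start[OF M(6)[OF x]] by blast
    then show "\<phi> (vert3 K x) \<in> vert3 G ` edges G" by (intro image_eqI[of _ _ f]) simp_all
  qed
  have "inj_on \<phi> (vert3 K ` edges K)" using \<phi>_inj by (auto simp: inj_on_def)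
  then have "card (\<phi> ` vert3 K ` edges K) = card (vert3 K ` edges K)" by (rule card_image)
  then show "card (\<phi> ` vert3 K ` edges K) = card (vert3 G ` edges G)"
    using card_edges_vert3[OF M(1) finK] card_edges_vert3[OF G fin] M(3) by simp
qed

text \<open>Lift each edge \<open>y\<close> of \<open>G\<close> at the image vertex, which is
  possible as its far end is also an image. The lift has length 1, so some edge of \<open>K\<close>
  has image exactly \<open>y\<close>. Three edges \<open>y\<close> thus account for all three edges
  at the vertex of \<open>K\<close>.\<close>

lemma single_letter: 
  assumes x: "x \<in> edges K" shows "\<exists>y\<in>edges G. m x = lt (l y) \<and> vert3 G y = \<phi> (vert3 K x)"
proof -
  have hit: "\<exists>z\<in>incident K (vert3 K x). m z = lt (l y)" if y: "y \<in> edges G" "vert3 G y = \<phi> (vert3 K x)" for y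
  proof -
    have "vert3 G (twin G y) \<in> \<phi> ` vert3 K ` edges K" using \<phi>_surj y G by simp
    then obtain t where t: "t \<in> edges K" "vert3 G (twin G y) = \<phi> (vert3 K t)" by blast
    have "lt (l y) \<in> PW (\<phi> (vert3 K x)) (\<phi> (vert3 K t))" using PW_lt[OF y(1)] y t by simp
    then obtain fs where fs: "chain K (vert3 K x) fs (vert3 K t)" "no_backtrack K fs" "lt (l y) = sum_list (map m fs)"
      using lift[OF x t(1)] by metis
    have "length fs \<le> 1" using length_word_chain[OF fs(1,2)] fs(3)[symmetric] by (simp add: len_def)
    moreover have "fs \<noteq> []" using fs(3) by auto
    ultimately obtain z where "fs = [z]" by (cases fs) auto
    then show ?thesis using fs incident_vert3[OF M(1) x] by auto
  qed
  let ?S = "incident G (\<phi> (vert3 K x))" and ?T = "incident K (vert3 K x)"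
  obtain s where "starts s (m x)" using starts_ex[OF no_zero_edge[OF x]] by blast
  then obtain y0 where y0: "y0 \<in> edges G" "vert3 G y0 = \<phi> (vert3 K x)" using PW_start[OF M(6)[OF x]] by blast
  have S: "y \<in> ?S \<longleftrightarrow> y \<in> edges G \<and> vert3 G y = \<phi> (vert3 K x)" for y
    using incident_vert3[OF G y0(1)] y0(2) by auto
  have "\<exists>h. \<forall>y\<in>?S. h y \<in> ?T \<and> m (h y) = lt (l y)" using hit S by (metis (no_types, lifting))
  then obtain h where h: "\<And>y. y \<in> ?S \<Longrightarrow> h y \<in> ?T \<and> m (h y) = lt (l y)" by blast
  have "inj_on h ?S"
  proof (rule inj_onI)
    fix y z assume "y \<in> ?S" "z \<in> ?S" "h y = h z"
    then show "y = z" using h[of y] h[of z] S l_eq_iff by (metis lt_eq_iff)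
  qed
  moreover have "card ?S = 3" "card ?T = 3" using mg_ends(3)[OF G y0(1)] y0(2) star_K[OF x] by (auto simp: degree_def)
  moreover have "h ` ?S \<subseteq> ?T" using h by auto
  ultimately have "h ` ?S = ?T" 
    by (metis card.infinite card_image card_subset_eq zero_neq_numeral)
  moreover have "x \<in> ?T" using x M(1) by simp
  ultimately obtain y where "y \<in> ?S" "x = h y" by blast
  then show ?thesis using h[of y] S by auto
qed

end


section \<open>Reaching a prescribed ribbon structure by shuffles\<close>

lemma cyclic_on_3_cases:
  assumes "cyclic_on f S" "cyclic_on g S" "card S = 3"
  shows "(\<forall>x\<in>S. f x = g x) \<or> (\<forall>x\<in>S. f x = g (g x))"
proof -
  obtain x where x: "x \<in> S" using assms by fastforce
  note g = cyclic_on_3[OF assms(2,3) x] and f = cyclic_on_3[OF assms(1,3) x]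
  have "f x \<in> {x, g x, g (g x)}" "f (f x) \<in> {x, g x, g (g x)}" using f(1) g(1) by blast+
  then have "f x = g x \<and> f (f x) = g (g x) \<or> f x = g (g x) \<and> f (f x) = g x"
    using f(3-5) by auto
  then show ?thesis using f(2) g by auto
qed

lemma cyclic_on_2_unique:
  assumes "cyclic_on f S" "cyclic_on g S" "card S = 2" "x \<in> S"
  shows "f x = g x"
  using cyclic_on_2[OF assms(1,3,4)] cyclic_on_2[OF assms(2,3,4)] by (metis insertI1 insertI2 insertE singletonD)

text \<open>Correct the degree-3 vertices one at a time; \<open>D\<close> is the set of those
  already corrected. Each has just two cyclic orders, so at most one shuffle is spent on it. A
  degree-2 vertex has only one cyclic order.\<close>

lemma OMG_mor_rot:
  assumes K: "modular_graph K" "finite (edges K)" and \<rho>: "\<And>v. v \<in> verts K \<Longrightarrow> cyclic_on (\<rho> v) (incident K v)"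
  shows "OMG_mor (K, l) (K\<lparr>rot := \<rho>\<rparr>, l) (functor_id (FG K))"
proof -
  let ?K = "\<lambda>D. K\<lparr>rot := (\<lambda>v. if v \<in> D then \<rho> v else rot K v)\<rparr>"
  have inc: "incident (?K D) = incident K" "incident (K\<lparr>rot := \<rho>\<rparr>) = incident K" for D 
    by (auto simp: incident_def[abs_def])
  have FGK: "FG (?K D) = FG K" for D by (rule fund_groupoid_cong) (auto simp: inc)
  have modK: "modular_graph (?K D)" for D
    by (rule modular_graph_rot[OF K(1)]) (use \<rho> rot_cyclic[OF K(1)] in auto)
  have deg: "degree (?K D) = degree K" for D by (simp add: degree_def[abs_def] inc)
  have v3: "vert3 (?K D) = vert3 K" for D by (simp add: vert3_def[abs_def] deg)
  note id = functor_id_iso[OF fund.gpd_axioms, of K]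
  have main: "finite D \<Longrightarrow> D \<subseteq> vert3 K ` edges K \<Longrightarrow> OMG_mor (K, l) (?K D, l) (functor_id (FG K))" for D
  proof (induction D rule: finite_induct)
    case empty
    show ?case by (rule OMG_mor_cong) auto
  next
    case (insert v D)
    then obtain x where x: "x \<in> edges K" "v = vert3 K x" by auto
    have v: "v \<in> verts K" "degree K v = 3" using x K(1) mg_ends(3)[OF K(1)] by auto
    have IH: "OMG_mor (K, l) (?K D, l) (functor_id (FG K))" using insert by simp
    have "card (incident K v) = 3" using v(2) by (simp add: degree_def)
    then consider "\<forall>x\<in>incident K v. \<rho> v x = rot K v x" | "\<forall>x\<in>incident K v. \<rho> v x = rot K v (rot K v x)"
      using cyclic_on_3_cases[OF \<rho>[OF v(1)] rot_cyclic[OF K(1) v(1)]] by blast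
    then show ?case
    proof cases
      case 1
      have "OMG_mor (?K D, l) (?K (insert v D), l) (functor_id (FG (?K D)))"
        by (rule OMG_mor_cong) (use 1 insert(2) in \<open>auto simp: inc\<close>)
      then show ?thesis using OMG_mor_compose_id_right[OF IH] id by (simp only: FGK)
    next
      case 2
      have "OMG_mor (?K D, l) (shuffle (?K D) v, l) (functor_id (FG (?K D)))"
        by (rule OMG_mor.shuffle) (use v deg in simp_all)
      then have s: "OMG_mor (K, l) (shuffle (?K D) v, l) (functor_id (FG K))"
        using OMG_mor_compose_id_right[OF IH] id by (simp only: FGK)
      have "rot (?K (insert v D)) t y = rot (shuffle (?K D) v) t y" if y: "y \<in> incident K t" for t y
      proof (cases "t = v")
        case True
        have "y \<in> edges K" "vert3 K y = v" using y True incident_vert3[OF K(1) x(1)] x(2) by auto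
        then show ?thesis using shuffle_rot[OF modK, of y D] 2 y True insert(2) v3 by simp
      qed simp
      then have "OMG_mor (shuffle (?K D) v, l) (?K (insert v D), l) (functor_id (FG (shuffle (?K D) v)))"
        by (intro OMG_mor_cong) (auto simp: inc simp del: shuffle_simps(9))
      then show ?thesis using OMG_mor_compose_id_right[OF s] id by (simp only: FGK shuffle_FG)
    qed
  qed
  have V: "OMG_mor (K, l) (?K (vert3 K ` edges K), l) (functor_id (FG K))" by (rule main) (use K in auto)
  have "rot (K\<lparr>rot := \<rho>\<rparr>) v x = rot (?K (vert3 K ` edges K)) v x" if "v \<in> verts K" "x \<in> incident K v" for v x
  proof (cases "v \<in> vert3 K ` edges K")
    case False
    then have "card (incident K v) = 2" 
      using that mg_ends(2)[OF K(1)] incident_iff[OF K(1)] by (auto simp: degree_def)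
    then show ?thesis using False cyclic_on_2_unique[OF \<rho> rot_cyclic[OF K(1)]] that by simp
  qed simp
  then have "OMG_mor (?K (vert3 K ` edges K), l) (K\<lparr>rot := \<rho>\<rparr>, l) (functor_id (FG (?K (vert3 K ` edges K))))"
    by (intro OMG_mor_cong) (auto simp: inc)
  then show ?thesis using OMG_mor_compose_id_right[OF V] id by (simp only: FGK)
qed

section \<open>The graph isomorphism given by a folded marking\<close>

context folded
begin

definition "\<psi> x = (SOME y. y \<in> edges G \<and> m x = lt (l y) \<and> vert3 G y = \<phi> (vert3 K x))"

lemma \<psi>: 
  assumes "x \<in> edges K" shows "\<psi> x \<in> edges G" "m x = lt (l (\<psi> x))" "vert3 G (\<psi> x) = \<phi> (vert3 K x)"
proof -
  have "\<psi> x \<in> edges G \<and> m x = lt (l (\<psi> x)) \<and> vert3 G (\<psi> x) = \<phi> (vert3 K x)"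
    unfolding \<psi>_def by (rule someI_ex) (use single_letter[OF assms] in blast)
  then show "\<psi> x \<in> edges G" "m x = lt (l (\<psi> x))" "vert3 G (\<psi> x) = \<phi> (vert3 K x)" by auto
qed

lemma \<psi>_twin: "x \<in> edges K \<Longrightarrow> \<psi> (twin K x) = twin G (\<psi> x)"
proof -
  assume x: "x \<in> edges K"
  then have t: "twin K x \<in> edges K" using M(1) by simp
  have "lt (l (\<psi> (twin K x))) = lt (l (twin G (\<psi> x)))"
    using \<psi>[OF x] \<psi>[OF t] M(8)[OF x] by (simp add: lt_inverse)
  then show ?thesis using l_eq_iff[of "\<psi> (twin K x)" "twin G (\<psi> x)"] \<psi>[OF x] \<psi>[OF t] G by simp
qed

lemma \<psi>_bij: "bij_betw \<psi> (edges K) (edges G)"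
proof -
  have inj: "inj_on \<psi> (edges K)"
  proof (rule inj_onI)
    fix x y assume xy: "x \<in> edges K" "y \<in> edges K" "\<psi> x = \<psi> y"
    then have "vert3 K x = vert3 K y" using \<phi>_inj \<psi> by metis
    moreover have "starts (l (\<psi> x)) (m x)" "starts (l (\<psi> x)) (m y)" using \<psi>[OF xy(1)] \<psi>[OF xy(2)] xy(3) by (simp_all add: starts_def)
    ultimately show "x = y" using starts_inj xy by metis
  qed
  moreover have "\<psi> ` edges K = edges G"
    by (rule card_subset_eq[OF fin]) (use \<psi> card_image[OF inj] M(3) in auto)
  ultimately show ?thesis by (simp add: bij_betw_def)
qed

lemma \<psi>_eq_iff: "\<lbrakk>x \<in> edges K; y \<in> edges K\<rbrakk> \<Longrightarrow> \<psi> x = \<psi> y \<longleftrightarrow> x = y"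
  using \<psi>_bij inj_on_eq_iff by (metis bij_betw_def)

text \<open>On degree-2 vertices the chosen edge is one of two twins, and both give the same value
  because \<open>\<psi>\<close> respects twins (\<open>\<psi>v_vert2\<close>).\<close>

definition "\<psi>v v = (if v \<in> vert3 K ` edges K then \<phi> v else vert2 G (\<psi> (SOME x. x \<in> edges K \<and> vert2 K x = v)))"

lemma \<psi>v_vert3: "x \<in> edges K \<Longrightarrow> \<psi>v (vert3 K x) = vert3 G (\<psi> x)"
  by (simp add: \<psi>v_def \<psi>)

lemma \<psi>v_vert2: "x \<in> edges K \<Longrightarrow> \<psi>v (vert2 K x) = vert2 G (\<psi> x)"
proof -
  assume x: "x \<in> edges K"
  let ?y = "SOME y. y \<in> edges K \<and> vert2 K y = vert2 K x"
  have y: "?y \<in> edges K \<and> vert2 K ?y = vert2 K x" by (rule someI[of _ x]) (use x in simp)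
  then have "?y = x \<or> ?y = twin K x" using vert2_eq_iff[OF M(1) x, of ?y] by auto
  then have "vert2 G (\<psi> ?y) = vert2 G (\<psi> x)" using \<psi>_twin[OF x] \<psi>(1)[OF x] G by auto
  moreover have "vert2 K x \<notin> vert3 K ` edges K" using M(1) x by auto
  ultimately show ?thesis by (simp add: \<psi>v_def)
qed

lemma \<psi>_surj: "y \<in> edges G \<Longrightarrow> \<exists>x\<in>edges K. y = \<psi> x"
  using \<psi>_bij by (auto simp: bij_betw_def)

lemma \<psi>v_bij: "bij_betw \<psi>v (verts K) (verts G)"
proof (rule bij_betw_imageI)
  show "\<psi>v ` verts K = verts G"
  proof (intro equalityI subsetI)
    fix t assume "t \<in> \<psi>v ` verts K"
    then obtain v where v: "v \<in> verts K" "t = \<psi>v v" by blast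
    from M(1) v(1) show "t \<in> verts G"
      by (rule vert_cases) (use v(2) \<psi>v_vert2 \<psi>v_vert3 \<psi>(1) G in auto)
  next
    fix t assume t: "t \<in> verts G"
    from G t show "t \<in> \<psi>v ` verts K"
    proof (rule vert_cases)
      fix y assume y: "y \<in> edges G" "t = vert2 G y"
      then obtain x where x: "x \<in> edges K" "y = \<psi> x" using \<psi>_surj by blast
      then show ?thesis using y M(1) by (intro image_eqI[of _ _ "vert2 K x"]) (simp_all add: \<psi>v_vert2)
    next
      fix y assume y: "y \<in> edges G" "t = vert3 G y"
      then obtain x where x: "x \<in> edges K" "y = \<psi> x" using \<psi>_surj by blast
      then show ?thesis using y M(1) by (intro image_eqI[of _ _ "vert3 K x"]) (simp_all add: \<psi>v_vert3)
    qed
  qed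
  show "inj_on \<psi>v (verts K)"
  proof (rule inj_onI)
    fix s t assume st: "s \<in> verts K" "t \<in> verts K" "\<psi>v s = \<psi>v t"
    have v2: "vert2 K x = vert2 K y" if xy: "x \<in> edges K" "y \<in> edges K" "vert2 G (\<psi> x) = vert2 G (\<psi> y)" for x y
    proof -
      have "\<psi> y = \<psi> x \<or> \<psi> y = \<psi> (twin K x)" 
        using vert2_eq_iff[OF G \<psi>(1)[OF xy(1)] \<psi>(1)[OF xy(2)]] xy(3) \<psi>_twin[OF xy(1)] by simp
      then have "y = x \<or> y = twin K x" 
        using \<psi>_eq_iff[OF xy(2,1)] \<psi>_eq_iff[OF xy(2) twin_edge[OF M(1) xy(1)]] by blast
      then show ?thesis using xy(1) vert2_twin[OF M(1) xy(1)] by metis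
    qed
    have v3: "vert3 K x = vert3 K y" if xy: "x \<in> edges K" "y \<in> edges K" "vert3 G (\<psi> x) = vert3 G (\<psi> y)" for x y
      using \<phi>_inj[OF xy(1,2)] xy \<psi>(3) by simp
    have v23: "vert2 G (\<psi> x) \<noteq> vert3 G (\<psi> y)" if "x \<in> edges K" "y \<in> edges K" for x y
      using that \<psi>(1) G by simp
    obtain x y where "x \<in> edges K" "y \<in> edges K" "s = vert2 K x \<or> s = vert3 K x" "t = vert2 K y \<or> t = vert3 K y"
      using verts_eq[OF M(1)] st(1,2) by auto
    then show "s = t" using st(3) v2 v3 v23 \<psi>v_vert2 \<psi>v_vert3 by metis
  qed
qed

lemma \<psi>_incident: 
  assumes "v \<in> verts K" shows "incident G (\<psi>v v) = \<psi> ` incident K v"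
proof -
  have inj: "\<psi>v s = \<psi>v t \<longleftrightarrow> s = t" if "s \<in> verts K" "t \<in> verts K" for s t
    using \<psi>v_bij that by (auto simp: bij_betw_def inj_on_def)
  have "\<psi> x \<in> incident G (\<psi>v v) \<longleftrightarrow> x \<in> incident K v" if x: "x \<in> edges K" for x
    unfolding incident_iff[OF G] incident_iff[OF M(1)] \<psi>v_vert2[OF x, symmetric] \<psi>v_vert3[OF x, symmetric]
    using x \<psi>(1)[OF x] inj assms vert_verts[OF M(1) x] by simp
  note * = this
  show ?thesis
  proof (intro equalityI subsetI)
    fix y assume y: "y \<in> incident G (\<psi>v v)"
    then obtain x where "x \<in> edges K" "y = \<psi> x" using \<psi>_surj incident_edges by fast
    then show "y \<in> \<psi> ` incident K v" using * y by blast
  qed (use * incident_edges[of _ K] in auto)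
qed

text \<open>The morphism is assembled from shuffles that give \<open>K\<close> the ribbon structure
  of \<open>G\<close>, a relabeling that gives it the labels of \<open>G\<close>, and the
  identification along \<open>\<psi>\<close>. Since every image is a single letter, its value under
  \<open>\<iota>\<close> is the marking.\<close>

lemma folded_iso:
  "\<exists>J. OMG_mor (K, l) (G, l) J \<and> (\<forall>x\<in>edges K. fst J x \<in> edges G \<and> vert3 G (fst J x) = \<phi> (vert3 K x))
    \<and> (\<forall>\<gamma>\<in>gpd_mor (FG K). \<iota> (snd J \<gamma>) = val K m \<gamma>)"
proof -
  define \<psi>' where "\<psi>' = inv_into (edges K) \<psi>"
  have \<psi>': "\<psi>' (\<psi> x) = x" if "x \<in> edges K" for x 
    using \<psi>_bij that by (simp add: \<psi>'_def bij_betw_def)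
  \<comment> \<open>The cyclic orders of \<open>G\<close> pulled back along
    \<open>\<psi>\<close>.\<close>
  define \<rho> where "\<rho> v x = \<psi>' (rot G (\<psi>v v) (\<psi> x))" for v x
  have rot_in: "rot G (\<psi>v v) (\<psi> x) \<in> \<psi> ` incident K v" if "v \<in> verts K" "x \<in> incident K v" for v x
  proof -
    have "\<psi>v v \<in> verts G" using \<psi>v_bij that by (auto simp: bij_betw_def)
    then show ?thesis using cyclic_on_inI[OF rot_cyclic[OF G]] \<psi>_incident[OF that(1)] that(2) by blast
  qed
  have \<rho>: "cyclic_on (\<rho> v) (incident K v)" if v: "v \<in> verts K" for v
  proof -
    have "\<psi>v v \<in> verts G" using \<psi>v_bij v by (auto simp: bij_betw_def)
    then have "cyclic_on (rot G (\<psi>v v)) (\<psi> ` incident K v)" using rot_cyclic[OF G] \<psi>_incident[OF v] by metis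
    then have "cyclic_on (\<rho> v) (\<psi>' ` \<psi> ` incident K v)"
      by (rule cyclic_on_image) (auto simp: \<rho>_def \<psi>' incident_edges)
    moreover have "\<psi>' ` \<psi> ` incident K v = incident K v" using \<psi>' incident_edges[of _ K v] by (force simp: image_iff)
    ultimately show ?thesis by simp
  qed
  let ?K = "K\<lparr>rot := \<rho>\<rparr>"
  have inc: "incident ?K = incident K" by (auto simp: incident_def[abs_def])
  have twinK: "twin ?K = twin K" "vert2 ?K = vert2 K" "vert3 ?K = vert3 K"
    by (auto simp: twin_def[abs_def] vert2_def[abs_def] vert3_def[abs_def] degree_def[abs_def] inc)
  have FGK: "FG ?K = FG K" "gen ?K = gen K" by (rule fund_groupoid_cong gen_cong; simp add: inc)+
  have modK: "modular_graph ?K" by (rule modular_graph_rot[OF M(1)]) (use \<rho> in auto)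
  have labK: "labeling ?K l" using M(2) by (auto simp: labeling_def label_indices_def twinK)
  define I where "I = label_indices G \<times> (UNIV :: bool set)"
  have ind: "label_indices ?K = label_indices G" using M(3) by (simp add: label_indices_def)
  have lK: "bij_betw l (edges K) I" and lG: "bij_betw l (edges G) I"
    using M(2,3) l by (auto simp: labeling_def label_indices_def I_def)
  \<comment> \<open>The permutation taking the label of \<open>x\<close> to the label of
    \<open>\<psi> x\<close>. It preserves pairs because \<open>\<psi>\<close> respects
    twins.\<close>
  define \<sigma> where "\<sigma> = l \<circ> (\<psi> \<circ> inv_into (edges K) l)"
  have \<sigma>_bij: "bij_betw \<sigma> I I" unfolding \<sigma>_def 
    using bij_betw_inv_into[OF lK] \<psi>_bij lG by (blast intro: bij_betw_trans)
  have \<sigma>: "\<sigma> (l x) = l (\<psi> x)" if "x \<in> edges K" for x 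
    using that lK by (simp add: \<sigma>_def bij_betw_def)
  have "\<exists>k. \<sigma> ` {(j, True), (j, False)} = {(k, True), (k, False)}" if j: "j \<in> label_indices G" for j
  proof -
    have "(j, True) \<in> l ` edges K" using lK j by (auto simp: bij_betw_def I_def)
    then obtain x where x: "x \<in> edges K" "l x = (j, True)" by auto
    have t: "l (twin K x) = (j, False)" using K.l_twin[OF x(1)] x(2) by simp
    have "\<sigma> (j, True) = l (\<psi> x)" "\<sigma> (j, False) = l (twin G (\<psi> x))"
      using \<sigma>[OF x(1)] \<sigma>[of "twin K x"] x t M(1) \<psi>_twin[OF x(1)] by simp_all
    then show ?thesis using l \<psi>(1)[OF x(1)] by (simp add: labeling_def)
  qed
  then have perm: "label_perm ?K \<sigma>" using \<sigma>_bij by (simp add: label_perm_def ind I_def)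
  have giso: "labeled_graph_iso (?K, \<sigma> \<circ> l) (G, l) \<psi>v \<psi>"
    unfolding labeled_graph_iso_def prod.case
  proof (intro conjI ballI)
    fix x assume "x \<in> edges ?K"
    then have x: "x \<in> edges K" by simp
    show "ends G (\<psi> x) = \<psi>v ` ends ?K x"
      using mg_ends(1)[OF G \<psi>(1)[OF x]] mg_ends(1)[OF M(1) x] \<psi>v_vert2[OF x] \<psi>v_vert3[OF x] by simp
    show "l (\<psi> x) = (\<sigma> \<circ> l) x" using \<sigma>[OF x] by simp
  next
    fix v x assume "v \<in> verts ?K" "x \<in> incident ?K v"
    then have vx: "v \<in> verts K" "x \<in> incident K v" by (simp_all add: inc)
    from rot_in[OF vx] obtain y where "y \<in> incident K v" "rot G (\<psi>v v) (\<psi> x) = \<psi> y" by blast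
    then show "rot G (\<psi>v v) (\<psi> x) = \<psi> (rot ?K v x)" using \<psi>'[of y] incident_edges[of y K v] by (simp add: \<rho>_def)
  qed (use \<psi>v_bij \<psi>_bij in simp_all)
  interpret I: graph_iso ?K G "\<sigma> \<circ> l" l \<psi>v \<psi> by unfold_locales (use modK giso in auto)
  let ?J = "iso_functor ?K \<psi>v \<psi>"
  have 1: "OMG_mor (K, l) (?K, l) (functor_id (FG K))"
    by (rule OMG_mor_rot[OF M(1) finK]) (rule \<rho>)
  have 2: "OMG_mor (?K, l) (?K, \<sigma> \<circ> l) (functor_id (FG K))"
    using OMG_mor.relabel[OF perm, of l] FGK by simp
  have 3: "OMG_mor (?K, \<sigma> \<circ> l) (G, l) ?J" by (rule OMG_mor.identify[OF giso])
  have id: "functor_id (FG K) \<in> gpd_iso (FG K) (FG ?K)" using functor_id_iso[OF fund.gpd_axioms, of K] FGK by simp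
  have 12: "OMG_mor (K, l) (?K, \<sigma> \<circ> l) (functor_id (FG K))"
    by (rule OMG_mor_compose_id_right[OF 1 id]) (use 2 FGK in simp)
  have "?J \<in> gpd_iso (FG K) (FG G)" using I.iso_functor_iso FGK by simp
  then have J: "OMG_mor (K, l) (G, l) ?J" using OMG_mor_compose_id_left[OF 12 3] by blast
  note fJ = functorialD[OF I.iso_functorial, unfolded FGK]
  have "\<iota> (snd ?J \<gamma>) = val K m \<gamma>" if \<gamma>: "\<gamma> \<in> gpd_mor (FG K)" for \<gamma>
  proof (rule group_functor_eqI[OF _ val_comp[OF M(1,4)] _ \<gamma>, where b = "\<lambda>v. SOME x. x \<in> incident K v"])
    fix a b assume "a \<in> gpd_mor (FG K)" "b \<in> gpd_mor (FG K)" "gpd_tgt (FG K) a = gpd_src (FG K) b"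
    then show "\<iota> (snd ?J (gpd_comp (FG K) a b)) = \<iota> (snd ?J a) + \<iota> (snd ?J b)"
      using fJ by (simp add: \<iota>_comp)
  next
    fix v x assume x: "x \<in> incident K v"
    let ?b = "SOME x. x \<in> incident K v"
    have b: "?b \<in> incident K v" using x by (rule someI)
    have e: "x \<in> edges K" "?b \<in> edges K" using x b incident_edges by fast+
    have v: "v \<in> verts K" using x M(1) by (auto simp: incident_iff[OF M(1)])
    have J: "snd ?J (gen K x v ?b) = gen G (\<psi> x) (\<psi>v v) (\<psi> ?b)"
      using I.iso_functor_gen[of x v ?b] x b by (simp add: inc FGK)
    have "\<psi> x \<in> incident G (\<psi>v v)" "\<psi> ?b \<in> incident G (\<psi>v v)" using x b \<psi>_incident[OF v] by auto
    then have "\<iota> (gen G (\<psi> x) (\<psi>v v) (\<psi> ?b)) = step_val G (\<lambda>x. lt (l x)) (\<psi> x) (\<psi>v v) (\<psi> ?b)"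
      unfolding \<iota>_def by (rule val_gen[OF G \<iota>_odd])
    also have "\<dots> = step_val K m x v ?b"
    proof -
      have "\<psi>v v = vert2 G (\<psi> x) \<longleftrightarrow> v = vert2 K x"
        using \<psi>v_vert2[OF e(1)] \<psi>v_bij v vert_verts(1)[OF M(1) e(1)] by (metis bij_betw_inv_into_left)
      moreover have "\<psi> ?b = \<psi> x \<longleftrightarrow> ?b = x" by (rule \<psi>_eq_iff[OF e(2,1)])
      ultimately show ?thesis using \<psi>(2)[OF e(1)] by (simp only: step_val_def)
    qed
    finally show "?b \<in> incident K v \<and> \<iota> (snd ?J (gen K x v ?b)) = val K m (gen K x v ?b)"
      using b J val_gen[OF M(1,4) x b] by simp
  qed
  then show ?thesis using J \<psi> by (intro exI[of _ ?J]) (simp add: iso_functor_def)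
qed

end

section \<open>Surjectivity\<close>

context labeled
begin

text \<open>Induction on the total length. If no marked graph is shorter, no two directions joined
  by a zero path can start with the same letter, which is the hypothesis of the locale
  \<open>folded\<close>.\<close>

lemma fold_completely:
  assumes fin: "finite (edges G)" and x0: "x0 \<in> edges G" and "marked N x0 K m \<phi>"
  shows "\<exists>F c. OMG_mor (G, l) (G, l) F \<and> c \<in> gpd_hom (FG G) x0 (fst F x0)
    \<and> (\<forall>\<gamma>\<in>gpd_hom (FG G) x0 x0. \<iota> (snd F \<gamma>) = - \<iota> c + N \<gamma> + \<iota> c)"
  using assms(3)
proof (induction "total_len K m" arbitrary: K m \<phi> rule: less_induct)
  case less
  show ?case
  proof (cases "\<exists>K' m' \<phi>'. marked N x0 K' m' \<phi>' \<and> total_len K' m' < total_len K m")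
    case True
    then show ?thesis using less by blast
  next
    case False
    have mk: "marking K m \<phi>" using less by (simp add: marked_def)
    note M = markingD[OF mk]
    interpret F: folded G l K m \<phi>
      by unfold_locales (use fin mk False fold_along_zero_path[OF x0 fin less(2)] in blast)+
    obtain J where J: "OMG_mor (K, l) (G, l) J" 
      "\<And>x. x \<in> edges K \<Longrightarrow> fst J x \<in> edges G \<and> vert3 G (fst J x) = \<phi> (vert3 K x)"
      "\<And>\<gamma>. \<gamma> \<in> gpd_mor (FG K) \<Longrightarrow> \<iota> (snd J \<gamma>) = val K m \<gamma>"
      using F.folded_iso by blast
    obtain \<Phi> c where \<Phi>: "OMG_mor (G, l) (K, l) \<Phi>" "\<Phi> \<in> gpd_iso (FG G) (FG K)" "fst \<Phi> x0 = x0" 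
      "c \<in> PW (vert3 G x0) (\<phi> (vert3 K x0))" 
      "\<forall>\<gamma>\<in>gpd_hom (FG G) x0 x0. val K m (snd \<Phi> \<gamma>) = - c + N \<gamma> + c"
      using less(2) by (auto simp: marked_def)
    note f\<Phi> = functorialD[OF gpd_iso_functorial[OF \<Phi>(2)]]
    have x0K: "x0 \<in> edges K" using x0 M(3) by simp
    have c: "c \<in> PW (vert3 G x0) (vert3 G (fst J x0))" using \<Phi>(4) J(2)[OF x0K] by simp
    obtain d where d: "d \<in> gpd_hom (FG G) x0 (fst J x0)" "\<iota> d = c"
      using \<iota>_surj[OF x0 _ c] J(2)[OF x0K] by blast
    let ?F = "functor_comp (FG G) J \<Phi>"
    have "fst ?F x0 = fst J x0" using x0 \<Phi>(3) by (simp add: functor_comp_def compose_def)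
    moreover have "\<iota> (snd ?F \<gamma>) = - \<iota> d + N \<gamma> + \<iota> d" if \<gamma>: "\<gamma> \<in> gpd_hom (FG G) x0 x0" for \<gamma>
    proof -
      have g: "\<gamma> \<in> gpd_mor (FG G)" using \<gamma> by (simp add: gpd_hom_def)
      then have "\<iota> (snd ?F \<gamma>) = \<iota> (snd J (snd \<Phi> \<gamma>))" by (simp add: functor_comp_def compose_def)
      also have "\<dots> = val K m (snd \<Phi> \<gamma>)" using J(3) f\<Phi>(2)[OF g] by blast
      finally show ?thesis using \<Phi>(5) \<gamma> d(2) by simp
    qed
    ultimately show ?thesis using OMG_mor.compose[OF \<Phi>(1) J(1)] d(1) by (intro exI[of _ ?F] exI[of _ d]) auto
  qed
qed

text \<open>The domain is \<open>G\<close> itself with the identity morphism, and every vertex is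
  sent to that of \<open>x0\<close>. A morphism is closed up to a loop at \<open>x0\<close> by
  chosen paths, and then \<open>\<alpha>\<close> is applied; so the value of a twin pair is usually
  a long word.\<close>

lemma initial_marking:
  assumes x0: "x0 \<in> edges G" and \<alpha>: "\<alpha> \<in> auto (pi1 G x0)"
  shows "\<exists>m \<phi>. marked (\<lambda>\<gamma>. \<iota> (\<alpha> \<gamma>)) x0 G m \<phi>"
proof -
  let ?X = "FG G" and ?H = "gpd_hom (FG G)"
  have pi: "carrier (pi1 G x0) = ?H x0 x0" "\<And>a b. a \<otimes>\<^bsub>pi1 G x0\<^esub> b = gpd_comp ?X a b"
    by (simp_all add: pi1_def isotropy_def)
  have \<alpha>_bij: "bij_betw \<alpha> (?H x0 x0) (?H x0 x0)" 
    and \<alpha>_comp: "\<And>a b. a \<in> ?H x0 x0 \<Longrightarrow> b \<in> ?H x0 x0 \<Longrightarrow> \<alpha> (gpd_comp ?X a b) = gpd_comp ?X (\<alpha> a) (\<alpha> b)"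
    using \<alpha> by (auto simp: auto_def Bij_def hom_def pi)
  have \<alpha>_H: "\<alpha> a \<in> ?H x0 x0" if "a \<in> ?H x0 x0" for a using \<alpha>_bij that by (auto simp: bij_betw_def)
  define N where "N a = \<iota> (\<alpha> a)" for a
  have N_comp: "N (gpd_comp ?X a b) = N a + N b" if "a \<in> ?H x0 x0" "b \<in> ?H x0 x0" for a b
    using \<alpha>_H[OF that(1)] \<alpha>_H[OF that(2)] that by (simp add: N_def \<alpha>_comp \<iota>_comp gpd_hom_def)
  define b where "b v = (SOME x. x \<in> edges G \<and> vert3 G x = v)" for v
  have b: "b (vert3 G x) \<in> edges G" "vert3 G (b (vert3 G x)) = vert3 G x" if "x \<in> edges G" for x
    using someI[of "\<lambda>y. y \<in> edges G \<and> vert3 G y = vert3 G x" x] that by (auto simp: b_def)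
  define q where "q v = (SOME c. c \<in> ?H x0 (b v))" for v
  have q: "q (vert3 G x) \<in> ?H x0 (b (vert3 G x))" if "x \<in> edges G" for x
    unfolding q_def by (rule someI_ex) (use fund_connected[OF G x0 b(1)[OF that]] in blast)
  \<comment> \<open>All paths to the edges of one degree-3 star pass through the same base edge of
    that star. This makes them compatible with turns in the star, so such turns close up to the
    identity and have value 0, as \<open>val\<close> requires.\<close>
  define p where "p x = gpd_comp ?X (q (vert3 G x)) (gen G (b (vert3 G x)) (vert3 G x) x)" for x
  have gen_b: "gen G (b (vert3 G x)) (vert3 G x) x \<in> ?H (b (vert3 G x)) x" if "x \<in> edges G" for x
    using gen_vert3_hom[OF b(1)[OF that] that] b(2)[OF that] by simp
  have p: "p x \<in> ?H x0 x" if "x \<in> edges G" for x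
    using comp_hom[OF q[OF that] gen_b[OF that]] by (simp add: p_def)
  have p_gen: "gpd_comp ?X (p x) (gen G x (vert3 G x) y) = p y" if "x \<in> edges G" "y \<in> edges G" "vert3 G y = vert3 G x" for x y
  proof -
    have i: "b (vert3 G x) \<in> incident G (vert3 G x)" "x \<in> incident G (vert3 G x)" "y \<in> incident G (vert3 G x)"
      using b[OF that(1)] that by (simp_all add: incident_vert3_iff)
    show ?thesis unfolding p_def that(3) gen_comp[OF i, symmetric] 
      using q[OF that(1)] i by (subst fund.comp_assoc) (auto simp: gpd_hom_def)
  qed
  define C where "C \<gamma> = gpd_comp ?X (gpd_comp ?X (p (gpd_src ?X \<gamma>)) \<gamma>) (gpd_inv ?X (p (gpd_tgt ?X \<gamma>)))" for \<gamma>
  have p': "p x \<in> gpd_mor ?X" "gpd_src ?X (p x) = x0" "gpd_tgt ?X (p x) = x" if "x \<in> edges G" for x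
    using p[OF that] by (simp_all add: gpd_hom_def)
  have st: "gpd_src ?X \<gamma> \<in> edges G" "gpd_tgt ?X \<gamma> \<in> edges G" if "\<gamma> \<in> gpd_mor ?X" for \<gamma>
    using fund.src_obj[OF that] fund.tgt_obj[OF that] by simp_all
  have C_H: "C \<gamma> \<in> ?H x0 x0" if "\<gamma> \<in> gpd_mor ?X" for \<gamma>
    using that p' st[OF that] by (simp add: C_def gpd_hom_def)
  have C_comp: "C (gpd_comp ?X a b) = gpd_comp ?X (C a) (C b)" 
    if "a \<in> gpd_mor ?X" "b \<in> gpd_mor ?X" "gpd_tgt ?X a = gpd_src ?X b" for a b
    using that p' st[OF that(1)] st[OF that(2)] by (simp add: C_def fund.comp_assoc)
  define m where "m x = N (C (gen G x (vert2 G x) (twin G x)))" for x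
  have N_ident: "N (gpd_ident ?X x0) = 0"
    using N_comp[of "gpd_ident ?X x0" "gpd_ident ?X x0"] x0 by (simp add: gpd_hom_def) (metis add.right_neutral add_left_imp_eq)
  have NC_comp: "N (C (gpd_comp ?X a b)) = N (C a) + N (C b)" 
    if "a \<in> gpd_mor ?X" "b \<in> gpd_mor ?X" "gpd_tgt ?X a = gpd_src ?X b" for a b
    using C_comp[OF that] N_comp C_H that by simp
  have C_ident: "C (gpd_ident ?X x) = gpd_ident ?X x0" if "x \<in> edges G" for x
    using that p'[OF that] by (simp add: C_def)
  have odd: "twin_odd G m"
    unfolding twin_odd_def
  proof
    fix x assume x: "x \<in> edges G"
    have i: "x \<in> incident G (vert2 G x)" "twin G x \<in> incident G (vert2 G x)" using x G incident_vert2[OF G x] by auto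
    have "m x + m (twin G x) = N (C (gpd_comp ?X (gen G x (vert2 G x) (twin G x)) (gen G (twin G x) (vert2 G x) x)))"
      using NC_comp i x G by (simp add: m_def)
    also have "\<dots> = 0" using gen_comp[OF i i(1)] gen_self[OF i(1)] C_ident[OF x] N_ident by simp
    finally show "m (twin G x) = - m x" by (simp add: minus_unique)
  qed
  have C_vert3: "N (C (gen G x (vert3 G x) y)) = 0" if xy: "x \<in> edges G" "y \<in> edges G" "vert3 G y = vert3 G x" for x y
  proof -
    have "gen G x (vert3 G x) y \<in> ?H x y" by (rule gen_vert3_hom[OF xy])
    then have "C (gen G x (vert3 G x) y) = gpd_comp ?X (p y) (gpd_inv ?X (p y))"
      using p_gen[OF xy] by (simp add: C_def gpd_hom_def)
    then show ?thesis using p'[OF xy(2)] N_ident by simp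
  qed
  have val: "val G m \<gamma> = N (C \<gamma>)" if \<gamma>: "\<gamma> \<in> gpd_mor ?X" for \<gamma>
  proof (rule group_functor_eqI[OF val_comp[OF G odd] NC_comp _ \<gamma>, where b = "\<lambda>v. SOME x. x \<in> incident G v"])
    fix v x assume x: "x \<in> incident G v"
    let ?b = "SOME x. x \<in> incident G v"
    have bi: "?b \<in> incident G v" using x by (rule someI)
    have e: "x \<in> edges G" "?b \<in> edges G" using x bi incident_edges by fast+
    have "val G m (gen G x v ?b) = N (C (gen G x v ?b))"
    proof (cases "v = vert2 G x")
      case True
      then consider "?b = x" | "?b = twin G x" using bi incident_vert2[OF G e(1)] by auto
      then show ?thesis
      proof cases
        case 1
        then show ?thesis using x C_ident[OF e(1)] N_ident val_ident[OF G odd e(1)] by (simp add: gen_self)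
      next
        case 2
        then show ?thesis using True val_gen_twin[OF G odd e(1)] by (simp add: m_def)
      qed
    next
      case False
      then have v: "v = vert3 G x" using x by (simp add: incident_iff[OF G])
      then have "vert3 G ?b = vert3 G x" using bi incident_vert3[OF G e(1)] by auto
      then show ?thesis using C_vert3[OF e] val_gen_vert3[OF G odd e] v by simp
    qed
    then show "?b \<in> incident G v \<and> val G m (gen G x v ?b) = N (C (gen G x v ?b))" using bi by simp
  qed
  let ?v0 = "vert3 G x0"
  have NP: "N a \<in> PW ?v0 ?v0" if "a \<in> ?H x0 x0" for a
    using \<iota>_PW[OF \<alpha>_H[OF that]] by (simp add: N_def)
  have bij: "bij_betw (val G m) (?H x y) (PW ?v0 ?v0)" if xy: "x \<in> edges G" "y \<in> edges G" for x y
  proof -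
    have "bij_betw C (?H x y) (?H x0 x0)"
      by (rule bij_betwI[where g = "\<lambda>a. gpd_comp ?X (gpd_comp ?X (gpd_inv ?X (p x)) a) (p y)"])
        (use p'[OF xy(1)] p'[OF xy(2)] in \<open>auto simp: C_def gpd_hom_def fund.comp_assoc\<close>)
    from bij_betw_trans[OF bij_betw_trans[OF this \<alpha>_bij] \<iota>_bij[OF x0 x0]] show ?thesis
      by (subst bij_betw_cong) (auto simp: val gpd_hom_def N_def)
  qed
  have mP: "m x \<in> PW ?v0 ?v0" if "x \<in> edges G" for x
    using NP[OF C_H] gen_twin_hom[OF that] by (simp add: m_def gpd_hom_def)
  have mk: "marking G m (\<lambda>_. ?v0)"
    unfolding marking_def using G l odd bij mP by blast
  \<comment> \<open>The path chosen for \<open>x0\<close> itself need not be the identity, as it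
    runs through the base edge of its star; closing up therefore conjugates by this loop.\<close>
  let ?c = "- N (p x0)"
  have px: "p x0 \<in> ?H x0 x0" by (rule p[OF x0])
  have "val G m (snd (functor_id ?X) \<gamma>) = - ?c + N \<gamma> + ?c" if \<gamma>: "\<gamma> \<in> ?H x0 x0" for \<gamma>
  proof -
    have g: "\<gamma> \<in> gpd_mor ?X" "gpd_src ?X \<gamma> = x0" "gpd_tgt ?X \<gamma> = x0" using \<gamma> by (simp_all add: gpd_hom_def)
    have inv: "gpd_inv ?X (p x0) \<in> ?H x0 x0" using px by (simp add: gpd_hom_def)
    have "N (p x0) + N (gpd_inv ?X (p x0)) = 0" 
      using N_comp[OF px inv] p'[OF x0] N_ident by simp
    then have "N (gpd_inv ?X (p x0)) = - N (p x0)" by (simp add: minus_unique)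
    moreover have "N (C \<gamma>) = N (p x0) + N \<gamma> + N (gpd_inv ?X (p x0))"
      unfolding C_def g(2,3) using N_comp[OF comp_hom[OF px \<gamma>] inv] N_comp[OF px \<gamma>] by simp
    ultimately show ?thesis using val[OF g(1)] g(1) by (simp add: functor_id_def)
  qed
  moreover have "?c \<in> PW ?v0 ?v0" using NP[OF px] by simp
  moreover have "OMG_mor (G, l) (G, l) (functor_id ?X)" by (rule OMG_mor_cong) auto
  moreover have "fst (functor_id ?X) x0 = x0" using x0 by (simp add: functor_id_def)
  ultimately have "marked N x0 G m (\<lambda>_. ?v0)"
    unfolding marked_def using mk functor_id_iso[OF fund.gpd_axioms, of G] by blast
  then show ?thesis unfolding N_def by blast
qed

text \<open>Folding yields the conjugacy between \<open>F\<close> and \<open>\<alpha>\<close> only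
  in the ambient free group. As \<open>c\<close> is a morphism and \<open>\<iota>\<close> is
  faithful on loops at \<open>x0\<close>, the same equation holds in the fundamental group.\<close>

lemma natural_hom_surj:
  assumes fin: "finite (edges G)" and x0: "x0 \<in> edges G" and \<alpha>: "\<alpha> \<in> auto (pi1 G x0)"
  shows "\<exists>F. OMG_mor (G, l) (G, l) F \<and> natural_hom (FG G) x0 F = Inn (pi1 G x0) #>\<^bsub>AutoGroup (pi1 G x0)\<^esub> \<alpha>"
proof -
  obtain m \<phi> where "marked (\<lambda>\<gamma>. \<iota> (\<alpha> \<gamma>)) x0 G m \<phi>" using initial_marking[OF x0 \<alpha>] by blast
  from fold_completely[OF fin x0 this] obtain F c where F: "OMG_mor (G, l) (G, l) F" 
    "c \<in> gpd_hom (FG G) x0 (fst F x0)" 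
    "\<And>\<gamma>. \<gamma> \<in> gpd_hom (FG G) x0 x0 \<Longrightarrow> \<iota> (snd F \<gamma>) = - \<iota> c + \<iota> (\<alpha> \<gamma>) + \<iota> c" by blast
  have iso: "F \<in> gpd_iso (FG G) (FG G)" by (rule OMG_mor_iso(4)[OF F(1) G l fin])
  note fF = functorialD[OF gpd_iso_functorial[OF iso]]
  have pi: "carrier (pi1 G x0) = gpd_hom (FG G) x0 x0" by (simp add: pi1_def isotropy_def)
  have \<alpha>_H: "\<alpha> \<gamma> \<in> gpd_hom (FG G) x0 x0" if "\<gamma> \<in> gpd_hom (FG G) x0 x0" for \<gamma>
    using \<alpha> that by (auto simp: auto_def hom_def pi)
  have "gpd_comp (FG G) (gpd_comp (FG G) c (snd F \<gamma>)) (gpd_inv (FG G) c) = \<alpha> \<gamma>" 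
    if \<gamma>: "\<gamma> \<in> gpd_hom (FG G) x0 x0" for \<gamma>
  proof (rule \<iota>_inj[of _ x0 x0])
    have s: "snd F \<gamma> \<in> gpd_hom (FG G) (fst F x0) (fst F x0)" using fF \<gamma> by (simp add: gpd_hom_def)
    then show "gpd_comp (FG G) (gpd_comp (FG G) c (snd F \<gamma>)) (gpd_inv (FG G) c) \<in> gpd_hom (FG G) x0 x0"
      using F(2) by (simp add: gpd_hom_def)
    have "\<iota> (gpd_comp (FG G) (gpd_comp (FG G) c (snd F \<gamma>)) (gpd_inv (FG G) c)) = \<iota> c + \<iota> (snd F \<gamma>) + - \<iota> c"
      using s F(2) by (simp add: \<iota>_comp \<iota>_inv gpd_hom_def)
    also have "\<dots> = \<iota> (\<alpha> \<gamma>)" using F(3)[OF \<gamma>] by (simp add: add.assoc)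
    finally show "\<iota> (gpd_comp (FG G) (gpd_comp (FG G) c (snd F \<gamma>)) (gpd_inv (FG G) c)) = \<iota> (\<alpha> \<gamma>)" .
  qed (rule \<alpha>_H[OF \<gamma>])
  then have "(\<lambda>\<gamma>\<in>carrier (pi1 G x0). gpd_comp (FG G) (gpd_comp (FG G) c (snd F \<gamma>)) (gpd_inv (FG G) c)) = \<alpha>"
    using \<alpha> by (intro extensionalityI[of _ "carrier (pi1 G x0)"]) (auto simp: pi auto_def Bij_def)
  then have "natural_hom (FG G) x0 F = Inn (pi1 G x0) #>\<^bsub>AutoGroup (pi1 G x0)\<^esub> \<alpha>"
    using natural_hom_eq[OF fund.gpd_axioms iso _ F(2)] x0 by (simp add: pi1_def)
  then show ?thesis using F(1) by blast
qed

lemma natural_hom_epi: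
  assumes fin: "finite (edges G)" and x0: "x0 \<in> edges G"
  shows "natural_hom (FG G) x0 \<in> epi (OMG G l) (Out (pi1 G x0))"
  unfolding epi_iff_subset
proof (intro conjI subsetI)
  show "natural_hom (FG G) x0 \<in> hom (OMG G l) (Out (pi1 G x0))" by (rule natural_hom_OMG[OF G l fin x0])
  interpret P: group "pi1 G x0" unfolding pi1_def by (rule fund.group_isotropy) (use x0 in simp)
  fix C assume "C \<in> carrier (Out (pi1 G x0))"
  then obtain \<alpha> where \<alpha>: "\<alpha> \<in> auto (pi1 G x0)" "C = Inn (pi1 G x0) #>\<^bsub>AutoGroup (pi1 G x0)\<^esub> \<alpha>"
    by (auto simp: P.Out_simps RCOSETS_def)
  obtain F where "OMG_mor (G, l) (G, l) F" "natural_hom (FG G) x0 F = C" 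
    using natural_hom_surj[OF fin x0 \<alpha>(1)] \<alpha>(2) by blast
  then show "C \<in> natural_hom (FG G) x0 ` carrier (OMG G l)" by (auto simp: OMG_def intro!: image_eqI[of _ _ F])
qed

end


section \<open>Freeness of the fundamental group\<close>

locale rooted = labeled G l for G :: "('v, 'e) ribbon_graph" and l +
  fixes x0 :: 'e
  assumes fin: "finite (edges G)" and x0: "x0 \<in> edges G"
begin

definition "root = vert3 G x0"

definition "depth v = (LEAST n. \<exists>fs. chain G v fs root \<and> length fs = n)"

text \<open>The first edge of a shortest path to the root; these edges and their twins form a spanning
  tree.\<close>

definition "parent v = (SOME y. y \<in> edges G \<and> vert3 G y = v \<and> depth (vert3 G (twin G y)) < depth v)"

definition "up y \<longleftrightarrow> y \<in> edges G \<and> vert3 G y \<noteq> root \<and> y = parent (vert3 G y)"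

definition "tree = {y \<in> edges G. up y \<or> up (twin G y)}"

lemma ex_chain: "y \<in> edges G \<Longrightarrow> \<exists>fs. chain G (vert3 G y) fs root"
  using fund_connected[OF G _ x0, of y] normal_form_hom root_def by (metis ex_in_conv)

lemma depth_le: "chain G v fs root \<Longrightarrow> depth v \<le> length fs"
  unfolding depth_def by (rule Least_le) blast

lemma shortest: 
  assumes "y \<in> edges G" shows "\<exists>fs. chain G (vert3 G y) fs root \<and> length fs = depth (vert3 G y)"
  unfolding depth_def by (rule LeastI_ex) (use ex_chain[OF assms] in blast)

lemma parent:
  assumes "y \<in> edges G" "vert3 G y \<noteq> root"
  shows "parent (vert3 G y) \<in> edges G" "vert3 G (parent (vert3 G y)) = vert3 G y"
    "depth (vert3 G (twin G (parent (vert3 G y)))) < depth (vert3 G y)"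
proof -
  let ?P = "\<lambda>z. z \<in> edges G \<and> vert3 G z = vert3 G y \<and> depth (vert3 G (twin G z)) < depth (vert3 G y)"
  obtain fs where fs: "chain G (vert3 G y) fs root" "length fs = depth (vert3 G y)" using shortest[OF assms(1)] by blast
  then obtain f gs where f: "fs = f # gs" using assms(2) by (cases fs) auto
  then have "?P f" using fs depth_le[of "vert3 G (twin G f)" gs] by auto
  then have "?P (parent (vert3 G y))" unfolding parent_def by (rule someI)
  then show "parent (vert3 G y) \<in> edges G" "vert3 G (parent (vert3 G y)) = vert3 G y"
    "depth (vert3 G (twin G (parent (vert3 G y)))) < depth (vert3 G y)" by auto
qed

lemma up_depth: "up y \<Longrightarrow> depth (vert3 G (twin G y)) < depth (vert3 G y)"
  using parent(3)[of y] by (auto simp: up_def)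

lemma up_parent: "\<lbrakk>y \<in> edges G; vert3 G y \<noteq> root\<rbrakk> \<Longrightarrow> up (parent (vert3 G y))"
  using parent[of y] by (simp add: up_def)

lemma up_twin: "up y \<Longrightarrow> \<not> up (twin G y)"
  using up_depth[of y] up_depth[of "twin G y"] G by (auto simp: up_def)

lemma twin_tree: "y \<in> edges G \<Longrightarrow> twin G y \<in> tree \<longleftrightarrow> y \<in> tree"
  using G by (auto simp: tree_def)

text \<open>After a step away from the root, the only way up is the parent edge of the vertex
  reached, which is the step just taken backwards. So a tree path that starts downwards keeps
  descending.\<close>

lemma down_chain:
  "\<lbrakk>chain G p (f # fs) q; no_backtrack G (f # fs); set (f # fs) \<subseteq> tree; \<not> up f\<rbrakk> \<Longrightarrow> depth p < depth q"
proof (induction fs arbitrary: p f)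
  case Nil
  then show ?case using up_depth[of "twin G f"] G by (auto simp: tree_def)
next
  case (Cons g fs)
  have f: "f \<in> edges G" "up (twin G f)" using Cons.prems by (auto simp: tree_def)
  have g: "vert3 G g = vert3 G (twin G f)" "g \<noteq> twin G f" using Cons.prems by (auto simp: no_backtrack_Cons)
  have "\<not> up g" using f(2) g by (auto simp: up_def)
  moreover have "chain G (vert3 G (twin G f)) (g # fs) q" "no_backtrack G (g # fs)" "set (g # fs) \<subseteq> tree"
    using Cons.prems g by (auto simp: no_backtrack_Cons)
  ultimately have "depth (vert3 G (twin G f)) < depth q" using Cons.IH by blast
  moreover have "depth p < depth (vert3 G (twin G f))" using up_depth[OF f(2)] f(1) Cons.prems(1) G by auto
  ultimately show ?case by simp
qed

lemma no_backtrack_rev: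
  assumes "set fs \<subseteq> edges G" "no_backtrack G fs" 
  shows "no_backtrack G (rev (map (twin G) fs))"
proof -
  have "map l (rev (map (twin G) fs)) = inverse_word (map l fs)"
    using assms(1) by (auto simp: inverse_word_def rev_map)
  moreover have "reduced (inverse_word (map l fs))" using reduced_map_l[OF assms(1)] assms(2) by simp
  moreover have "set (rev (map (twin G) fs)) \<subseteq> edges G" using assms(1) G by auto
  ultimately show ?thesis using reduced_map_l by metis
qed

text \<open>A path in the tree without backtracking first goes up and then down. So if it is closed and
  nonempty, its last edge is the twin of its first one, and it can be shortened at both ends.\<close>

lemma tree_chain_closed:
  "\<lbrakk>chain G p fs p; no_backtrack G fs; set fs \<subseteq> tree\<rbrakk> \<Longrightarrow> fs = []"
proof (induction "length fs" arbitrary: fs p rule: less_induct)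
  case less
  \<comment> \<open>A first step downwards would make the end point strictly deeper than itself. So
    the first edge is the parent edge of \<open>p\<close>, and the same holds for the reversed
    path.\<close>
  have first_up: "up (hd gs) \<and> hd gs = parent p" if gs: "chain G p gs p" "no_backtrack G gs" "set gs \<subseteq> tree" "gs \<noteq> []" for gs
  proof -
    obtain f hs where f: "gs = f # hs" using gs(4) by (cases gs) auto
    have "up f" using down_chain[of p f hs p] gs f by auto
    then show ?thesis using gs(1) f by (auto simp: up_def)
  qed
  show ?case
  proof (rule ccontr)
    assume ne: "fs \<noteq> []"
    have E: "set fs \<subseteq> edges G" using less.prems(3) by (auto simp: tree_def)
    let ?r = "rev (map (twin G) fs)"
    have r: "set ?r \<subseteq> tree" "?r \<noteq> []" using less.prems(3) E ne twin_tree by auto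
    have "hd ?r = parent p" using first_up[OF chain_rev[OF less.prems(1)] no_backtrack_rev[OF E less.prems(2)] r] by simp
    then have "twin G (last fs) = hd fs" using first_up[OF less.prems ne] ne by (simp add: hd_rev last_map)
    moreover have last: "last fs \<in> edges G" using E ne by auto
    ultimately have lst: "last fs = twin G (hd fs)" using twin_twin[OF G last] by simp
    obtain f hs where f: "fs = f # hs" using ne by (cases fs) auto
    have "hs \<noteq> []" using lst f G E by auto
    then obtain gs where gs: "fs = f # gs @ [twin G f]" using lst f by (metis append_butlast_last_id last_ConsR list.sel(1))
    have fE: "f \<in> edges G" using E gs by auto
    have "chain G (vert3 G (twin G f)) gs (vert3 G (twin G f))" using less.prems(1) gs by (auto simp: chain_append)
    moreover have nb: "no_backtrack G gs" using less.prems(2) gs 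
      by (auto simp: no_backtrack_def successively_append_iff successively_Cons)
    ultimately have "gs = []" using less.hyps[of gs] less.prems(3) gs by auto
    then show False using less.prems(2) gs by (simp add: no_backtrack_def)
  qed
qed

text \<open>Each degree-3 vertex except the root contributes its parent edge and the twin of that
  edge, and no \<open>up\<close> edge is the twin of another.\<close>

lemma card_tree: "card tree + 2 = 2 * card (vert3 G ` edges G)"
proof -
  have inj: "inj_on (vert3 G) {y. up y}" by (rule inj_onI) (auto simp: up_def)
  have img: "vert3 G ` {y. up y} = vert3 G ` edges G - {root}"
  proof (intro equalityI subsetI)
    fix v assume "v \<in> vert3 G ` edges G - {root}"
    then obtain y where y: "y \<in> edges G" "v = vert3 G y" "vert3 G y \<noteq> root" by blast
    then show "v \<in> vert3 G ` {y. up y}" using up_parent[OF y(1,3)] parent(2)[OF y(1,3)]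
      by (intro image_eqI[of _ _ "parent (vert3 G y)"]) simp_all
  qed (auto simp: up_def)
  have finup: "finite {y. up y}" by (rule finite_subset[OF _ fin]) (auto simp: up_def)
  have root_in: "root \<in> vert3 G ` edges G" using x0 by (simp add: root_def)
  then have c1: "card {y. up y} + 1 = card (vert3 G ` edges G)"
    using card_image[OF inj] img fin card_Suc_Diff1[of "vert3 G ` edges G" root] by simp
  have "tree = {y. up y} \<union> twin G ` {y. up y}"
  proof (intro equalityI subsetI)
    fix y assume "y \<in> tree"
    then show "y \<in> {y. up y} \<union> twin G ` {y. up y}" using G by (auto simp: tree_def intro!: image_eqI[of _ _ "twin G y"])
  next
    fix y assume "y \<in> {y. up y} \<union> twin G ` {y. up y}"
    then show "y \<in> tree" using G by (auto simp: tree_def up_def[of y] up_def[of "twin G y"]) (auto simp: up_def)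
  qed
  moreover have "{y. up y} \<inter> twin G ` {y. up y} = {}" using up_twin by auto
  moreover have "card (twin G ` {y. up y}) = card {y. up y}"
    by (rule card_image) (use G in \<open>auto simp: inj_on_def up_def\<close>)
  ultimately have "card tree = 2 * card {y. up y}" using finup by (simp add: card_Un_disjoint)
  then show ?thesis using c1 by simp
qed

section \<open>Free generators from the edges outside the spanning tree\<close>

definition "outer = edges G - tree"

lemma twin_outer: "y \<in> outer \<Longrightarrow> twin G y \<in> outer"
  using twin_tree G by (auto simp: outer_def)

definition "indices = (fst \<circ> l) ` outer"

lemma l_outer: "l ` outer = indices \<times> UNIV"
proof (intro equalityI subsetI)
  fix s assume "s \<in> indices \<times> (UNIV :: bool set)"
  then obtain y where y: "y \<in> outer" "fst s = fst (l y)" by (auto simp: indices_def)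
  then have yE: "y \<in> edges G" by (simp add: outer_def)
  show "s \<in> l ` outer"
  proof (cases "snd s = snd (l y)")
    case True
    then show ?thesis using y by (intro image_eqI[of _ _ y]) (simp_all add: prod_eq_iff)
  next
    case False
    then have "s = l (twin G y)" using y yE by (cases s; cases "l y") auto
    then show ?thesis using twin_outer[OF y(1)] by blast
  qed
qed (auto simp: indices_def image_iff intro: bexI; metis fst_conv)

text \<open>With V vertices of degree 3 there are 3V edges, of which 2V - 2 lie in the tree. The
  remaining V + 2 form twin pairs, one pair for each index.\<close>

lemma card_indices: "2 * card indices = card (vert3 G ` edges G) + 2"
proof -
  have "card (l ` outer) = card outer" 
    by (rule card_image) (use l_inj in \<open>auto simp: outer_def intro: inj_on_subset\<close>)
  then have "2 * card indices = card outer" unfolding l_outer by (simp add: card_cartesian_product)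
  moreover have "card outer + card tree = card (edges G)"
  proof -
    have "tree \<subseteq> edges G" by (auto simp: tree_def)
    then show ?thesis unfolding outer_def 
      using card_Diff_subset[of tree "edges G"] card_mono[OF fin, of tree] finite_subset[OF _ fin] by simp
  qed
  ultimately show ?thesis using card_tree card_edges_vert3[OF G fin] by simp
qed

context
  fixes h r
  assumes h: "bij_betw h indices {..<(r::nat)}"
begin

definition "letter y = (h (fst (l y)), snd (l y))"

text \<open>Collapses the spanning tree: its edges become trivial and each outer twin pair becomes a
  free generator, renumbered by \<open>h\<close>.\<close>

definition "\<mu> y = (if y \<in> outer then lt (letter y) else 0)"

lemma letter_twin: "y \<in> edges G \<Longrightarrow> letter (twin G y) = inverse_letter (letter y)"
  by (cases "l y") (simp add: letter_def)

lemma letter_inj: "inj_on letter outer"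
proof (rule inj_onI)
  fix y z assume yz: "y \<in> outer" "z \<in> outer" "letter y = letter z"
  then have "fst (l y) \<in> indices" "fst (l z) \<in> indices" by (auto simp: indices_def)
  then have "l y = l z" using yz(3) h by (auto simp: letter_def bij_betw_def inj_on_def prod_eq_iff)
  then show "y = z" using yz l_eq_iff by (auto simp: outer_def)
qed

lemma letter_image: "letter ` outer = {..<r} \<times> UNIV"
proof -
  have "letter ` outer = map_prod h id ` l ` outer" by (auto simp: letter_def image_iff map_prod_def case_prod_unfold)
  also have "\<dots> = {..<r} \<times> UNIV" unfolding l_outer using h by (auto simp: bij_betw_def image_iff) (metis imageE lessThan_iff)
  finally show ?thesis .
qed

lemma \<mu>_odd: "twin_odd G \<mu>"
  unfolding twin_odd_def
proof
  fix y assume y: "y \<in> edges G"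
  have "twin G y \<in> outer \<longleftrightarrow> y \<in> outer" using twin_tree[OF y] y G by (simp add: outer_def)
  then show "\<mu> (twin G y) = - \<mu> y" using letter_twin[OF y] by (simp add: \<mu>_def lt_inverse)
qed

text \<open>If two consecutive outer edges cancelled, the tree edges between them would form a
  closed path without backtracking, which is empty. The two outer edges would then already be
  adjacent twins in the chain.\<close>

lemma reduced_outer:
  "\<lbrakk>chain G p fs q; no_backtrack G fs\<rbrakk> \<Longrightarrow> reduced (map letter (filter (\<lambda>y. y \<in> outer) fs))"
proof (induction fs arbitrary: p)
  case (Cons f fs)
  have IH: "reduced (map letter (filter (\<lambda>y. y \<in> outer) fs))" using Cons by (auto simp: no_backtrack_Cons)
  show ?case
  proof (cases "f \<in> outer \<and> filter (\<lambda>y. y \<in> outer) fs \<noteq> []")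
    case True
    then obtain g gs where g: "filter (\<lambda>y. y \<in> outer) fs = g # gs" by (cases "filter (\<lambda>y. y \<in> outer) fs") auto
    then obtain ts us where ts: "fs = ts @ g # us" "\<forall>t\<in>set ts. t \<notin> outer" "g \<in> outer"
      by (auto simp: filter_eq_Cons_iff)
    have fE: "f \<in> edges G" using Cons.prems by simp
    have "g \<noteq> twin G f"
    proof
      assume gf: "g = twin G f"
      have c: "chain G (vert3 G (twin G f)) ts (vert3 G (twin G f))"
        using Cons.prems(1) ts(1) gf by (auto simp: chain_append)
      moreover have "no_backtrack G ts" using Cons.prems(2) ts(1) 
        by (auto simp: no_backtrack_def successively_append_iff successively_Cons)
      moreover have "set ts \<subseteq> tree" using chain_edges[OF c] ts(2) by (auto simp: outer_def)
      ultimately have "ts = []" by (rule tree_chain_closed)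
      then show False using Cons.prems(2) ts(1) gf by (simp add: no_backtrack_Cons)
    qed
    then have "letter g \<noteq> letter (twin G f)" 
      using letter_inj ts(3) twin_outer[of f] True by (auto simp: inj_on_def)
    then have "letter g \<noteq> inverse_letter (letter f)" using letter_twin[OF fE] by simp
    then show ?thesis using True IH g by (simp add: reduced_Cons)
  next
    case False
    then show ?thesis using IH by (auto simp: reduced_Cons)
  qed
qed simp

lemma val_word:
  assumes "chain G p fs q" "no_backtrack G fs"
  shows "word (sum_list (map \<mu> fs)) = map letter (filter (\<lambda>y. y \<in> outer) fs)"
proof -
  have "sum_list (map \<mu> fs) = sum_list (map lt (map letter (filter (\<lambda>y. y \<in> outer) fs)))"
    by (induction fs) (auto simp: \<mu>_def)
  then show ?thesis using word_sum_list[OF reduced_outer[OF assms]] by simp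
qed

text \<open>A loop with value 0 crosses no outer edge, so it lies in the tree, where closed normal
  forms are empty.\<close>

lemma val_zero:
  assumes "\<gamma> \<in> gpd_hom (FG G) x0 x0" "val G \<mu> \<gamma> = 0" 
  shows "\<gamma> = gpd_ident (FG G) x0"
proof -
  obtain fs where fs: "chain G root fs root" "no_backtrack G fs" "\<gamma> = chain_class G x0 fs x0"
    using normal_form_hom[OF assms(1)] unfolding root_def by metis
  have "sum_list (map \<mu> fs) = 0" using val_chain_class[OF \<mu>_odd x0 x0, of fs] fs assms(2) by (simp add: root_def)
  then have "filter (\<lambda>y. y \<in> outer) fs = []" using val_word[OF fs(1,2)] by simp
  then have "set fs \<subseteq> tree" using chain_edges[OF fs(1)] by (auto simp: filter_empty_conv outer_def)
  then have "fs = []" using tree_chain_closed[OF fs(1,2)] by simp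
  then show ?thesis using fs(3) x0 G by (simp add: gen_self)
qed

text \<open>Follow parent edges, by induction on the depth: all crossings lie in the tree, and turns
  inside stars have value 0.\<close>

lemma tree_path: "y \<in> edges G \<Longrightarrow> \<exists>c\<in>gpd_hom (FG G) x0 y. val G \<mu> c = 0"
proof (induction "depth (vert3 G y)" arbitrary: y rule: less_induct)
  case less
  show ?case
  proof (cases "vert3 G y = root")
    case True
    then have "vert3 G y = vert3 G x0" by (simp add: root_def)
    then show ?thesis using gen_vert3_hom[OF x0 less.prems] val_gen_vert3[OF G \<mu>_odd x0 less.prems] by blast
  next
    case False
    let ?z = "parent (vert3 G y)"
    note z = parent[OF less.prems False]
    have t: "twin G ?z \<in> edges G" using z G by simp
    obtain c where c: "c \<in> gpd_hom (FG G) x0 (twin G ?z)" "val G \<mu> c = 0" using less.hyps[OF z(3) t] by blast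
    have g: "gen G (twin G ?z) (vert2 G (twin G ?z)) ?z \<in> gpd_hom (FG G) (twin G ?z) ?z" 
      "val G \<mu> (gen G (twin G ?z) (vert2 G (twin G ?z)) ?z) = \<mu> (twin G ?z)"
      using gen_twin_hom[OF t] val_gen_twin[OF G \<mu>_odd t] z(1) G by simp_all
    have "twin G ?z \<in> tree" using up_parent[OF less.prems False] z(1) G by (simp add: tree_def)
    then have m: "\<mu> (twin G ?z) = 0" by (simp add: \<mu>_def outer_def)
    have k: "gen G ?z (vert3 G ?z) y \<in> gpd_hom (FG G) ?z y" "val G \<mu> (gen G ?z (vert3 G ?z) y) = 0"
      using gen_vert3_hom[OF z(1) less.prems] val_gen_vert3[OF G \<mu>_odd z(1) less.prems] z(2) by simp_all
    have cg: "gpd_comp (FG G) c (gen G (twin G ?z) (vert2 G (twin G ?z)) ?z) \<in> gpd_hom (FG G) x0 ?z"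
      by (rule comp_hom[OF c(1) g(1)])
    have "val G \<mu> (gpd_comp (FG G) c (gen G (twin G ?z) (vert2 G (twin G ?z)) ?z)) = 0"
      using val_comp[OF G \<mu>_odd] c g m unfolding gpd_hom_def by auto
    then have "val G \<mu> (gpd_comp (FG G) (gpd_comp (FG G) c (gen G (twin G ?z) (vert2 G (twin G ?z)) ?z)) (gen G ?z (vert3 G ?z) y)) = 0"
      using val_comp[OF G \<mu>_odd] cg k unfolding gpd_hom_def by auto
    then show ?thesis using comp_hom[OF cg k(1)] by blast
  qed
qed

text \<open>A letter is realized by going through the tree to the corresponding outer edge, crossing
  it, and returning through the tree.\<close>

lemma val_surj:
  "\<lbrakk>reduced w; set w \<subseteq> {..<r} \<times> UNIV\<rbrakk> \<Longrightarrow> \<exists>\<gamma>\<in>gpd_hom (FG G) x0 x0. word (val G \<mu> \<gamma>) = w"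
proof (induction w)
  case Nil
  then show ?case using x0 val_ident[OF G \<mu>_odd x0] by (intro bexI[of _ "gpd_ident (FG G) x0"]) (auto simp: gpd_hom_def)
next
  case (Cons s w)
  then obtain \<gamma> where \<gamma>: "\<gamma> \<in> gpd_hom (FG G) x0 x0" "word (val G \<mu> \<gamma>) = w" by (auto simp: reduced_Cons)
  have "s \<in> letter ` outer" using Cons.prems letter_image by auto
  then obtain y where y: "y \<in> outer" "s = letter y" by blast
  have yE: "y \<in> edges G" "twin G y \<in> edges G" using y G by (auto simp: outer_def)
  obtain c where c: "c \<in> gpd_hom (FG G) x0 y" "val G \<mu> c = 0" using tree_path[OF yE(1)] by blast
  obtain d where d: "d \<in> gpd_hom (FG G) x0 (twin G y)" "val G \<mu> d = 0" using tree_path[OF yE(2)] by blast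
  have d': "gpd_inv (FG G) d \<in> gpd_hom (FG G) (twin G y) x0" "val G \<mu> (gpd_inv (FG G) d) = 0"
    using d val_inv[OF G \<mu>_odd, of d] by (simp_all add: gpd_hom_def)
  let ?g = "gen G y (vert2 G y) (twin G y)"
  have g: "?g \<in> gpd_hom (FG G) y (twin G y)" "val G \<mu> ?g = lt s"
    using gen_twin_hom[OF yE(1)] val_gen_twin[OF G \<mu>_odd yE(1)] y by (simp_all add: \<mu>_def)
  let ?a = "gpd_comp (FG G) c (gpd_comp (FG G) ?g (gpd_comp (FG G) (gpd_inv (FG G) d) \<gamma>))"
  have 1: "gpd_comp (FG G) (gpd_inv (FG G) d) \<gamma> \<in> gpd_hom (FG G) (twin G y) x0" by (rule comp_hom[OF d'(1) \<gamma>(1)])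
  have 2: "gpd_comp (FG G) ?g (gpd_comp (FG G) (gpd_inv (FG G) d) \<gamma>) \<in> gpd_hom (FG G) y x0" by (rule comp_hom[OF g(1) 1])
  have 3: "?a \<in> gpd_hom (FG G) x0 x0" by (rule comp_hom[OF c(1) 2])
  have vc: "val G \<mu> (gpd_comp (FG G) a b) = val G \<mu> a + val G \<mu> b" 
    if "a \<in> gpd_hom (FG G) x y" "b \<in> gpd_hom (FG G) y z" for a b x y z
    using val_comp[OF G \<mu>_odd] that unfolding gpd_hom_def by auto
  have "val G \<mu> ?a = lt s + val G \<mu> \<gamma>"
    using vc[OF d'(1) \<gamma>(1)] vc[OF g(1) 1] vc[OF c(1) 2] c(2) d'(2) g(2) by simp
  then have "word (val G \<mu> ?a) = push_letter s w" using \<gamma>(2) by (simp add: word_lt_add)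
  also have "\<dots> = s # w" using Cons.prems(1) by (auto simp: reduced_Cons push_letter_Cons)
  finally show ?case using 3 by blast
qed

lemma pi1_iso: "(\<lambda>\<gamma>. word (val G \<mu> \<gamma>)) \<in> iso (pi1 G x0) (free_group {..<r})"
proof -
  have pi: "carrier (pi1 G x0) = gpd_hom (FG G) x0 x0" "\<And>a b. a \<otimes>\<^bsub>pi1 G x0\<^esub> b = gpd_comp (FG G) a b"
    by (simp_all add: pi1_def isotropy_def)
  have into: "word (val G \<mu> \<gamma>) \<in> carrier (free_group {..<r})" if \<gamma>: "\<gamma> \<in> gpd_hom (FG G) x0 x0" for \<gamma>
  proof -
    obtain fs where fs: "chain G root fs root" "no_backtrack G fs" "\<gamma> = chain_class G x0 fs x0"
      using normal_form_hom[OF \<gamma>] unfolding root_def by metis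
    have "val G \<mu> \<gamma> = sum_list (map \<mu> fs)" using val_chain_class[OF \<mu>_odd x0 x0, of fs] fs by (simp add: root_def)
    then have "word (val G \<mu> \<gamma>) = map letter (filter (\<lambda>y. y \<in> outer) fs)" using val_word[OF fs(1,2)] by simp
    then have "set (word (val G \<mu> \<gamma>)) \<subseteq> letter ` outer" by auto
    then show ?thesis unfolding letter_image by (simp add: free_group_simps)
  qed
  have vc: "val G \<mu> (gpd_comp (FG G) a b) = val G \<mu> a + val G \<mu> b" 
    if "a \<in> gpd_hom (FG G) x0 x0" "b \<in> gpd_hom (FG G) x0 x0" for a b
    using val_comp[OF G \<mu>_odd] that unfolding gpd_hom_def by auto
  have inj: "inj_on (\<lambda>\<gamma>. word (val G \<mu> \<gamma>)) (gpd_hom (FG G) x0 x0)"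
  proof (rule inj_onI)
    fix a b assume a: "a \<in> gpd_hom (FG G) x0 x0" and b: "b \<in> gpd_hom (FG G) x0 x0" and "word (val G \<mu> a) = word (val G \<mu> b)"
    then have eq: "val G \<mu> a = val G \<mu> b" by (simp add: word_inject)
    have ib: "gpd_inv (FG G) b \<in> gpd_hom (FG G) x0 x0" "val G \<mu> (gpd_inv (FG G) b) = - val G \<mu> b"
      using b val_inv[OF G \<mu>_odd, of b] by (simp_all add: gpd_hom_def)
    have "gpd_comp (FG G) a (gpd_inv (FG G) b) = gpd_ident (FG G) x0"
      by (rule val_zero[OF comp_hom[OF a ib(1)]]) (use vc[OF a ib(1)] ib(2) eq in simp)
    then have "gpd_inv (FG G) a = gpd_inv (FG G) b" using a ib(1) by (intro fund.inv_equality) (auto simp: gpd_hom_def)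
    then have "gpd_inv (FG G) (gpd_inv (FG G) a) = gpd_inv (FG G) (gpd_inv (FG G) b)" by (rule arg_cong)
    moreover have "a \<in> gpd_mor (FG G)" "b \<in> gpd_mor (FG G)" using a b by (simp_all add: gpd_hom_def)
    ultimately show "a = b" by (simp only: fund.inv_inv)
  qed
  have "(\<lambda>\<gamma>. word (val G \<mu> \<gamma>)) ` gpd_hom (FG G) x0 x0 = carrier (free_group {..<r})"
  proof (intro equalityI subsetI)
    fix w assume "w \<in> carrier (free_group {..<r})"
    then have w: "reduced w" "set w \<subseteq> {..<r} \<times> UNIV" by (auto simp: free_group_simps)
    then obtain \<gamma> where "\<gamma> \<in> gpd_hom (FG G) x0 x0" "word (val G \<mu> \<gamma>) = w" using val_surj[OF w] by blast
    then show "w \<in> (\<lambda>\<gamma>. word (val G \<mu> \<gamma>)) ` gpd_hom (FG G) x0 x0" by (intro image_eqI) simp_all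
  qed (use into in auto)
  then show ?thesis using inj into vc by (auto simp: iso_def hom_def bij_betw_def pi word_add free_group_simps)
qed

end

lemma pi1_free: "2 * r = card (vert3 G ` edges G) + 2 \<Longrightarrow> pi1 G x0 \<cong> free_group {..<r}"
proof -
  assume "2 * r = card (vert3 G ` edges G) + 2"
  then have "card indices = r" using card_indices by simp
  moreover have "finite indices" using fin by (auto simp: indices_def outer_def)
  ultimately obtain h where "bij_betw h indices {..<r}" by (metis bij_betw_iff_card card_lessThan finite_lessThan)
  then show ?thesis using pi1_iso unfolding is_iso_def by blast
qed

end

text \<open>With V vertices of degree 3 there are 3V edges and 3V/2 vertices of degree 2, so the
  graph has Euler characteristic -V/2. Gluing in \<open>n\<close> discs gives n - V/2 = 2 - 2g,
  hence V/2 + 1 = 2g + n - 1. In particular 2g + n is at least 2, so the subtraction of natural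
  numbers is genuine.\<close>

lemma rank_eq:
  assumes "modular_graph G" "finite (edges G)" "has_genus G g" "card (punctures G) = n" "r = 2 * g + n - 1"
  shows "2 * r = card (vert3 G ` edges G) + 2"
proof -
  let ?V2 = "card (vert2 G ` edges G)" and ?V3 = "card (vert3 G ` edges G)"
  have e: "card (edges G) = 3 * ?V3" "card (edges G) = 2 * ?V2" "card (verts G) = ?V2 + ?V3"
    using card_edges_vert3[OF assms(1,2)] card_edges_vert2[OF assms(1,2)] card_verts[OF assms(1,2)] by auto
  have "int (card (verts G)) - int (card (edges G)) + int n = 2 - 2 * int g"
    using assms(3,4) by (simp add: has_genus_def surface_euler_char_def)
  then show ?thesis using e assms(5) by linarith
qed

theorem theorem7p4:
  fixes G :: "('v, 'e) ribbon_graph" and l :: "'e \<Rightarrow> label" and x :: 'e and g n r :: nat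
  assumes "modular_graph G" and "finite (edges G)"
    and "has_genus G g" and "card (punctures G) = n" and "r = 2 * g + n - 1"
    and "labeling G l" and "x \<in> edges G"
  shows "group (OMG G l)
    \<and> natural_hom (fund_groupoid G) x \<in> epi (OMG G l) (Out (pi1 G x))
    \<and> pi1 G x \<cong> free_group {..<r}
    \<and> (\<exists>\<Phi>. \<Phi> \<in> epi (OMG G l) (Out (free_group {..<r})))"
proof -
  interpret rooted G l x using assms by unfold_locales
  have epi: "natural_hom (FG G) x \<in> epi (OMG G l) (Out (pi1 G x))"
    by (rule natural_hom_epi[OF assms(2,7)])
  have iso: "pi1 G x \<cong> free_group {..<r}" 
    by (rule pi1_free[OF rank_eq[OF assms(1-5)]])
  have "group (pi1 G x)" unfolding pi1_def by (rule fund.group_isotropy) (use assms(7) in simp)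
  then obtain \<Theta> where "\<Theta> \<in> epi (Out (pi1 G x)) (Out (free_group {..<r}))"
    using Out_iso_epi[OF _ group_free_group] iso unfolding is_iso_def by blast
  then have "\<exists>\<Phi>. \<Phi> \<in> epi (OMG G l) (Out (free_group {..<r}))" using epi_comp[OF epi] by blast
  then show ?thesis using group_OMG[OF assms(1,6,2)] epi iso by blast
qed

end
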